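(* Let $G$ be the HLS groupoid associated with an approximated group $(\Gamma,(K_n)_{n\in\mathbb N})$, $\Gamma$ countable, and let $\pi$ be a continuous unitary representation of $G$. Then $\pi$ is amenable if and only if $\tilde\pi$ is amenable, where $\tilde\pi$ is the restriction of $\pi$ to $\Gamma_\infty=\Gamma$.
   Context: HLS groupoid. An approximated group $(\Gamma,(K_n)_{n\in\mathbb N})$ is a discrete group $\Gamma$ with a decreasing sequence of finite-index normal subgroups $K_n$ with $\bigcap_nK_n=\{e\}$. Put $\Gamma_n=\Gamma/K_n$ with quotient map $q_n:\Gamma\to\Gamma_n$, and $\Gamma_\infty=\Gamma$, $q_\infty=\mathrm{id}_\Gamma$. The HLS groupoid is $G=\bigsqcup_{n\in\mathbb N\cup\{\infty\}}\{n\}\times\Gamma_n$, with topology generated by the singletons $\{(n,g)\}$, $n\in\mathbb N$, $g\in\Gamma_n$, and the sets $\{(n,q_n(g)):n\in\mathbb N\cup\{\infty\},\,n>N\}$, $g\in\Gamma$, $N\in\mathbb N$. Its unit space is $G^0=\{(n,e):n\in\mathbb N\cup\{\infty\}\}$, $d(n,g)=r(n,g)=(n,e)$, $(n,g)(n,h)=(n,gh)$, $(n,g)^{-1}=(n,g^{-1})$. It is a locally compact Hausdorff second countable étale groupoid; $G^0$ is identified with the one-point compactification of $\mathbb N$. Representations. A continuous Hilbert bundle over $G^0$ is a continuous field $\{\mathcal H_u\}_{u\in G^0}$ of separable Hilbert spaces; $C_0(G^0,\mathcal H)$ is its space of continuous sections vanishing at infinity, a left Hilbert $C_0(G^0)$-module.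 A continuous unitary representation $(\mathcal H^\pi,\pi)$ of a groupoid $G$ is a continuous Hilbert bundle over $G^0$ with unitaries $\pi(x):\mathcal H^\pi_{d(x)}\to\mathcal H^\pi_{r(x)}$ such that $\pi(u)=\mathrm{id}$ for $u\in G^0$, $\pi(xy)=\pi(x)\pi(y)$, $\pi(x)^{-1}=\pi(x^{-1})$, and $x\mapsto\langle\pi(x)\xi(d(x)),\eta(r(x))\rangle$ is continuous for $\xi,\eta\in C_0(G^0,\mathcal H^\pi)$. All representations are assumed to have all fibers non-zero and $C_0(G^0,\mathcal H^\pi)$ countably generated. Amenable representation. For $T$ adjointable on $C_0(G^0,\mathcal H^\pi)$, $T_u$ is its localization on $\mathcal H^\pi_u$, $(T\xi)(u)=T_u\xi(u)$. $T$ is Hilbert–Schmidt if $u\mapsto\operatorname{Tr}(|T_u|^2)$ lies in $C_0(G^0)$; $\|T_u\|_2=\operatorname{Tr}(|T_u|^2)^{1/2}$, $\|T\|_2=\sup_u\|T_u\|_2$. Put $x\cdot T_{d(x)}=\pi(x)T_{d(x)}\pi(x^{-1})$. $\pi$ is amenable if there is a net $\{T^i\}$ of Hilbert–Schmidt operators on $C_0(G^0,\mathcal H^\pi)$ with $\|T^i\|_2\le1$, $\|T^i_u\|_2\to1$ uniformly on compact subsets of $G^0$, and $\langle x\cdot T^i_{d(x)},T^i_{r(x)}\rangle\to1$ (Hilbert–Schmidt inner product) uniformly on compact subsets of $G$. The same definition is used for a group, viewed as a groupoid whose unit space is a point. *)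

theory Defs
  imports "HOL-Analysis.Analysis" "HOL-Algebra.Module" "HOL-Algebra.Coset"
begin

section \<open>Complex Hilbert spaces with explicit carriers\<close>

text \<open>
  The fibres of a Hilbert bundle vary with the base point, so Hilbert spaces are carrier-based.
  They extend the module record of HOL-Algebra, whose ring fields mult and one are unused.
  The inner product is linear in the first argument.
\<close>

definition complex_ring :: "complex ring" where
  "complex_ring = \<lparr>carrier = UNIV, mult = (*), one = 1, zero = 0, add = (+)\<rparr>"

record 'v hilbert = "(complex, 'v) module" +
  hinner :: "'v \<Rightarrow> 'v \<Rightarrow> complex"

definition hnorm :: "'v hilbert \<Rightarrow> 'v \<Rightarrow> real" where
  "hnorm H x = sqrt (Re (hinner H x x))"

definition hdist :: "'v hilbert \<Rightarrow> 'v \<Rightarrow> 'v \<Rightarrow> real" where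
  "hdist H x y = hnorm H (x \<ominus>\<^bsub>H\<^esub> y)"

locale complex_hilbert_space = Module.module complex_ring H for H :: "'v hilbert" (structure) +
  assumes hinner_add_left:
      "\<lbrakk>x \<in> carrier H; y \<in> carrier H; z \<in> carrier H\<rbrakk> \<Longrightarrow>
        hinner H (x \<oplus> y) z = hinner H x z + hinner H y z"
    and hinner_smult_left:
      "\<lbrakk>x \<in> carrier H; y \<in> carrier H\<rbrakk> \<Longrightarrow> hinner H (a \<odot> x) y = a * hinner H x y"
    and hinner_commute:
      "\<lbrakk>x \<in> carrier H; y \<in> carrier H\<rbrakk> \<Longrightarrow> hinner H x y = cnj (hinner H y x)"
    and hinner_nonneg: "x \<in> carrier H \<Longrightarrow> 0 \<le> Re (hinner H x x)"
    and hinner_eq_zero: "\<lbrakk>x \<in> carrier H; hinner H x x = 0\<rbrakk> \<Longrightarrow> x = \<zero>"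
    and complete:
      "\<lbrakk>\<And>n :: nat. s n \<in> carrier H;
        \<forall>\<epsilon>>0. \<exists>N. \<forall>m\<ge>N. \<forall>n\<ge>N. hdist H (s m) (s n) < \<epsilon>\<rbrakk> \<Longrightarrow>
        \<exists>x\<in>carrier H. (\<lambda>n. hdist H (s n) x) \<longlonglongrightarrow> 0"

definition dense_in_hilbert :: "'v hilbert \<Rightarrow> 'v set \<Rightarrow> bool" where
  "dense_in_hilbert H D \<longleftrightarrow>
     D \<subseteq> carrier H \<and> (\<forall>x\<in>carrier H. \<forall>\<epsilon>>0. \<exists>y\<in>D. hdist H x y < \<epsilon>)"

definition separable_hilbert :: "'v hilbert \<Rightarrow> bool" where
  "separable_hilbert H \<longleftrightarrow> (\<exists>D. countable D \<and> dense_in_hilbert H D)"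

definition unitary_between :: "'v hilbert \<Rightarrow> 'v hilbert \<Rightarrow> ('v \<Rightarrow> 'v) \<Rightarrow> bool" where
  "unitary_between H H' U \<longleftrightarrow>
     bij_betw U (carrier H) (carrier H') \<and>
     (\<forall>x\<in>carrier H. \<forall>y\<in>carrier H. U (x \<oplus>\<^bsub>H\<^esub> y) = U x \<oplus>\<^bsub>H'\<^esub> U y) \<and>
     (\<forall>a. \<forall>x\<in>carrier H. U (a \<odot>\<^bsub>H\<^esub> x) = a \<odot>\<^bsub>H'\<^esub> U x) \<and>
     (\<forall>x\<in>carrier H. \<forall>y\<in>carrier H. hinner H' (U x) (U y) = hinner H x y)"

text \<open>An orthonormal basis is a maximal orthonormal set.\<close>

definition orthonormal_basis :: "'v hilbert \<Rightarrow> 'v set \<Rightarrow> bool" where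
  "orthonormal_basis H B \<longleftrightarrow>
     B \<subseteq> carrier H \<and>
     (\<forall>x\<in>B. \<forall>y\<in>B. hinner H x y = (if x = y then 1 else 0)) \<and>
     (\<forall>v\<in>carrier H. (\<forall>x\<in>B. hinner H v x = 0) \<longrightarrow> v = \<zero>\<^bsub>H\<^esub>)"

definition chosen_basis :: "'v hilbert \<Rightarrow> 'v set" where
  "chosen_basis H = (SOME B. orthonormal_basis H B)"

definition hadjoint :: "'v hilbert \<Rightarrow> ('v \<Rightarrow> 'v) \<Rightarrow> 'v \<Rightarrow> 'v" where
  "hadjoint H S y = (THE z. z \<in> carrier H \<and> (\<forall>x\<in>carrier H. hinner H (S x) y = hinner H x z))"

definition htrace :: "'v hilbert \<Rightarrow> ('v \<Rightarrow> 'v) \<Rightarrow> complex" where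
  "htrace H S = (\<Sum>\<^sub>\<infinity>e\<in>chosen_basis H. hinner H (S e) e)"

text \<open>
  Since infsum is 0 for a family that is not summable, finiteness of a trace is a separate
  condition. For a positive operator it does not depend on the orthonormal basis.
\<close>

definition finite_htrace :: "'v hilbert \<Rightarrow> ('v \<Rightarrow> 'v) \<Rightarrow> bool" where
  "finite_htrace H S \<longleftrightarrow> (\<lambda>e. hinner H (S e) e) summable_on chosen_basis H"

definition abs_square :: "'v hilbert \<Rightarrow> ('v \<Rightarrow> 'v) \<Rightarrow> 'v \<Rightarrow> 'v" where
  "abs_square H S = hadjoint H S \<circ> S"

definition hs_norm :: "'v hilbert \<Rightarrow> ('v \<Rightarrow> 'v) \<Rightarrow> real" where
  "hs_norm H S = sqrt (Re (htrace H (abs_square H S)))"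

definition hs_inner :: "'v hilbert \<Rightarrow> ('v \<Rightarrow> 'v) \<Rightarrow> ('v \<Rightarrow> 'v) \<Rightarrow> complex" where
  "hs_inner H S R = htrace H (hadjoint H R \<circ> S)"


section \<open>Continuous Hilbert bundles\<close>

definition C0 :: "'u topology \<Rightarrow> ('u \<Rightarrow> complex) set" where
  "C0 X = {f. continuous_map X euclidean f \<and>
     (\<forall>\<epsilon>>0. \<exists>C. compactin X C \<and> (\<forall>u\<in>topspace X - C. cmod (f u) < \<epsilon>))}"

text \<open>
  Sections are extensional functions on the base. All fibres live in one type, which can always
  be arranged by taking their disjoint union.
\<close>

record ('u, 'v) hilbert_bundle =
  fibre :: "'u \<Rightarrow> 'v hilbert"
  csections :: "('u \<Rightarrow> 'v) set"

text \<open>Continuous fields of separable Hilbert spaces in the sense of Dixmier.\<close>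

locale continuous_hilbert_bundle =
  fixes X :: "'u topology" and E :: "('u, 'v) hilbert_bundle"
  assumes fibre_hilbert: "u \<in> topspace X \<Longrightarrow> complex_hilbert_space (fibre E u)"
    and fibre_separable: "u \<in> topspace X \<Longrightarrow> separable_hilbert (fibre E u)"
    and csections_subset: "csections E \<subseteq> (\<Pi>\<^sub>E u\<in>topspace X. carrier (fibre E u))"
    and csections_zero: "(\<lambda>u\<in>topspace X. \<zero>\<^bsub>fibre E u\<^esub>) \<in> csections E"
    and csections_add: "\<lbrakk>\<xi> \<in> csections E; \<eta> \<in> csections E\<rbrakk> \<Longrightarrow>
        (\<lambda>u\<in>topspace X. \<xi> u \<oplus>\<^bsub>fibre E u\<^esub> \<eta> u) \<in> csections E"
    and csections_smult: "\<xi> \<in> csections E \<Longrightarrow>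
        (\<lambda>u\<in>topspace X. a \<odot>\<^bsub>fibre E u\<^esub> \<xi> u) \<in> csections E"
    and csections_dense: "u \<in> topspace X \<Longrightarrow>
        dense_in_hilbert (fibre E u) ((\<lambda>\<xi>. \<xi> u) ` csections E)"
    and csections_norm: "\<xi> \<in> csections E \<Longrightarrow>
        continuous_map X euclidean (\<lambda>u. hnorm (fibre E u) (\<xi> u))"
    and csections_local:
      "\<lbrakk>\<xi> \<in> (\<Pi>\<^sub>E u\<in>topspace X. carrier (fibre E u));
        \<forall>u\<in>topspace X. \<forall>\<epsilon>>0. \<exists>\<eta>\<in>csections E. \<exists>W. openin X W \<and> u \<in> W \<and>
          (\<forall>w\<in>W. hdist (fibre E w) (\<xi> w) (\<eta> w) \<le> \<epsilon>)\<rbrakk> \<Longrightarrow> \<xi> \<in> csections E"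

definition C0_sections :: "'u topology \<Rightarrow> ('u, 'v) hilbert_bundle \<Rightarrow> ('u \<Rightarrow> 'v) set" where
  "C0_sections X E = {\<xi> \<in> csections E.
     \<forall>\<epsilon>>0. \<exists>C. compactin X C \<and> (\<forall>u\<in>topspace X - C. hnorm (fibre E u) (\<xi> u) < \<epsilon>)}"

definition closed_C0_submodule ::
    "'u topology \<Rightarrow> ('u, 'v) hilbert_bundle \<Rightarrow> ('u \<Rightarrow> 'v) set \<Rightarrow> bool" where
  "closed_C0_submodule X E M \<longleftrightarrow>
     M \<subseteq> C0_sections X E \<and>
     (\<lambda>u\<in>topspace X. \<zero>\<^bsub>fibre E u\<^esub>) \<in> M \<and>
     (\<forall>\<xi>\<in>M. \<forall>\<eta>\<in>M. (\<lambda>u\<in>topspace X. \<xi> u \<oplus>\<^bsub>fibre E u\<^esub> \<eta> u) \<in> M) \<and>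
     (\<forall>a. \<forall>\<xi>\<in>M. (\<lambda>u\<in>topspace X. a \<odot>\<^bsub>fibre E u\<^esub> \<xi> u) \<in> M) \<and>
     (\<forall>f\<in>C0 X. \<forall>\<xi>\<in>M. (\<lambda>u\<in>topspace X. f u \<odot>\<^bsub>fibre E u\<^esub> \<xi> u) \<in> M) \<and>
     (\<forall>\<xi>\<in>C0_sections X E.
        (\<forall>\<epsilon>>0. \<exists>\<eta>\<in>M. \<forall>u\<in>topspace X. hdist (fibre E u) (\<xi> u) (\<eta> u) < \<epsilon>) \<longrightarrow> \<xi> \<in> M)"

definition countably_generated :: "'u topology \<Rightarrow> ('u, 'v) hilbert_bundle \<Rightarrow> bool" where
  "countably_generated X E \<longleftrightarrow>
     (\<exists>S. countable S \<and> S \<subseteq> C0_sections X E \<and>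
        (\<forall>M. closed_C0_submodule X E M \<and> S \<subseteq> M \<longrightarrow> M = C0_sections X E))"

definition adjointable ::
    "'u topology \<Rightarrow> ('u, 'v) hilbert_bundle \<Rightarrow> (('u \<Rightarrow> 'v) \<Rightarrow> 'u \<Rightarrow> 'v) \<Rightarrow> bool" where
  "adjointable X E T \<longleftrightarrow>
     T \<in> C0_sections X E \<rightarrow> C0_sections X E \<and>
     (\<exists>T' \<in> C0_sections X E \<rightarrow> C0_sections X E.
        \<forall>\<xi>\<in>C0_sections X E. \<forall>\<eta>\<in>C0_sections X E. \<forall>u\<in>topspace X.
          hinner (fibre E u) (T \<xi> u) (\<eta> u) = hinner (fibre E u) (\<xi> u) (T' \<eta> u))"

text \<open>
  The value at v of the localization of T at u is (T \<xi>)(u) for any \<xi> with \<xi>(u) = v. Over a locally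
  compact Hausdorff base such \<xi> exists, and adjointability of T makes the result independent of it.
\<close>

definition localization ::
    "'u topology \<Rightarrow> ('u, 'v) hilbert_bundle \<Rightarrow> (('u \<Rightarrow> 'v) \<Rightarrow> 'u \<Rightarrow> 'v) \<Rightarrow> 'u \<Rightarrow> 'v \<Rightarrow> 'v" where
  "localization X E T u v = (THE w. \<exists>\<xi>\<in>C0_sections X E. \<xi> u = v \<and> T \<xi> u = w)"

definition hilbert_schmidt ::
    "'u topology \<Rightarrow> ('u, 'v) hilbert_bundle \<Rightarrow> (('u \<Rightarrow> 'v) \<Rightarrow> 'u \<Rightarrow> 'v) \<Rightarrow> bool" where
  "hilbert_schmidt X E T \<longleftrightarrow>
     adjointable X E T \<and>
     (\<forall>u\<in>topspace X. finite_htrace (fibre E u) (abs_square (fibre E u) (localization X E T u))) \<and>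
     (\<lambda>u. htrace (fibre E u) (abs_square (fibre E u) (localization X E T u))) \<in> C0 X"

definition bundle_hs_norm ::
    "'u topology \<Rightarrow> ('u, 'v) hilbert_bundle \<Rightarrow> (('u \<Rightarrow> 'v) \<Rightarrow> 'u \<Rightarrow> 'v) \<Rightarrow> real" where
  "bundle_hs_norm X E T = (SUP u\<in>topspace X. hs_norm (fibre E u) (localization X E T u))"


section \<open>Representations of topological groupoids\<close>

text \<open>Multiplication of x and y is meaningful when the domain of x is the range of y.\<close>

record 'g groupoid =
  gtop :: "'g topology"
  gdom :: "'g \<Rightarrow> 'g"
  grng :: "'g \<Rightarrow> 'g"
  gmult :: "'g \<Rightarrow> 'g \<Rightarrow> 'g"
  ginv :: "'g \<Rightarrow> 'g"

abbreviation arrows :: "'g groupoid \<Rightarrow> 'g set" where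
  "arrows G \<equiv> topspace (gtop G)"

definition units :: "'g groupoid \<Rightarrow> 'g set" where
  "units G = gdom G ` arrows G"

definition unit_space :: "'g groupoid \<Rightarrow> 'g topology" where
  "unit_space G = subtopology (gtop G) (units G)"

locale continuous_unitary_rep =
  continuous_hilbert_bundle "unit_space G" E
  for G :: "'g groupoid" and E :: "('g, 'v) hilbert_bundle" +
  fixes \<pi> :: "'g \<Rightarrow> 'v \<Rightarrow> 'v"
  assumes fibre_nonzero: "u \<in> units G \<Longrightarrow> carrier (fibre E u) \<noteq> {\<zero>\<^bsub>fibre E u\<^esub>}"
    and countably_generated: "countably_generated (unit_space G) E"
    and rep_unitary: "x \<in> arrows G \<Longrightarrow>
        unitary_between (fibre E (gdom G x)) (fibre E (grng G x)) (\<pi> x)"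
    and rep_unit: "\<lbrakk>u \<in> units G; v \<in> carrier (fibre E u)\<rbrakk> \<Longrightarrow> \<pi> u v = v"
    and rep_mult: "\<lbrakk>x \<in> arrows G; y \<in> arrows G; gdom G x = grng G y;
        v \<in> carrier (fibre E (gdom G y))\<rbrakk> \<Longrightarrow> \<pi> (gmult G x y) v = \<pi> x (\<pi> y v)"
    and rep_inv: "\<lbrakk>x \<in> arrows G; v \<in> carrier (fibre E (grng G x))\<rbrakk> \<Longrightarrow>
        \<pi> (ginv G x) v = inv_into (carrier (fibre E (gdom G x))) (\<pi> x) v"
    and rep_continuous:
      "\<lbrakk>\<xi> \<in> C0_sections (unit_space G) E; \<eta> \<in> C0_sections (unit_space G) E\<rbrakk> \<Longrightarrow>
        continuous_map (gtop G) euclidean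
          (\<lambda>x. hinner (fibre E (grng G x)) (\<pi> x (\<xi> (gdom G x))) (\<eta> (grng G x)))"

definition translate ::
    "'g groupoid \<Rightarrow> ('g \<Rightarrow> 'v \<Rightarrow> 'v) \<Rightarrow> 'g \<Rightarrow> ('v \<Rightarrow> 'v) \<Rightarrow> 'v \<Rightarrow> 'v" where
  "translate G \<pi> x S = \<pi> x \<circ> S \<circ> \<pi> (ginv G x)"

text \<open>
  A net of operators enters only through what holds eventually along it, so it is given as a
  proper filter on operators: the tails of a net generate such a filter, and every proper filter
  arises in this way. This avoids fixing a type of indices.
\<close>

definition amenable_rep ::
    "'g groupoid \<Rightarrow> ('g, 'v) hilbert_bundle \<Rightarrow> ('g \<Rightarrow> 'v \<Rightarrow> 'v) \<Rightarrow> bool" where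
  "amenable_rep G E \<pi> \<longleftrightarrow>
     (let X = unit_space G; loc = localization X E in
      \<exists>F :: (('g \<Rightarrow> 'v) \<Rightarrow> 'g \<Rightarrow> 'v) filter. F \<noteq> bot \<and>
        (\<forall>\<^sub>F T in F. hilbert_schmidt X E T \<and> bundle_hs_norm X E T \<le> 1) \<and>
        (\<forall>C. compactin X C \<longrightarrow>
           uniform_limit C (\<lambda>T u. hs_norm (fibre E u) (loc T u)) (\<lambda>_. 1) F) \<and>
        (\<forall>C. compactin (gtop G) C \<longrightarrow>
           uniform_limit C
             (\<lambda>T x. hs_inner (fibre E (grng G x))
                (translate G \<pi> x (loc T (gdom G x))) (loc T (grng G x)))
             (\<lambda>_. 1) F))"


section \<open>HLS groupoids\<close>

definition approximated_group :: "('a, 'm) monoid_scheme \<Rightarrow> (nat \<Rightarrow> 'a set) \<Rightarrow> bool" where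
  "approximated_group \<Gamma> K \<longleftrightarrow>
     group \<Gamma> \<and> (\<forall>n. K n \<lhd> \<Gamma> \<and> finite (rcosets\<^bsub>\<Gamma>\<^esub> (K n))) \<and> decseq K \<and>
     (\<Inter>n. K n) = {\<one>\<^bsub>\<Gamma>\<^esub>}"

text \<open>The pairs (n, g) with n finite, respectively (\<open>\<infinity>\<close>, g).\<close>

datatype 'a hls = At nat "'a set" | AtInfty 'a

definition hls_topology ::
    "('a, 'm) monoid_scheme \<Rightarrow> (nat \<Rightarrow> 'a set) \<Rightarrow> 'a hls topology" where
  "hls_topology \<Gamma> K = topology_generated_by
     ({{At n c} | n c. c \<in> carrier (\<Gamma> Mod K n)} \<union>
      {insert (AtInfty g) {At n (K n #>\<^bsub>\<Gamma>\<^esub> g) | n. n > N} | g N. g \<in> carrier \<Gamma>})"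

fun hls_base :: "('a, 'm) monoid_scheme \<Rightarrow> (nat \<Rightarrow> 'a set) \<Rightarrow> 'a hls \<Rightarrow> 'a hls" where
  "hls_base \<Gamma> K (At n c) = At n \<one>\<^bsub>\<Gamma> Mod K n\<^esub>"
| "hls_base \<Gamma> K (AtInfty g) = AtInfty \<one>\<^bsub>\<Gamma>\<^esub>"

fun hls_mult :: "('a, 'm) monoid_scheme \<Rightarrow> (nat \<Rightarrow> 'a set) \<Rightarrow> 'a hls \<Rightarrow> 'a hls \<Rightarrow> 'a hls" where
  "hls_mult \<Gamma> K (At n c) (At m c') = (if n = m then At n (c \<otimes>\<^bsub>\<Gamma> Mod K n\<^esub> c') else undefined)"
| "hls_mult \<Gamma> K (AtInfty g) (AtInfty h) = AtInfty (g \<otimes>\<^bsub>\<Gamma>\<^esub> h)"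
| "hls_mult \<Gamma> K _ _ = undefined"

fun hls_inv :: "('a, 'm) monoid_scheme \<Rightarrow> (nat \<Rightarrow> 'a set) \<Rightarrow> 'a hls \<Rightarrow> 'a hls" where
  "hls_inv \<Gamma> K (At n c) = At n (inv\<^bsub>\<Gamma> Mod K n\<^esub> c)"
| "hls_inv \<Gamma> K (AtInfty g) = AtInfty (inv\<^bsub>\<Gamma>\<^esub> g)"

definition hls_groupoid ::
    "('a, 'm) monoid_scheme \<Rightarrow> (nat \<Rightarrow> 'a set) \<Rightarrow> 'a hls groupoid" where
  "hls_groupoid \<Gamma> K =
     \<lparr>gtop = hls_topology \<Gamma> K, gdom = hls_base \<Gamma> K, grng = hls_base \<Gamma> K,
      gmult = hls_mult \<Gamma> K, ginv = hls_inv \<Gamma> K\<rparr>"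

definition group_groupoid :: "('a, 'm) monoid_scheme \<Rightarrow> 'a groupoid" where
  "group_groupoid \<Gamma> =
     \<lparr>gtop = discrete_topology (carrier \<Gamma>), gdom = (\<lambda>_. \<one>\<^bsub>\<Gamma>\<^esub>), grng = (\<lambda>_. \<one>\<^bsub>\<Gamma>\<^esub>),
      gmult = mult \<Gamma>, ginv = m_inv \<Gamma>\<rparr>"

text \<open>Over the one-point unit space of a group, every vector of the fibre is a continuous section.\<close>

definition bundle_at_infinity ::
    "('a, 'm) monoid_scheme \<Rightarrow> ('a hls, 'v) hilbert_bundle \<Rightarrow> ('a, 'v) hilbert_bundle" where
  "bundle_at_infinity \<Gamma> E =
     \<lparr>fibre = (\<lambda>_. fibre E (AtInfty \<one>\<^bsub>\<Gamma>\<^esub>)),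
      csections = (\<Pi>\<^sub>E u\<in>{\<one>\<^bsub>\<Gamma>\<^esub>}. carrier (fibre E (AtInfty \<one>\<^bsub>\<Gamma>\<^esub>)))\<rparr>"

definition rep_at_infinity :: "('a hls \<Rightarrow> 'v \<Rightarrow> 'v) \<Rightarrow> 'a \<Rightarrow> 'v \<Rightarrow> 'v" where
  "rep_at_infinity \<pi> g = \<pi> (AtInfty g)"

end

theory Submission
  imports Defs
begin

text \<open>
  Localizing at infinity turns a net for the groupoid into a net for the group. Conversely, let
  \<open>S\<close> be an almost invariant Hilbert-Schmidt operator on the fibre at infinity. Up to a small error
  it has finite rank, \<open>\<Sum>\<^sub>i \<langle>\<cdot>, b\<^sub>i\<rangle> a\<^sub>i\<close>, and all \<open>a\<^sub>i\<close>, \<open>b\<^sub>i\<close> extend to continuous sections. On the fibre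
  over \<open>n\<close>, the Hilbert-Schmidt inner product of the extended operator with its translate by
  \<open>q\<^sub>n(g)\<close> is a polynomial in matrix coefficients, hence converges to the inner product at infinity as
  \<open>n\<close> grows. So after normalization the extended operator is almost invariant over all but finitely
  many \<open>n\<close>. Over the remaining isolated points it is replaced by an invariant operator of norm 1,
  which exists because the quotients of \<open>\<Gamma>\<close> are finite. Since a compact set of arrows meets only the
  translates by finitely many \<open>g\<close>, this gives the required net.
\<close>

section \<open>Orthonormal bases and Parseval's identity\<close>

text \<open>The fibres over different units are unrelated Hilbert spaces: the bundle compares them
  only through norms of continuous sections, and the representation only through matrix coefficients
  of such sections. An operator at infinity therefore has no counterpart nearby unless it is built
  from finitely many vectors, and its Hilbert-Schmidt data must be written as a finite expression in
  coefficients before a limit can be taken. Parseval's identity does this by removing the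
  orthonormal basis, whose choice in one fibre says nothing about another. The truncation error has
  to be bounded after translation too, uniformly in the group element; as a unitary need not
  preserve the chosen basis, invariance of the Hilbert-Schmidt norm under conjugation is derived by
  passing to adjoints. Making the norm exactly 1 in every fibre turns the trace function into a
  constant, so its continuity is immediate. Countability of the group provides a sequence of finite
  sets that exhausts it.\<close>

lemma carrier_complex_ring [simp]: "carrier complex_ring = UNIV"
  by (simp add: complex_ring_def)

section \<open>Inner product calculus: Cauchy-Schwarz, triangle inequality, limits\<close>

context complex_hilbert_space
begin

lemma smult_carrier [simp, intro]: "x \<in> carrier H \<Longrightarrow> a \<odot> x \<in> carrier H"
  by (simp add: smult_closed)

lemma hinner_zero_left [simp]: "y \<in> carrier H \<Longrightarrow> hinner H \<zero> y = 0"
  using hinner_add_left[of \<zero> \<zero> y] by simp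

lemma hinner_zero_right [simp]: "y \<in> carrier H \<Longrightarrow> hinner H y \<zero> = 0"
  using hinner_commute[of y \<zero>] by simp

lemma hinner_add_right:
  "\<lbrakk>x \<in> carrier H; y \<in> carrier H; z \<in> carrier H\<rbrakk> \<Longrightarrow>
    hinner H z (x \<oplus> y) = hinner H z x + hinner H z y"
  using hinner_commute[of z "x \<oplus> y"] hinner_commute[of z x] hinner_commute[of z y]
    hinner_add_left[of x y z] by simp

lemma hinner_smult_right:
  "\<lbrakk>x \<in> carrier H; y \<in> carrier H\<rbrakk> \<Longrightarrow> hinner H y (a \<odot> x) = cnj a * hinner H y x"
  using hinner_commute[of y "a \<odot> x"] hinner_commute[of y x] hinner_smult_left[of x y a] by simp

lemma hinner_minus_left:
  assumes "x \<in> carrier H" "y \<in> carrier H" "z \<in> carrier H"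
  shows "hinner H (x \<ominus> y) z = hinner H x z - hinner H y z"
proof -
  have "hinner H y z + hinner H (\<ominus> y) z = 0"
    using hinner_add_left[of y "\<ominus> y" z] assms by (simp add: M.r_neg)
  then show ?thesis
    using hinner_add_left[of x "\<ominus> y" z] assms by (simp add: a_minus_def eq_neg_iff_add_eq_0 add.commute)
qed

lemma hinner_minus_right:
  assumes "x \<in> carrier H" "y \<in> carrier H" "z \<in> carrier H"
  shows "hinner H z (x \<ominus> y) = hinner H z x - hinner H z y"
  using hinner_commute[of z "x \<ominus> y"] hinner_commute[of z x] hinner_commute[of z y]
    hinner_minus_left[of x y z] assms by simp

lemma hinner_finsum_left:
  assumes "f \<in> I \<rightarrow> carrier H" "finite I" "y \<in> carrier H"
  shows "hinner H (finsum H f I) y = (\<Sum>i\<in>I. hinner H (f i) y)"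
  using assms(2,1)
proof (induction I rule: finite_induct)
  case empty
  then show ?case using assms(3) by simp
next
  case (insert i I)
  then have "f \<in> I \<rightarrow> carrier H" "f i \<in> carrier H" by auto
  with insert show ?case using assms(3)
    by (simp add: hinner_add_left)
qed

lemma hnorm_nonneg [simp]: "x \<in> carrier H \<Longrightarrow> 0 \<le> hnorm H x"
  by (simp add: hnorm_def hinner_nonneg)

lemma hnorm_sq: "x \<in> carrier H \<Longrightarrow> (hnorm H x)\<^sup>2 = Re (hinner H x x)"
  by (simp add: hnorm_def hinner_nonneg)

lemma hinner_self: "x \<in> carrier H \<Longrightarrow> hinner H x x = of_real ((hnorm H x)\<^sup>2)"
  using hinner_commute[of x x] by (simp add: hnorm_sq complex_eq_iff)

lemma hnorm_eq_zero: "x \<in> carrier H \<Longrightarrow> hnorm H x = 0 \<Longrightarrow> x = \<zero>"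
  by (rule hinner_eq_zero) (simp_all add: hinner_self)

lemma hnorm_zero [simp]: "hnorm H \<zero> = 0"
  by (simp add: hnorm_def)

lemma hnorm_smult: "x \<in> carrier H \<Longrightarrow> hnorm H (a \<odot> x) = cmod a * hnorm H x"
proof -
  assume x: "x \<in> carrier H"
  have "hinner H (a \<odot> x) (a \<odot> x) = of_real ((cmod a * hnorm H x)\<^sup>2)"
    using x complex_norm_square[of a] hinner_self[OF x]
    by (simp add: hinner_smult_left hinner_smult_right power_mult_distrib mult.assoc[symmetric])
  then have "(hnorm H (a \<odot> x))\<^sup>2 = (cmod a * hnorm H x)\<^sup>2"
    using x by (simp add: hnorm_sq del: of_real_mult of_real_power)
  then show ?thesis using x by (simp add: power2_eq_iff_nonneg)
qed

lemma cauchy_schwarz: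
  assumes x: "x \<in> carrier H" and y: "y \<in> carrier H"
  shows "cmod (hinner H x y) \<le> hnorm H x * hnorm H y"
proof (cases "hnorm H y = 0")
  case True
  then have "y = \<zero>" using y by (simp add: hnorm_eq_zero)
  then show ?thesis using x by simp
next
  case False
  define t where "t = hnorm H y"
  define c where "c = hinner H x y"
  have t: "t > 0" using False y by (simp add: t_def less_le)
  define a where "a = c / of_real (t\<^sup>2)"
  have yx: "hinner H y x = cnj c" using x y by (simp add: c_def hinner_commute[of y x])
  have ay: "a \<odot> y \<in> carrier H" using y by simp
  have "hinner H (x \<ominus> a \<odot> y) (x \<ominus> a \<odot> y)
      = hinner H x x - cnj a * c - a * cnj c + a * cnj a * of_real (t\<^sup>2)"
    using x y ay by (simp add: hinner_minus_left hinner_minus_right hinner_smult_left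
        hinner_smult_right yx hinner_self[OF y] t_def algebra_simps flip: c_def)
  also have "a * cnj a * of_real (t\<^sup>2) = a * cnj c"
    using t by (simp add: a_def field_simps power2_eq_square)
  also have "cnj a * c = of_real ((cmod c)\<^sup>2 / t\<^sup>2)"
    using complex_norm_square[of c] t
    by (simp add: a_def mult.commute)
  finally have "Re (hinner H (x \<ominus> a \<odot> y) (x \<ominus> a \<odot> y)) = Re (hinner H x x) - (cmod c)\<^sup>2 / t\<^sup>2"
    by simp
  moreover have "0 \<le> Re (hinner H (x \<ominus> a \<odot> y) (x \<ominus> a \<odot> y))"
    using x ay by (intro hinner_nonneg) simp
  ultimately have "0 \<le> Re (hinner H x x) - (cmod c)\<^sup>2 / t\<^sup>2"
    by linarith
  then have "(cmod c)\<^sup>2 \<le> (hnorm H x * t)\<^sup>2"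
    using t x by (simp add: hnorm_sq field_simps power_mult_distrib)
  then show ?thesis
    unfolding c_def t_def by (rule power2_le_imp_le) (simp add: x y)
qed

lemma hnorm_triangle:
  assumes x: "x \<in> carrier H" and y: "y \<in> carrier H"
  shows "hnorm H (x \<oplus> y) \<le> hnorm H x + hnorm H y"
proof (rule power2_le_imp_le)
  have "(hnorm H (x \<oplus> y))\<^sup>2 = (hnorm H x)\<^sup>2 + (hnorm H y)\<^sup>2 + 2 * Re (hinner H x y)"
    using x y hinner_commute[of y x]
    by (simp add: hnorm_sq hinner_add_left hinner_add_right)
  also have "Re (hinner H x y) \<le> hnorm H x * hnorm H y"
    using cauchy_schwarz[OF x y] complex_Re_le_cmod order_trans by blast
  finally show "(hnorm H (x \<oplus> y))\<^sup>2 \<le> (hnorm H x + hnorm H y)\<^sup>2"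
    by (simp add: power2_sum)
qed (use x y in simp)

lemma hdist_sym: "x \<in> carrier H \<Longrightarrow> y \<in> carrier H \<Longrightarrow> hdist H x y = hdist H y x"
  by (simp add: hdist_def hnorm_def hinner_minus_left hinner_minus_right)

lemma hdist_triangle:
  assumes "x \<in> carrier H" "y \<in> carrier H" "z \<in> carrier H"
  shows "hdist H x z \<le> hdist H x y + hdist H y z"
proof -
  have "x \<ominus> z = (x \<ominus> y) \<oplus> (y \<ominus> z)"
  proof -
    have "(x \<ominus> y) \<oplus> (y \<ominus> z) = x \<oplus> ((\<ominus> y) \<oplus> (y \<oplus> (\<ominus> z)))"
      using assms by (simp add: a_minus_def M.a_assoc)
    also have "(\<ominus> y) \<oplus> (y \<oplus> (\<ominus> z)) = \<ominus> z"
      using assms by (simp add: M.r_neg1)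
    finally show ?thesis by (simp add: a_minus_def)
  qed
  then show ?thesis using assms hnorm_triangle[of "x \<ominus> y" "y \<ominus> z"] by (simp add: hdist_def)
qed

lemma hdist_refl [simp]: "x \<in> carrier H \<Longrightarrow> hdist H x x = 0"
  by (simp add: hdist_def a_minus_def M.r_neg)

lemma hdist_nonneg [simp]: "x \<in> carrier H \<Longrightarrow> y \<in> carrier H \<Longrightarrow> 0 \<le> hdist H x y"
  by (simp add: hdist_def)

lemma hdist_smult:
  assumes "x \<in> carrier H"
  shows "hdist H (a \<odot> x) (b \<odot> x) = cmod (a - b) * hnorm H x"
proof -
  have "hinner H (a \<odot> x \<ominus> b \<odot> x) (a \<odot> x \<ominus> b \<odot> x) = hinner H ((a - b) \<odot> x) ((a - b) \<odot> x)"
    using assms by (simp add: hinner_minus_left hinner_minus_right hinner_smult_left hinner_smult_right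
        algebra_simps)
  then have "hdist H (a \<odot> x) (b \<odot> x) = hnorm H ((a - b) \<odot> x)"
    by (simp add: hdist_def hnorm_def)
  then show ?thesis using assms by (simp add: hnorm_smult)
qed

lemma eq_of_minus_zero:
  assumes "x \<in> carrier H" "y \<in> carrier H" "x \<ominus> y = \<zero>"
  shows "x = y"
proof -
  have "x = x \<oplus> (\<ominus> y \<oplus> y)" using assms by (simp add: M.l_neg)
  also have "\<dots> = (x \<ominus> y) \<oplus> y" using assms(1,2) by (simp add: a_minus_def M.a_assoc)
  finally show ?thesis using assms by simp
qed

lemma eq_of_hdist_zero:
  assumes "x \<in> carrier H" "y \<in> carrier H" "hdist H x y = 0"
  shows "x = y"
  using assms hnorm_eq_zero[of "x \<ominus> y"] eq_of_minus_zero[of x y] by (simp add: hdist_def)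

text \<open>Nondegeneracy, tested on \<open>x \<ominus> y\<close> itself. It reduces identities
  between vectors, in particular between finite sums in the module, to identities between complex
  numbers.\<close>

lemma eq_of_hinner_eq:
  assumes x: "x \<in> carrier H" and y: "y \<in> carrier H"
    and eq: "\<And>z. z \<in> carrier H \<Longrightarrow> hinner H x z = hinner H y z"
  shows "x = y"
proof (rule eq_of_hdist_zero[OF x y])
  have "hinner H (x \<ominus> y) (x \<ominus> y) = 0"
    using x y eq[of "x \<ominus> y"] by (simp add: hinner_minus_left)
  then show "hdist H x y = 0" by (simp add: hdist_def hnorm_def)
qed

lemma hinner_convergent:
  assumes s: "\<And>n::nat. s n \<in> carrier H" and x: "x \<in> carrier H" and y: "y \<in> carrier H"
    and lim: "(\<lambda>n. hdist H (s n) x) \<longlonglongrightarrow> 0"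
  shows "(\<lambda>n. hinner H (s n) y) \<longlonglongrightarrow> hinner H x y"
proof -
  have "(\<lambda>n. hinner H (s n) y - hinner H x y) \<longlonglongrightarrow> 0"
  proof (rule Lim_null_comparison)
    show "eventually (\<lambda>n. norm (hinner H (s n) y - hinner H x y) \<le> hdist H (s n) x * hnorm H y) sequentially"
      using cauchy_schwarz[of "s n \<ominus> x" y for n] s x y
      by (simp add: hdist_def hinner_minus_left)
    show "(\<lambda>n. hdist H (s n) x * hnorm H y) \<longlonglongrightarrow> 0"
      using tendsto_mult_right[OF lim, of "hnorm H y"] by simp
  qed
  then show ?thesis by (simp add: LIM_zero_iff)
qed

text \<open>Zorn's lemma on orthonormal sets: a nonzero vector orthogonal to a maximal one could be
  normalized and added. This gives meaning to the \<open>SOME\<close> in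
  \<open>chosen_basis\<close>.\<close>

lemma orthonormal_basis_exists: "\<exists>B. orthonormal_basis H B"
proof -
  define orth where "orth B \<longleftrightarrow> B \<subseteq> carrier H \<and>
     (\<forall>x\<in>B. \<forall>y\<in>B. hinner H x y = (if x = y then 1 else 0))" for B
  have "\<exists>M\<in>Collect orth. \<forall>X\<in>Collect orth. M \<subseteq> X \<longrightarrow> X = M"
  proof (rule subset_Zorn_nonempty)
    show "Collect orth \<noteq> {}" by (auto simp: orth_def)
    fix \<C> assume C: "\<C> \<noteq> {}" "subset.chain (Collect orth) \<C>"
    show "\<Union>\<C> \<in> Collect orth"
    proof -
      have sub: "orth B" if "B \<in> \<C>" for B using C(2) that by (auto simp: subset.chain_def)
      have "\<exists>B\<in>\<C>. x \<in> B \<and> y \<in> B" if xy: "x \<in> \<Union>\<C>" "y \<in> \<Union>\<C>" for x y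
      proof -
        obtain X Y where XY: "X \<in> \<C>" "x \<in> X" "Y \<in> \<C>" "y \<in> Y" using xy by blast
        then have "X \<subseteq> Y \<or> Y \<subseteq> X" using C(2) by (simp add: subset_chain_def)
        then show ?thesis using XY by blast
      qed
      then have "\<exists>B. orth B \<and> x \<in> B \<and> y \<in> B" if "x \<in> \<Union>\<C>" "y \<in> \<Union>\<C>" for x y
        using sub that by blast
      then have "hinner H x y = (if x = y then 1 else 0)" if "x \<in> \<Union>\<C>" "y \<in> \<Union>\<C>" for x y
        using that unfolding orth_def by blast
      then show ?thesis using sub unfolding orth_def by auto
    qed
  qed
  then obtain B where B: "orth B" and max: "\<And>X. orth X \<Longrightarrow> B \<subseteq> X \<Longrightarrow> X = B" by auto
  have "v = \<zero>" if v: "v \<in> carrier H" and ort: "\<forall>x\<in>B. hinner H v x = 0" for v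
  proof (rule ccontr)
    assume "v \<noteq> \<zero>"
    then have n: "hnorm H v > 0" using v hnorm_eq_zero by (auto simp: less_le)
    define w where "w = complex_of_real (1 / hnorm H v) \<odot> v"
    have w: "w \<in> carrier H" using v by (simp add: w_def)
    have ww: "hinner H w w = 1"
      using n v hinner_self[OF v]
      by (simp add: w_def hinner_smult_left hinner_smult_right power2_eq_square)
    have wx: "hinner H w x = 0 \<and> hinner H x w = 0" if "x \<in> B" for x
      using ort that v B hinner_commute[of x v]
      by (auto simp: w_def hinner_smult_left hinner_smult_right orth_def subset_eq)
    have "orth (insert w B)"
      using B w ww wx unfolding orth_def by auto
    then have "w \<in> B" using max by blast
    then show False using wx ww by fastforce
  qed
  then have "orthonormal_basis H B" using B by (simp add: orthonormal_basis_def orth_def)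
  then show ?thesis ..
qed

lemma chosen_basis: "orthonormal_basis H (chosen_basis H)"
  unfolding chosen_basis_def using orthonormal_basis_exists by (rule someI_ex)

section \<open>Projections onto finite parts of a basis, Bessel and Parseval\<close>

definition proj :: "'v set \<Rightarrow> 'v \<Rightarrow> 'v" where
  "proj F x = (\<Oplus>e\<in>F. hinner H x e \<odot> e)"

lemma proj_closed [simp]:
  "F \<subseteq> carrier H \<Longrightarrow> proj F x \<in> carrier H"
  unfolding proj_def by (intro M.finsum_closed) auto

context
  fixes B assumes B: "orthonormal_basis H B"
begin

lemma basis_carrier: "e \<in> B \<Longrightarrow> e \<in> carrier H"
  using B by (auto simp: orthonormal_basis_def)

lemma hinner_basis: "e \<in> B \<Longrightarrow> f \<in> B \<Longrightarrow> hinner H e f = (if e = f then 1 else 0)"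
  using B by (auto simp: orthonormal_basis_def)

lemma proj_carrier: "F \<subseteq> B \<Longrightarrow> proj F x \<in> carrier H"
  by (rule proj_closed) (auto intro: basis_carrier)

lemma hinner_proj:
  assumes "x \<in> carrier H" "y \<in> carrier H" "finite F" "F \<subseteq> B"
  shows "hinner H (proj F x) y = (\<Sum>e\<in>F. hinner H x e * cnj (hinner H y e))"
proof -
  have F: "F \<subseteq> carrier H" using assms(4) basis_carrier by auto
  have "hinner H (proj F x) y = (\<Sum>e\<in>F. hinner H (hinner H x e \<odot> e) y)"
    unfolding proj_def by (intro hinner_finsum_left) (use assms F in auto)
  also have "\<dots> = (\<Sum>e\<in>F. hinner H x e * cnj (hinner H y e))"
  proof (rule sum.cong[OF refl])
    fix e assume "e \<in> F"
    then show "hinner H (hinner H x e \<odot> e) y = hinner H x e * cnj (hinner H y e)"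
      using assms F hinner_commute[of e y] by (auto simp: hinner_smult_left)
  qed
  finally show ?thesis .
qed

lemma hinner_proj_basis:
  assumes "x \<in> carrier H" "finite F" "F \<subseteq> B" "f \<in> B"
  shows "hinner H (proj F x) f = (if f \<in> F then hinner H x f else 0)"
proof -
  have "hinner H (proj F x) f = (\<Sum>e\<in>F. hinner H x e * cnj (hinner H f e))"
    using assms basis_carrier by (intro hinner_proj) auto
  also have "\<dots> = (\<Sum>e\<in>F. if e = f then hinner H x f else 0)"
    by (rule sum.cong[OF refl]) (use assms in \<open>auto simp: hinner_basis subset_eq\<close>)
  finally show ?thesis using assms by simp
qed

text \<open>Pythagoras: the inner products of \<open>proj F x\<close> with \<open>x\<close> and with
  itself coincide. Bessel's inequality and monotonicity in \<open>F\<close> are read off from the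
  right-hand side.\<close>

lemma norm_minus_proj:
  assumes x: "x \<in> carrier H" and F: "finite F" "F \<subseteq> B"
  shows "(hdist H x (proj F x))\<^sup>2 = (hnorm H x)\<^sup>2 - (\<Sum>e\<in>F. (cmod (hinner H x e))\<^sup>2)"
proof -
  have p: "proj F x \<in> carrier H" using F by (simp add: proj_carrier)
  have s: "hinner H (proj F x) x = of_real (\<Sum>e\<in>F. (cmod (hinner H x e))\<^sup>2)"
    using hinner_proj[OF x x F] by (simp add: complex_norm_square del: of_real_power)
  have pp: "hinner H (proj F x) (proj F x) = of_real (\<Sum>e\<in>F. (cmod (hinner H x e))\<^sup>2)"
  proof -
    have "hinner H (proj F x) (proj F x) = (\<Sum>e\<in>F. hinner H x e * cnj (hinner H (proj F x) e))"
      by (rule hinner_proj[OF x p F])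
    also have "\<dots> = (\<Sum>e\<in>F. hinner H x e * cnj (hinner H x e))"
      by (rule sum.cong[OF refl]) (use F x in \<open>auto simp: hinner_proj_basis subset_eq\<close>)
    finally show ?thesis by (simp add: complex_norm_square del: of_real_power)
  qed
  have "hinner H (x \<ominus> proj F x) (x \<ominus> proj F x)
      = hinner H x x - of_real (\<Sum>e\<in>F. (cmod (hinner H x e))\<^sup>2)"
    using x p s pp hinner_commute[OF x p]
    by (simp add: hinner_minus_left hinner_minus_right)
  then show ?thesis using x p
    by (simp add: hdist_def hnorm_sq)
qed

lemma bessel:
  assumes "x \<in> carrier H" "finite F" "F \<subseteq> B"
  shows "(\<Sum>e\<in>F. (cmod (hinner H x e))\<^sup>2) \<le> (hnorm H x)\<^sup>2"
  using norm_minus_proj[OF assms] zero_le_power2[of "hdist H x (proj F x)"] by linarith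

lemma proj_mono:
  assumes x: "x \<in> carrier H" and G: "finite G" "G \<subseteq> B" and FG: "F \<subseteq> G"
  shows "hdist H x (proj G x) \<le> hdist H x (proj F x)"
proof -
  have F: "finite F" "F \<subseteq> B" using G FG finite_subset by auto
  have "(hdist H x (proj G x))\<^sup>2 \<le> (hdist H x (proj F x))\<^sup>2"
    using norm_minus_proj[OF x G] norm_minus_proj[OF x F]
      sum_mono2[OF G(1) FG, of "\<lambda>e. (cmod (hinner H x e))\<^sup>2"] by auto
  then show ?thesis
    by (rule power2_le_imp_le) (use x F in \<open>auto simp: proj_carrier\<close>)
qed

text \<open>The partial sums over a maximizing sequence of finite sets are Cauchy, and \<open>x\<close> minus
  their limit is orthogonal to the basis.\<close>

lemma proj_approx:
  assumes x: "x \<in> carrier H" and eps: "\<epsilon> > 0"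
  shows "\<exists>F. finite F \<and> F \<subseteq> B \<and> hdist H x (proj F x) < \<epsilon>"
proof -
  define g where "g e = (cmod (hinner H x e))\<^sup>2" for e
  define Fs where "Fs = {F. finite F \<and> F \<subseteq> B}"
  define s where "s = (SUP F\<in>Fs. sum g F)"
  have bdd: "bdd_above (sum g ` Fs)"
    using bessel[OF x] by (intro bdd_aboveI2) (auto simp: Fs_def g_def)
  have le_s: "sum g F \<le> s" if "F \<in> Fs" for F
    unfolding s_def by (rule cSUP_upper[OF that bdd])
  have "\<exists>F\<in>Fs. s - 1 / real (Suc n) < sum g F" for n
  proof -
    have "s - 1 / real (Suc n) < s" by simp
    then show ?thesis unfolding s_def
      by (subst (asm) less_cSUP_iff[OF _ bdd]) (auto simp: Fs_def)
  qed
  then obtain \<Phi> where \<Phi>: "\<And>n. \<Phi> n \<in> Fs" "\<And>n. s - 1 / real (Suc n) < sum g (\<Phi> n)" by metis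
  \<comment> \<open>Taking unions makes the maximizing sets increasing, so that Pythagoras computes
    the distances between the projections.\<close>
  define F where "F n = (\<Union>k\<le>n. \<Phi> k)" for n
  have F: "F n \<in> Fs" for n using \<Phi>(1) by (auto simp: F_def Fs_def)
  then have FB: "finite (F n)" "F n \<subseteq> B" for n by (auto simp: Fs_def)
  have mono: "F m \<subseteq> F n" if "m \<le> n" for m n
    unfolding F_def using that by (intro UN_mono) auto
  have Fs: "s - 1 / real (Suc n) < sum g (F n)" for n
  proof -
    have "sum g (\<Phi> n) \<le> sum g (F n)"
      using FB(1)[of n] by (rule sum_mono2) (auto simp: F_def g_def)
    then show ?thesis using \<Phi>(2)[of n] by linarith
  qed
  have pc: "proj (F n) x \<in> carrier H" for n using FB by (simp add: proj_carrier)
  have split: "(hdist H (proj (F n) x) (proj (F m) x))\<^sup>2 = sum g (F n) - sum g (F m)" if "m \<le> n" for m n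
  proof -
    have diff: "F n - F m \<subseteq> B" "finite (F n - F m)" using FB by auto
    have sub: "F m \<subseteq> F n" by (rule mono[OF that])
    \<comment> \<open>Only the smaller set contributes, because on the vectors of \<open>F j\<close>
      the projection has the same coefficients as \<open>x\<close>.\<close>
    have ip: "hinner H (proj (F i) x) (proj (F j) x) = of_real (sum g (F i))" if "F i \<subseteq> F j" for i j
    proof -
      have "hinner H (proj (F i) x) (proj (F j) x)
          = (\<Sum>e\<in>F i. hinner H x e * cnj (hinner H (proj (F j) x) e))"
        by (rule hinner_proj[OF x pc FB])
      also have "\<dots> = (\<Sum>e\<in>F i. hinner H x e * cnj (hinner H x e))"
        by (rule sum.cong[OF refl]) (use that FB x in \<open>auto simp: hinner_proj_basis subset_eq\<close>)
      finally show ?thesis by (simp add: complex_norm_square g_def del: of_real_power)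
    qed
    have "hinner H (proj (F n) x \<ominus> proj (F m) x) (proj (F n) x \<ominus> proj (F m) x)
        = of_real (sum g (F n) - sum g (F m))"
      using ip[OF sub] ip[of n n] ip[of m m] hinner_commute[OF pc[of n] pc[of m]] pc
      by (simp add: hinner_minus_left hinner_minus_right)
    then show ?thesis using pc by (simp add: hdist_def hnorm_sq)
  qed
  have small: "hdist H (proj (F n) x) (proj (F m) x) < \<epsilon>'" if "\<epsilon>' > 0" "m \<le> n" "1 / real (Suc m) < \<epsilon>'\<^sup>2" for m n \<epsilon>'
  proof (rule power2_less_imp_less)
    show "(hdist H (proj (F n) x) (proj (F m) x))\<^sup>2 < \<epsilon>'\<^sup>2"
      using split[OF that(2)] Fs[of m] le_s[OF F[of n]] that(3) by linarith
  qed (use that in simp)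
  have "\<exists>w\<in>carrier H. (\<lambda>n. hdist H (proj (F n) x) w) \<longlonglongrightarrow> 0"
  proof (rule complete)
    show "proj (F n) x \<in> carrier H" for n by (rule pc)
    show "\<forall>\<epsilon>>0. \<exists>N. \<forall>m\<ge>N. \<forall>n\<ge>N. hdist H (proj (F m) x) (proj (F n) x) < \<epsilon>"
    proof (intro allI impI)
      fix \<epsilon>' :: real assume e: "\<epsilon>' > 0"
      then obtain N where N: "1 / real (Suc N) < (\<epsilon>'/2)\<^sup>2"
        using nat_approx_posE[of "(\<epsilon>'/2)\<^sup>2"] by auto
      have "hdist H (proj (F m) x) (proj (F n) x) < \<epsilon>'" if "m \<ge> N" "n \<ge> N" for m n
        using small[OF _ that(1) N] small[OF _ that(2) N] e
          hdist_triangle[OF pc[of m] pc[of N] pc[of n]] hdist_sym[OF pc[of N] pc[of n]] by simp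
      then show "\<exists>N. \<forall>m\<ge>N. \<forall>n\<ge>N. hdist H (proj (F m) x) (proj (F n) x) < \<epsilon>'" by blast
    qed
  qed
  then obtain w where w: "w \<in> carrier H" and lim: "(\<lambda>n. hdist H (proj (F n) x) w) \<longlonglongrightarrow> 0" by blast
  have "hinner H (x \<ominus> w) e = 0" if e: "e \<in> B" for e
  proof -
    have ec: "e \<in> carrier H" using e by (rule basis_carrier)
    have l: "(\<lambda>n. hinner H (proj (F n) x) e) \<longlonglongrightarrow> hinner H w e"
      by (rule hinner_convergent[OF pc w ec lim])
    have "(\<lambda>n. hinner H (proj (F n) x) e) \<longlonglongrightarrow> hinner H x e"
    proof (cases "\<exists>m. e \<in> F m")
      case True
      then obtain m where m: "e \<in> F m" by blast
      have "eventually (\<lambda>n. hinner H (proj (F n) x) e = hinner H x e) sequentially"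
        using eventually_ge_at_top[of m]
        by eventually_elim (use m mono FB x e in \<open>auto simp: hinner_proj_basis subset_eq\<close>)
      then show ?thesis by (rule tendsto_eventually)
    next
      case False
      \<comment> \<open>Adding \<open>e\<close> to \<open>F n\<close> still gives a sum of at most
        \<open>s\<close>, so its term fits into the gap that \<open>F n\<close> leaves below
        \<open>s\<close>.\<close>
      have "g e \<le> 1 / real (Suc n)" for n
      proof -
        have "insert e (F n) \<in> Fs" using F[of n] e by (auto simp: Fs_def)
        then have "g e + sum g (F n) \<le> s" using le_s False FB(1)[of n] by fastforce
        then show ?thesis using Fs[of n] by linarith
      qed
      then have "g e \<le> 0"
        by (metis nat_approx_posE not_le)
      then have "hinner H x e = 0" by (simp add: g_def)
      moreover have "hinner H (proj (F n) x) e = 0" for n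
        using False e FB x by (simp add: hinner_proj_basis)
      ultimately show ?thesis by simp
    qed
    then have "hinner H x e = hinner H w e" using l LIMSEQ_unique by blast
    then show ?thesis using x w ec by (simp add: hinner_minus_left)
  qed
  then have "x \<ominus> w = \<zero>" using B x w by (auto simp: orthonormal_basis_def)
  then have "x = w" using x w by (simp add: eq_of_minus_zero)
  with lim have "eventually (\<lambda>n. hdist H (proj (F n) x) x < \<epsilon>) sequentially"
    using eps by (auto dest: order_tendstoD)
  then obtain n where "hdist H (proj (F n) x) x < \<epsilon>"
    by (meson eventually_False_sequentially eventually_mono)
  then show ?thesis using FB[of n] hdist_sym[OF x pc[of n]] by auto
qed

text \<open>A partial sum over \<open>G\<close> equals the inner product of \<open>proj G x\<close>
  with \<open>y\<close>, so by Cauchy-Schwarz the error is at most the distance from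
  \<open>x\<close> to its projection times the norm of \<open>y\<close>.\<close>

lemma parseval:
  assumes x: "x \<in> carrier H" and y: "y \<in> carrier H"
  shows "((\<lambda>e. hinner H x e * cnj (hinner H y e)) has_sum hinner H x y) B"
  unfolding has_sum_def tendsto_iff eventually_finite_subsets_at_top
proof (intro allI impI)
  fix \<epsilon> :: real assume e: "\<epsilon> > 0"
  \<comment> \<open>The summand 1 keeps the denominator positive when \<open>y\<close> is
    zero.\<close>
  define \<delta> where "\<delta> = \<epsilon> / (hnorm H y + 1)"
  have n: "hnorm H y + 1 > 0" using y by (simp add: add_nonneg_pos)
  then have "\<delta> > 0" using e by (simp add: \<delta>_def)
  then obtain F where F: "finite F" "F \<subseteq> B" "hdist H x (proj F x) < \<delta>"
    using proj_approx[OF x] by blast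
  have "dist (\<Sum>e\<in>G. hinner H x e * cnj (hinner H y e)) (hinner H x y) < \<epsilon>"
    if G: "finite G" "F \<subseteq> G" "G \<subseteq> B" for G
  proof -
    have p: "proj G x \<in> carrier H" using G by (simp add: proj_carrier)
    have "dist (\<Sum>e\<in>G. hinner H x e * cnj (hinner H y e)) (hinner H x y)
       = cmod (hinner H (x \<ominus> proj G x) y)"
      using G x y p by (simp add: hinner_proj hinner_minus_left dist_norm norm_minus_commute)
    also have "\<dots> \<le> hdist H x (proj G x) * hnorm H y"
      using x y p by (simp add: hdist_def cauchy_schwarz)
    also have "\<dots> \<le> hdist H x (proj G x) * (hnorm H y + 1)"
      using x y p by (intro mult_left_mono) auto
    also have "\<dots> < \<delta> * (hnorm H y + 1)"
      using proj_mono[OF x G(1,3,2)] F(3) n by (intro mult_strict_right_mono) auto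
    also have "\<dots> = \<epsilon>" using n by (simp add: \<delta>_def)
    finally show ?thesis .
  qed
  then show "\<exists>X. finite X \<and> X \<subseteq> B \<and> (\<forall>Y. finite Y \<and> X \<subseteq> Y \<and> Y \<subseteq> B \<longrightarrow>
      dist (\<Sum>e\<in>Y. hinner H x e * cnj (hinner H y e)) (hinner H x y) < \<epsilon>)"
    using F by blast
qed

lemma parseval_norm:
  assumes x: "x \<in> carrier H"
  shows "((\<lambda>e. (cmod (hinner H x e))\<^sup>2) has_sum (hnorm H x)\<^sup>2) B"
proof -
  have "((\<lambda>e. Re (hinner H x e * cnj (hinner H x e))) has_sum Re (hinner H x x)) B"
    by (rule has_sum_Re[OF parseval[OF x x]])
  then show ?thesis
    by (simp only: hnorm_sq[OF x] complex_norm_square[symmetric] Re_complex_of_real)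
qed

end

end

section \<open>Hilbert-Schmidt sums and finite rank operators\<close>

text \<open>The adjoint is carried along explicitly instead of assuming linearity and boundedness.
  Its existence determines the \<open>THE\<close> in \<open>hadjoint\<close> and already makes
  \<open>A\<close> additive, as \<open>hinner_image_minus\<close> uses.\<close>

definition adjoint_pair :: "'v hilbert \<Rightarrow> ('v \<Rightarrow> 'v) \<Rightarrow> ('v \<Rightarrow> 'v) \<Rightarrow> bool" where
  "adjoint_pair H A A' \<longleftrightarrow> A \<in> carrier H \<rightarrow> carrier H \<and> A' \<in> carrier H \<rightarrow> carrier H \<and>
     (\<forall>x\<in>carrier H. \<forall>y\<in>carrier H. hinner H (A x) y = hinner H x (A' y))"

text \<open>The vectors form indexed families rather than sets: one index set then serves all fibres
  at once, and vectors may coincide or vanish in some of them.\<close>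

definition finite_rank ::
    "'v hilbert \<Rightarrow> 'i set \<Rightarrow> ('i \<Rightarrow> 'v) \<Rightarrow> ('i \<Rightarrow> 'v) \<Rightarrow> 'v \<Rightarrow> 'v" where
  "finite_rank H I a b v = (\<Oplus>\<^bsub>H\<^esub>i\<in>I. hinner H v (b i) \<odot>\<^bsub>H\<^esub> a i)"

section \<open>Adjoint pairs, traces over the chosen basis, finite rank operators\<close>

context complex_hilbert_space
begin

lemma adjoint_pair_closed:
  assumes "adjoint_pair H A A'" "x \<in> carrier H"
  shows "A x \<in> carrier H" "A' x \<in> carrier H"
  using assms by (auto simp: adjoint_pair_def)

lemma adjoint_pair_hinner:
  assumes "adjoint_pair H A A'" "x \<in> carrier H" "y \<in> carrier H"
  shows "hinner H (A x) y = hinner H x (A' y)"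
  using assms by (auto simp: adjoint_pair_def)

lemma adjoint_pair_sym:
  assumes "adjoint_pair H A A'"
  shows "adjoint_pair H A' A"
  unfolding adjoint_pair_def
proof (intro conjI ballI)
  fix x y assume "x \<in> carrier H" "y \<in> carrier H"
  then show "hinner H (A' x) y = hinner H x (A y)"
    using adjoint_pair_hinner[OF assms, of y x] adjoint_pair_closed[OF assms]
      hinner_commute[of "A' x" y] hinner_commute[of x "A y"] by simp
qed (use assms in \<open>auto simp: adjoint_pair_def\<close>)

lemma adjoint_pair_comp:
  assumes "adjoint_pair H A A'" "adjoint_pair H C C'"
  shows "adjoint_pair H (A \<circ> C) (C' \<circ> A')"
  using assms by (auto simp: adjoint_pair_def Pi_iff)

lemma adjoint_pair_minus:
  assumes "adjoint_pair H A A'" "adjoint_pair H C C'"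
  shows "adjoint_pair H (\<lambda>x. A x \<ominus> C x) (\<lambda>x. A' x \<ominus> C' x)"
  using assms by (auto simp: adjoint_pair_def Pi_iff hinner_minus_left hinner_minus_right)

lemma hinner_image_minus:
  assumes A: "adjoint_pair H A A'" and x: "x \<in> carrier H" "y \<in> carrier H" "z \<in> carrier H"
  shows "hinner H (A (x \<ominus> y)) z = hinner H (A x) z - hinner H (A y) z"
  using adjoint_pair_closed[OF A] x
  by (simp add: adjoint_pair_hinner[OF A] hinner_minus_left)

lemma minus_zero_right: "x \<in> carrier H \<Longrightarrow> x \<ominus> \<zero> = x"
  by (rule eq_of_hinner_eq) (simp_all add: hinner_minus_left)

lemma minus_self: "x \<in> carrier H \<Longrightarrow> x \<ominus> x = \<zero>"
  by (simp add: a_minus_def M.r_neg)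

lemma hadjoint_eq:
  assumes A: "adjoint_pair H A A'" and y: "y \<in> carrier H"
  shows "hadjoint H A y = A' y"
  unfolding hadjoint_def
proof (rule the_equality)
  show "A' y \<in> carrier H \<and> (\<forall>x\<in>carrier H. hinner H (A x) y = hinner H x (A' y))"
    using A y by (auto simp: adjoint_pair_def)
  fix z assume z: "z \<in> carrier H \<and> (\<forall>x\<in>carrier H. hinner H (A x) y = hinner H x z)"
  show "z = A' y"
  proof (rule eq_of_hinner_eq)
    fix x assume x: "x \<in> carrier H"
    have "hinner H x z = hinner H x (A' y)" using z x A y by (auto simp: adjoint_pair_def)
    then show "hinner H z x = hinner H (A' y) x"
      using z x y hinner_commute[of z x] hinner_commute[of "A' y" x]
        adjoint_pair_closed[OF A y] by simp
  qed (use z y adjoint_pair_closed[OF A y] in auto)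
qed

lemma chosen_basis_carrier: "e \<in> chosen_basis H \<Longrightarrow> e \<in> carrier H"
  by (rule basis_carrier[OF chosen_basis])

lemma hs_inner_eq:
  assumes R: "adjoint_pair H R R'" and S: "S \<in> carrier H \<rightarrow> carrier H"
  shows "hs_inner H S R = (\<Sum>\<^sub>\<infinity>e\<in>chosen_basis H. hinner H (S e) (R e))"
  unfolding hs_inner_def htrace_def
proof (rule infsum_cong)
  fix e assume "e \<in> chosen_basis H"
  then have e: "e \<in> carrier H" by (rule chosen_basis_carrier)
  then have Se: "S e \<in> carrier H" using S by auto
  show "hinner H ((hadjoint H R \<circ> S) e) e = hinner H (S e) (R e)"
    using hadjoint_eq[OF R Se] adjoint_pair_hinner[OF adjoint_pair_sym[OF R] Se e] by simp
qed

lemma hinner_abs_square: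
  assumes A: "adjoint_pair H A A'" and e: "e \<in> carrier H"
  shows "hinner H (abs_square H A e) e = of_real ((hnorm H (A e))\<^sup>2)"
proof -
  have Ae: "A e \<in> carrier H" using adjoint_pair_closed[OF A e] by simp
  show ?thesis
    using hadjoint_eq[OF A Ae] adjoint_pair_hinner[OF adjoint_pair_sym[OF A] Ae e] hinner_self[OF Ae]
    by (simp add: abs_square_def)
qed

lemma finite_htrace_iff:
  assumes A: "adjoint_pair H A A'"
  shows "finite_htrace H (abs_square H A) \<longleftrightarrow> (\<lambda>e. (hnorm H (A e))\<^sup>2) summable_on chosen_basis H"
proof -
  have "finite_htrace H (abs_square H A) \<longleftrightarrow>
      (\<lambda>e. of_real ((hnorm H (A e))\<^sup>2) :: complex) summable_on chosen_basis H"
    unfolding finite_htrace_def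
    by (rule summable_on_cong) (simp only: hinner_abs_square[OF A chosen_basis_carrier])
  also have "\<dots> \<longleftrightarrow> (\<lambda>e. (hnorm H (A e))\<^sup>2) summable_on chosen_basis H"
    by (metis (mono_tags, lifting) Re_complex_of_real has_sum_Re has_sum_of_real summable_on_cong
        summable_on_def)
  finally show ?thesis .
qed

lemma htrace_abs_square:
  assumes A: "adjoint_pair H A A'"
    and s: "((\<lambda>e. (hnorm H (A e))\<^sup>2) has_sum s) (chosen_basis H)"
  shows "htrace H (abs_square H A) = of_real s"
proof -
  have "htrace H (abs_square H A) = (\<Sum>\<^sub>\<infinity>e\<in>chosen_basis H. of_real ((hnorm H (A e))\<^sup>2))"
    unfolding htrace_def by (rule infsum_cong) (simp only: hinner_abs_square[OF A chosen_basis_carrier])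
  also have "\<dots> = of_real s"
    by (rule infsumI, rule has_sum_of_real[OF s])
  finally show ?thesis .
qed

lemma hs_norm_eq:
  assumes "adjoint_pair H A A'" "((\<lambda>e. (hnorm H (A e))\<^sup>2) has_sum s) (chosen_basis H)"
  shows "hs_norm H A = sqrt s"
  using htrace_abs_square[OF assms] by (simp add: hs_norm_def)

text \<open>On finite sets the bound comes from Cauchy-Schwarz in \<open>H\<close>, followed by
  Cauchy-Schwarz for the real vectors of norms. Since it is uniform in the finite set, it yields
  absolute summability as well.\<close>

lemma family_cauchy_schwarz:
  assumes f: "f \<in> B \<rightarrow> carrier H" and g: "g \<in> B \<rightarrow> carrier H"
    and s: "((\<lambda>e. (hnorm H (f e))\<^sup>2) has_sum s) B" and t: "((\<lambda>e. (hnorm H (g e))\<^sup>2) has_sum t) B"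
  shows "(\<lambda>e. hinner H (f e) (g e)) summable_on B"
    and "cmod (\<Sum>\<^sub>\<infinity>e\<in>B. hinner H (f e) (g e)) \<le> sqrt s * sqrt t"
proof -
  have fin: "(\<Sum>e\<in>F. cmod (hinner H (f e) (g e))) \<le> sqrt s * sqrt t" if F: "finite F" "F \<subseteq> B" for F
  proof -
    have "(\<Sum>e\<in>F. cmod (hinner H (f e) (g e))) \<le> (\<Sum>e\<in>F. \<bar>hnorm H (f e)\<bar> * \<bar>hnorm H (g e)\<bar>)"
    proof (rule sum_mono)
      fix e assume "e \<in> F"
      then have c: "f e \<in> carrier H" "g e \<in> carrier H" using f g F by auto
      show "cmod (hinner H (f e) (g e)) \<le> \<bar>hnorm H (f e)\<bar> * \<bar>hnorm H (g e)\<bar>"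
        using cauchy_schwarz[OF c] c by simp
    qed
    also have "\<dots> \<le> L2_set (\<lambda>e. hnorm H (f e)) F * L2_set (\<lambda>e. hnorm H (g e)) F"
      by (rule L2_set_mult_ineq)
    also have "\<dots> \<le> sqrt s * sqrt t"
    proof (rule mult_mono)
      show "L2_set (\<lambda>e. hnorm H (f e)) F \<le> sqrt s"
        unfolding L2_set_def using finite_sum_le_has_sum[OF s F] by simp
      show "L2_set (\<lambda>e. hnorm H (g e)) F \<le> sqrt t"
        unfolding L2_set_def using finite_sum_le_has_sum[OF t F] by simp
      show "0 \<le> sqrt s" using has_sum_nonneg[OF s] by simp
    qed (simp add: L2_set_nonneg)
    finally show ?thesis .
  qed
  have a: "(\<lambda>e. cmod (hinner H (f e) (g e))) summable_on B"
    unfolding Infinite_Sum.abs_summable_iff_bdd_above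
    using fin by (auto intro!: bdd_aboveI2[where M = "sqrt s * sqrt t"])
  then show "(\<lambda>e. hinner H (f e) (g e)) summable_on B"
    by (rule abs_summable_summable)
  have "cmod (\<Sum>\<^sub>\<infinity>e\<in>B. hinner H (f e) (g e)) \<le> (\<Sum>\<^sub>\<infinity>e\<in>B. cmod (hinner H (f e) (g e)))"
    by (rule norm_infsum_bound[OF a])
  also have "\<dots> \<le> sqrt s * sqrt t"
    using a fin by (intro infsum_le_finite_sums) auto
  finally show "cmod (\<Sum>\<^sub>\<infinity>e\<in>B. hinner H (f e) (g e)) \<le> sqrt s * sqrt t" .
qed

lemma finite_rank_closed [simp]:
  assumes "a \<in> I \<rightarrow> carrier H"
  shows "finite_rank H I a b v \<in> carrier H"
  unfolding finite_rank_def using assms by (intro M.finsum_closed) auto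

lemma hinner_finite_rank:
  assumes "finite I" "a \<in> I \<rightarrow> carrier H" "y \<in> carrier H"
  shows "hinner H (finite_rank H I a b v) y = (\<Sum>i\<in>I. hinner H v (b i) * hinner H (a i) y)"
proof -
  have "hinner H (finite_rank H I a b v) y = (\<Sum>i\<in>I. hinner H (hinner H v (b i) \<odot> a i) y)"
    unfolding finite_rank_def using assms by (intro hinner_finsum_left) auto
  also have "\<dots> = (\<Sum>i\<in>I. hinner H v (b i) * hinner H (a i) y)"
    by (rule sum.cong[OF refl]) (use assms in \<open>simp add: hinner_smult_left Pi_iff\<close>)
  finally show ?thesis .
qed

lemma hinner_finite_rank_right:
  assumes "finite I" "a \<in> I \<rightarrow> carrier H" "b \<in> I \<rightarrow> carrier H" "y \<in> carrier H" "v \<in> carrier H"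
  shows "hinner H y (finite_rank H I a b v) = (\<Sum>i\<in>I. hinner H y (a i) * hinner H (b i) v)"
proof -
  have "hinner H y (finite_rank H I a b v) = cnj (hinner H (finite_rank H I a b v) y)"
    using assms by (intro hinner_commute) auto
  also have "\<dots> = (\<Sum>i\<in>I. cnj (hinner H v (b i)) * cnj (hinner H (a i) y))"
    using assms by (simp add: hinner_finite_rank)
  also have "\<dots> = (\<Sum>i\<in>I. hinner H y (a i) * hinner H (b i) v)"
  proof (rule sum.cong[OF refl])
    fix i assume "i \<in> I"
    then have "a i \<in> carrier H" "b i \<in> carrier H" using assms by auto
    then show "cnj (hinner H v (b i)) * cnj (hinner H (a i) y) = hinner H y (a i) * hinner H (b i) v"
      using assms hinner_commute[of y "a i"] hinner_commute[of "b i" v] by simp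
  qed
  finally show ?thesis .
qed

lemma adjoint_pair_finite_rank:
  assumes "finite I" "a \<in> I \<rightarrow> carrier H" "b \<in> I \<rightarrow> carrier H"
  shows "adjoint_pair H (finite_rank H I a b) (finite_rank H I b a)"
  unfolding adjoint_pair_def using assms
  by (auto simp: hinner_finite_rank hinner_finite_rank_right)

text \<open>As \<open>V\<close> is adjoint to \<open>U\<close>, the factor
  \<open>hinner H (V x) (b i)\<close> equals \<open>hinner H x (U (b i))\<close>. Conjugation thus
  only moves both families by \<open>U\<close>, which is how matrix coefficients enter.\<close>

lemma conj_finite_rank:
  assumes U: "adjoint_pair H U V"
    and I: "finite I" "a \<in> I \<rightarrow> carrier H" "b \<in> I \<rightarrow> carrier H" and x: "x \<in> carrier H"
  shows "U (finite_rank H I a b (V x)) = finite_rank H I (\<lambda>i. U (a i)) (\<lambda>i. U (b i)) x"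
proof (rule eq_of_hinner_eq)
  have Ua: "(\<lambda>i. U (a i)) \<in> I \<rightarrow> carrier H"
    using I adjoint_pair_closed[OF U] by auto
  show "U (finite_rank H I a b (V x)) \<in> carrier H"
    using I adjoint_pair_closed[OF U] by simp
  show "finite_rank H I (\<lambda>i. U (a i)) (\<lambda>i. U (b i)) x \<in> carrier H"
    using Ua by simp
  fix z assume z: "z \<in> carrier H"
  have "hinner H (U (finite_rank H I a b (V x))) z = hinner H (finite_rank H I a b (V x)) (V z)"
    using I z by (intro adjoint_pair_hinner[OF U]) auto
  also have "\<dots> = (\<Sum>i\<in>I. hinner H (V x) (b i) * hinner H (a i) (V z))"
    using I z adjoint_pair_closed[OF U] by (intro hinner_finite_rank) auto
  also have "\<dots> = (\<Sum>i\<in>I. hinner H x (U (b i)) * hinner H (U (a i)) z)"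
  proof (rule sum.cong[OF refl])
    fix i assume "i \<in> I"
    then have "a i \<in> carrier H" "b i \<in> carrier H" using I by auto
    then show "hinner H (V x) (b i) * hinner H (a i) (V z) = hinner H x (U (b i)) * hinner H (U (a i)) z"
      using x z adjoint_pair_hinner[OF U] adjoint_pair_hinner[OF adjoint_pair_sym[OF U]] by simp
  qed
  also have "\<dots> = hinner H (finite_rank H I (\<lambda>i. U (a i)) (\<lambda>i. U (b i)) x) z"
    using hinner_finite_rank[OF I(1) Ua z] by simp
  finally show "hinner H (U (finite_rank H I a b (V x))) z
     = hinner H (finite_rank H I (\<lambda>i. U (a i)) (\<lambda>i. U (b i)) x) z" .
qed

section \<open>Hilbert-Schmidt sums over an orthonormal basis\<close>

context
  fixes B assumes B: "orthonormal_basis H B"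
begin

text \<open>The nonnegative double sum of the squared matrix entries \<open>hinner H (A e) f\<close>
  is evaluated by rows and by columns; Parseval identifies the rows with \<open>A\<close> and the
  columns with \<open>A'\<close>.\<close>

lemma has_sum_norm_adjoint:
  assumes A: "adjoint_pair H A A'" and s: "((\<lambda>e. (hnorm H (A e))\<^sup>2) has_sum s) B"
  shows "((\<lambda>e. (hnorm H (A' e))\<^sup>2) has_sum s) B"
proof -
  define h where "h = (\<lambda>(e, f). (cmod (hinner H (A e) f))\<^sup>2)"
  have row: "((\<lambda>f. h (e, f)) has_sum (hnorm H (A e))\<^sup>2) B" if "e \<in> B" for e
    unfolding h_def prod.case
    by (rule parseval_norm[OF B]) (use that adjoint_pair_closed[OF A] basis_carrier[OF B] in auto)
  have "h summable_on B \<times> B"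
    by (rule summable_on_SigmaI[OF row]) (use s in \<open>auto simp: h_def summable_on_def\<close>)
  then have "(h has_sum s) (B \<times> B)"
    by (intro has_sum_SigmaI[OF row s]) auto
  then have "((\<lambda>(x, y). h (y, x)) has_sum s) (B \<times> B)"
    by (rule has_sum_swap[THEN iffD1])
  then show ?thesis
  proof (rule has_sum_SigmaD)
    fix f assume f: "f \<in> B"
    have fc: "f \<in> carrier H" by (rule basis_carrier[OF B f])
    have "((\<lambda>e. (cmod (hinner H (A' f) e))\<^sup>2) has_sum (hnorm H (A' f))\<^sup>2) B"
      by (rule parseval_norm[OF B]) (use fc adjoint_pair_closed[OF A] in auto)
    also have "?this \<longleftrightarrow> ((\<lambda>e. case (f, e) of (x, y) \<Rightarrow> h (y, x)) has_sum (hnorm H (A' f))\<^sup>2) B"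
    proof (rule has_sum_cong)
      fix e assume "e \<in> B"
      then have e: "e \<in> carrier H" by (rule basis_carrier[OF B])
      have "hinner H (A e) f = cnj (hinner H (A' f) e)"
        using adjoint_pair_hinner[OF A e fc] hinner_commute[of e "A' f"] e fc
          adjoint_pair_closed[OF A] by simp
      then show "(cmod (hinner H (A' f) e))\<^sup>2 = (case (f, e) of (x, y) \<Rightarrow> h (y, x))"
        by (simp add: h_def)
    qed
    finally show "((\<lambda>e. case (f, e) of (x, y) \<Rightarrow> h (y, x)) has_sum (hnorm H (A' f))\<^sup>2) B" .
  qed
qed

text \<open>\<open>U\<close> may move \<open>B\<close> to a different basis, so this is no
  reindexing. An isometry on the left preserves every term; passing from \<open>U \<circ> A'\<close>
  to its adjoint \<open>A \<circ> V\<close> puts \<open>V\<close> on the right, and a second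
  application of \<open>U\<close> on the left finishes.\<close>

lemma has_sum_norm_conj:
  assumes A: "adjoint_pair H A A'" and s: "((\<lambda>e. (hnorm H (A e))\<^sup>2) has_sum s) B"
    and U: "adjoint_pair H U V" and iso: "\<And>x. x \<in> carrier H \<Longrightarrow> hnorm H (U x) = hnorm H x"
  shows "((\<lambda>e. (hnorm H (U (A (V e))))\<^sup>2) has_sum s) B"
proof -
  have VU: "adjoint_pair H V U" by (rule adjoint_pair_sym[OF U])
  have "((\<lambda>e. (hnorm H (A' e))\<^sup>2) has_sum s) B"
    by (rule has_sum_norm_adjoint[OF A s])
  also have "?this \<longleftrightarrow> ((\<lambda>e. (hnorm H ((U \<circ> A') e))\<^sup>2) has_sum s) B"
    by (rule has_sum_cong) (use iso adjoint_pair_closed[OF A] basis_carrier[OF B] in auto)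
  finally have "((\<lambda>e. (hnorm H ((A \<circ> V) e))\<^sup>2) has_sum s) B"
    by (rule has_sum_norm_adjoint[OF adjoint_pair_comp[OF U adjoint_pair_sym[OF A]]])
  also have "?this \<longleftrightarrow> ((\<lambda>e. (hnorm H (U (A (V e))))\<^sup>2) has_sum s) B"
    by (rule has_sum_cong)
      (use iso adjoint_pair_closed[OF A] adjoint_pair_closed[OF U] basis_carrier[OF B] in auto)
  finally show ?thesis .
qed

lemma has_sum_finite_sum:
  assumes "finite I" "\<And>i. i \<in> I \<Longrightarrow> ((f i) has_sum (s i)) C"
  shows "((\<lambda>x. \<Sum>i\<in>I. f i x :: complex) has_sum (\<Sum>i\<in>I. s i)) C"
  using assms by (induction I rule: finite_induct) (auto intro!: has_sum_add)

text \<open>Expanding both operators leaves, for each pair \<open>i\<close>, \<open>j\<close>, a sum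
  over the basis that Parseval evaluates to \<open>hinner H (d j) (b i)\<close>. The result no
  longer mentions the basis and can be compared between fibres.\<close>

lemma finite_rank_has_sum:
  assumes I: "finite I" "a \<in> I \<rightarrow> carrier H" "b \<in> I \<rightarrow> carrier H"
    and J: "finite J" "c \<in> J \<rightarrow> carrier H" "d \<in> J \<rightarrow> carrier H"
  shows "((\<lambda>e. hinner H (finite_rank H I a b e) (finite_rank H J c d e)) has_sum
    (\<Sum>i\<in>I. \<Sum>j\<in>J. hinner H (a i) (c j) * hinner H (d j) (b i))) B"
proof -
  have term_sum: "((\<lambda>e. hinner H e (b i) * (hinner H (a i) (c j) * hinner H (d j) e)) has_sum
      hinner H (a i) (c j) * hinner H (d j) (b i)) B" if ij: "i \<in> I" "j \<in> J" for i j
  proof -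
    have c: "b i \<in> carrier H" "d j \<in> carrier H" using ij I J by auto
    have "((\<lambda>e. hinner H (a i) (c j) * (hinner H (d j) e * cnj (hinner H (b i) e))) has_sum
      hinner H (a i) (c j) * hinner H (d j) (b i)) B"
      by (intro has_sum_cmult_right parseval[OF B] c)
    also have "?this \<longleftrightarrow> ?thesis"
    proof (rule has_sum_cong)
      fix e assume "e \<in> B"
      then have "e \<in> carrier H" by (rule basis_carrier[OF B])
      then show "hinner H (a i) (c j) * (hinner H (d j) e * cnj (hinner H (b i) e))
          = hinner H e (b i) * (hinner H (a i) (c j) * hinner H (d j) e)"
        using c hinner_commute[of e "b i"] by simp
    qed
    finally show ?thesis .
  qed
  have "((\<lambda>e. \<Sum>i\<in>I. \<Sum>j\<in>J. hinner H e (b i) * (hinner H (a i) (c j) * hinner H (d j) e)) has_sum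
    (\<Sum>i\<in>I. \<Sum>j\<in>J. hinner H (a i) (c j) * hinner H (d j) (b i))) B"
    by (intro has_sum_finite_sum I J term_sum)
  also have "?this \<longleftrightarrow> ?thesis"
  proof (rule has_sum_cong)
    fix e assume "e \<in> B"
    then have e: "e \<in> carrier H" by (rule basis_carrier[OF B])
    have "hinner H (finite_rank H I a b e) (finite_rank H J c d e)
       = (\<Sum>i\<in>I. hinner H e (b i) * hinner H (a i) (finite_rank H J c d e))"
      using I J by (intro hinner_finite_rank) auto
    also have "\<dots> = (\<Sum>i\<in>I. \<Sum>j\<in>J. hinner H e (b i) * (hinner H (a i) (c j) * hinner H (d j) e))"
    proof (rule sum.cong[OF refl])
      fix i assume "i \<in> I"
      then have "a i \<in> carrier H" using I by auto
      then show "hinner H e (b i) * hinner H (a i) (finite_rank H J c d e)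
        = (\<Sum>j\<in>J. hinner H e (b i) * (hinner H (a i) (c j) * hinner H (d j) e))"
        using J e by (simp add: hinner_finite_rank_right sum_distrib_left)
    qed
    finally show "(\<Sum>i\<in>I. \<Sum>j\<in>J. hinner H e (b i) * (hinner H (a i) (c j) * hinner H (d j) e))
       = hinner H (finite_rank H I a b e) (finite_rank H J c d e)" by simp
  qed
  finally show ?thesis .
qed

text \<open>For linear \<open>S\<close> the operator is \<open>S\<close> preceded by the projection
  onto the span of \<open>F\<close>: a truncation of \<open>S\<close> along the basis.\<close>

lemma finite_rank_basis:
  assumes F: "finite F" "F \<subseteq> B" and S: "S \<in> carrier H \<rightarrow> carrier H" and e: "e \<in> B"
  shows "finite_rank H F S (\<lambda>f. f) e = (if e \<in> F then S e else \<zero>)"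
proof (rule eq_of_hinner_eq)
  have FC: "F \<subseteq> carrier H" using F basis_carrier[OF B] by auto
  then have SF: "S \<in> F \<rightarrow> carrier H" using S by auto
  show "finite_rank H F S (\<lambda>f. f) e \<in> carrier H" using SF by simp
  show "(if e \<in> F then S e else \<zero>) \<in> carrier H" using SF by auto
  fix z assume z: "z \<in> carrier H"
  have "hinner H (finite_rank H F S (\<lambda>f. f) e) z = (\<Sum>f\<in>F. hinner H e f * hinner H (S f) z)"
    by (rule hinner_finite_rank[OF F(1) SF z])
  also have "\<dots> = (\<Sum>f\<in>F. if f = e then hinner H (S e) z else 0)"
    by (rule sum.cong[OF refl]) (use F e in \<open>auto simp: hinner_basis[OF B]\<close>)
  finally show "hinner H (finite_rank H F S (\<lambda>f. f) e) z = hinner H (if e \<in> F then S e else \<zero>) z"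
    using F z by simp
qed

text \<open>The bound does not depend on \<open>U\<close> because the Hilbert-Schmidt norm is invariant under
  unitary conjugation.\<close>

lemma finite_rank_approx:
  assumes S: "adjoint_pair H S S'" and s: "((\<lambda>e. (hnorm H (S e))\<^sup>2) has_sum s) B" "s \<le> 1"
    and \<delta>: "\<delta> > 0"
  obtains F where "finite F" "F \<subseteq> B"
    "\<And>U V. adjoint_pair H U V \<Longrightarrow> (\<And>x. x \<in> carrier H \<Longrightarrow> hnorm H (U x) = hnorm H x) \<Longrightarrow>
       cmod ((\<Sum>\<^sub>\<infinity>e\<in>B. hinner H (U (S (V e))) (S e)) -
         (\<Sum>\<^sub>\<infinity>e\<in>B. hinner H (U (finite_rank H F S (\<lambda>f. f) (V e))) (finite_rank H F S (\<lambda>f. f) e)))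
       \<le> 2 * \<delta>"
proof -
  \<comment> \<open>The tail is made smaller than the square of \<delta> because its square root
    enters the Cauchy-Schwarz bounds.\<close>
  have "eventually (\<lambda>F. dist (\<Sum>e\<in>F. (hnorm H (S e))\<^sup>2) s < \<delta>\<^sup>2) (finite_subsets_at_top B)"
    using s(1) \<delta> unfolding has_sum_def tendsto_iff by auto
  then obtain F where F: "finite F" "F \<subseteq> B" and d: "dist (\<Sum>e\<in>F. (hnorm H (S e))\<^sup>2) s < \<delta>\<^sup>2"
    unfolding eventually_finite_subsets_at_top by auto
  define r where "r = (\<Sum>e\<in>F. (hnorm H (S e))\<^sup>2)"
  define R where "R = finite_rank H F S (\<lambda>f. f)"
  define R' where "R' = finite_rank H F (\<lambda>f. f) S"
  define D where "D x = S x \<ominus> R x" for x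
  define D' where "D' x = S' x \<ominus> R' x" for x
  have SC: "S \<in> carrier H \<rightarrow> carrier H" using S by (auto simp: adjoint_pair_def)
  have FC: "F \<subseteq> carrier H" using F basis_carrier[OF B] by auto
  have R: "adjoint_pair H R R'"
    unfolding R_def R'_def using F FC SC by (intro adjoint_pair_finite_rank) auto
  have D: "adjoint_pair H D D'"
    unfolding D_def D'_def by (rule adjoint_pair_minus[OF S R])
  have Rb: "R e = (if e \<in> F then S e else \<zero>)" if "e \<in> B" for e
    unfolding R_def by (rule finite_rank_basis[OF F SC that])
  have r1: "r \<le> s" unfolding r_def by (rule finite_sum_le_has_sum[OF s(1) F]) simp
  have "((\<lambda>e. (hnorm H (S e))\<^sup>2) has_sum r) F"
    unfolding r_def using F by (intro has_sum_finiteI) auto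
  also have "?this \<longleftrightarrow> ((\<lambda>e. (hnorm H (R e))\<^sup>2) has_sum r) B"
    by (rule has_sum_cong_neutral) (use F in \<open>auto simp: Rb subset_eq\<close>)
  finally have Rs: "((\<lambda>e. (hnorm H (R e))\<^sup>2) has_sum r) B" .
  \<comment> \<open>\<open>D\<close> vanishes on \<open>F\<close> and agrees with \<open>S\<close>
    on the rest of \<open>B\<close>, so the squared norms subtract term by term.\<close>
  have "((\<lambda>e. (hnorm H (S e))\<^sup>2 + - (hnorm H (R e))\<^sup>2) has_sum (s + - r)) B"
    by (intro has_sum_add s(1) has_sum_uminus[THEN iffD2]) (use Rs in auto)
  also have "?this \<longleftrightarrow> ((\<lambda>e. (hnorm H (D e))\<^sup>2) has_sum (s + - r)) B"
  proof (rule has_sum_cong)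
    fix e assume e: "e \<in> B"
    then have "S e \<in> carrier H" using SC basis_carrier[OF B] by auto
    then show "(hnorm H (S e))\<^sup>2 + - (hnorm H (R e))\<^sup>2 = (hnorm H (D e))\<^sup>2"
      using e minus_zero_right by (simp add: D_def Rb minus_self)
  qed
  finally have Ds: "((\<lambda>e. (hnorm H (D e))\<^sup>2) has_sum (s - r)) B" by simp
  have dsmall: "sqrt (s - r) \<le> \<delta>"
    using d r1 \<delta> by (intro real_le_lsqrt) (auto simp: r_def dist_real_def)
  have sq1: "sqrt s \<le> 1" "sqrt r \<le> 1" using s(2) r1 by auto
  show ?thesis
  proof (rule that[OF F])
    fix U V assume U: "adjoint_pair H U V" and iso: "\<And>x. x \<in> carrier H \<Longrightarrow> hnorm H (U x) = hnorm H x"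
    note cl = adjoint_pair_closed[OF U] adjoint_pair_closed[OF S] adjoint_pair_closed[OF R]
      adjoint_pair_closed[OF D] basis_carrier[OF B]
    have US: "((\<lambda>e. (hnorm H (U (S (V e))))\<^sup>2) has_sum s) B"
      by (rule has_sum_norm_conj[OF S s(1) U iso])
    have UR: "((\<lambda>e. (hnorm H (U (R (V e))))\<^sup>2) has_sum r) B"
      by (rule has_sum_norm_conj[OF R Rs U iso])
    have UD: "((\<lambda>e. (hnorm H (U (D (V e))))\<^sup>2) has_sum (s - r)) B"
      by (rule has_sum_norm_conj[OF D Ds U iso])
    have in1: "(\<lambda>e. U (S (V e))) \<in> B \<rightarrow> carrier H" "(\<lambda>e. U (R (V e))) \<in> B \<rightarrow> carrier H"
      "(\<lambda>e. U (D (V e))) \<in> B \<rightarrow> carrier H" "S \<in> B \<rightarrow> carrier H" "R \<in> B \<rightarrow> carrier H" "D \<in> B \<rightarrow> carrier H"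
      using cl by auto
    note cs1 = family_cauchy_schwarz[OF in1(1,4) US s(1)]
    note cs2 = family_cauchy_schwarz[OF in1(2,5) UR Rs]
    note cs3 = family_cauchy_schwarz[OF in1(3,4) UD s(1)]
    note cs4 = family_cauchy_schwarz[OF in1(2,6) UR Ds]
    \<comment> \<open>The two arguments are replaced one after the other, so each error term
      contains \<open>D\<close> once and a factor of norm at most 1 besides. This is the origin of
      the 2 in the bound.\<close>
    have "hinner H (U (S (V e))) (S e)
       = (hinner H (U (D (V e))) (S e) + hinner H (U (R (V e))) (D e)) + hinner H (U (R (V e))) (R e)"
      if "e \<in> B" for e
      using cl that unfolding D_def
      by (simp add: hinner_image_minus[OF U] hinner_minus_right)
    then have "(\<Sum>\<^sub>\<infinity>e\<in>B. hinner H (U (S (V e))) (S e))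
       = (\<Sum>\<^sub>\<infinity>e\<in>B. (hinner H (U (D (V e))) (S e) + hinner H (U (R (V e))) (D e))
           + hinner H (U (R (V e))) (R e))"
      by (rule infsum_cong)
    then have "(\<Sum>\<^sub>\<infinity>e\<in>B. hinner H (U (S (V e))) (S e)) - (\<Sum>\<^sub>\<infinity>e\<in>B. hinner H (U (R (V e))) (R e))
       = (\<Sum>\<^sub>\<infinity>e\<in>B. hinner H (U (D (V e))) (S e)) + (\<Sum>\<^sub>\<infinity>e\<in>B. hinner H (U (R (V e))) (D e))"
      using infsum_add[OF cs3(1) cs4(1)]
        infsum_add[OF summable_on_add[OF cs3(1) cs4(1)] cs2(1)] by simp
    then have "cmod ((\<Sum>\<^sub>\<infinity>e\<in>B. hinner H (U (S (V e))) (S e)) - (\<Sum>\<^sub>\<infinity>e\<in>B. hinner H (U (R (V e))) (R e)))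
       \<le> sqrt (s - r) * sqrt s + sqrt r * sqrt (s - r)"
      using norm_triangle_mono[OF cs3(2) cs4(2)] by simp
    also have "\<dots> \<le> \<delta> * 1 + 1 * \<delta>"
      using dsmall sq1 r1 \<delta> has_sum_nonneg[OF Rs] has_sum_nonneg[OF s(1)]
      by (intro add_mono mult_mono) auto
    finally show "cmod ((\<Sum>\<^sub>\<infinity>e\<in>B. hinner H (U (S (V e))) (S e)) -
         (\<Sum>\<^sub>\<infinity>e\<in>B. hinner H (U (finite_rank H F S (\<lambda>f. f) (V e))) (finite_rank H F S (\<lambda>f. f) e)))
       \<le> 2 * \<delta>" by (simp add: R_def)
  qed
qed

end

end

section \<open>The topology and the continuous sections over an HLS groupoid\<close>

text \<open>By \<open>adj\<close>, the pairing of \<open>T \<xi> u\<close> with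
  \<open>\<eta> u\<close> depends on \<xi> only through \<open>\<xi> u\<close>, and by
  \<open>ex\<close> the vectors \<open>\<eta> u\<close> exhaust the fibre. Hence the
  \<open>THE\<close> in \<open>localization\<close> has exactly one candidate.\<close>

lemma localization_eval:
  assumes H: "complex_hilbert_space (fibre E u)"
    and val: "\<And>\<xi>. \<xi> \<in> C0_sections X E \<Longrightarrow> \<xi> u \<in> carrier (fibre E u)"
    and ex: "\<And>v. v \<in> carrier (fibre E u) \<Longrightarrow> \<exists>\<xi>\<in>C0_sections X E. \<xi> u = v"
    and T: "T \<in> C0_sections X E \<rightarrow> C0_sections X E" "T' \<in> C0_sections X E \<rightarrow> C0_sections X E"
    and adj: "\<And>\<xi> \<eta>. \<xi> \<in> C0_sections X E \<Longrightarrow> \<eta> \<in> C0_sections X E \<Longrightarrow>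
      hinner (fibre E u) (T \<xi> u) (\<eta> u) = hinner (fibre E u) (\<xi> u) (T' \<eta> u)"
    and \<xi>: "\<xi> \<in> C0_sections X E"
  shows "localization X E T u (\<xi> u) = T \<xi> u"
  unfolding localization_def
proof (rule the_equality)
  show "\<exists>\<xi>'\<in>C0_sections X E. \<xi>' u = \<xi> u \<and> T \<xi>' u = T \<xi> u" using \<xi> by blast
  fix w assume "\<exists>\<xi>'\<in>C0_sections X E. \<xi>' u = \<xi> u \<and> T \<xi>' u = w"
  then obtain \<xi>' where \<xi>': "\<xi>' \<in> C0_sections X E" "\<xi>' u = \<xi> u" "T \<xi>' u = w" by blast
  have "T \<xi>' u = T \<xi> u"
  proof (rule complex_hilbert_space.eq_of_hinner_eq[OF H])
    show "T \<xi>' u \<in> carrier (fibre E u)" "T \<xi> u \<in> carrier (fibre E u)"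
      using T \<xi> \<xi>' by (auto intro: val)
    fix z assume "z \<in> carrier (fibre E u)"
    then obtain \<eta> where "\<eta> \<in> C0_sections X E" "\<eta> u = z" using ex by blast
    then show "hinner (fibre E u) (T \<xi>' u) z = hinner (fibre E u) (T \<xi> u) z"
      using adj[OF \<xi>, of \<eta>] adj[OF \<xi>'(1), of \<eta>] \<xi>' by simp
  qed
  then show "w = T \<xi> u" using \<xi>' by simp
qed

text \<open>The adjoint \<open>T'\<close> satisfies the same hypotheses with the roles exchanged, so
  its localization serves as the adjoint. The base stays arbitrary because both the HLS unit space
  and the one-point space are used.\<close>

lemma localization_adjoint_pair:
  assumes H: "complex_hilbert_space (fibre E u)" and u: "u \<in> topspace X"
    and val: "\<And>\<xi>. \<xi> \<in> C0_sections X E \<Longrightarrow> \<xi> u \<in> carrier (fibre E u)"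
    and ex: "\<And>v. v \<in> carrier (fibre E u) \<Longrightarrow> \<exists>\<xi>\<in>C0_sections X E. \<xi> u = v"
    and T: "adjointable X E T"
  shows "\<And>\<xi>. \<xi> \<in> C0_sections X E \<Longrightarrow> localization X E T u (\<xi> u) = T \<xi> u"
    and "\<exists>S'. adjoint_pair (fibre E u) (localization X E T u) S'"
proof -
  interpret complex_hilbert_space "fibre E u" by (rule H)
  obtain T' where TT: "T \<in> C0_sections X E \<rightarrow> C0_sections X E" "T' \<in> C0_sections X E \<rightarrow> C0_sections X E"
    and adj: "\<And>\<xi> \<eta>. \<xi> \<in> C0_sections X E \<Longrightarrow> \<eta> \<in> C0_sections X E \<Longrightarrow>
      hinner (fibre E u) (T \<xi> u) (\<eta> u) = hinner (fibre E u) (\<xi> u) (T' \<eta> u)"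
    using T u unfolding adjointable_def by blast
  have adj': "hinner (fibre E u) (T' \<xi> u) (\<eta> u) = hinner (fibre E u) (\<xi> u) (T \<eta> u)"
    if "\<xi> \<in> C0_sections X E" "\<eta> \<in> C0_sections X E" for \<xi> \<eta>
  proof -
    have c: "T' \<xi> u \<in> carrier (fibre E u)" "T \<eta> u \<in> carrier (fibre E u)"
      using TT that by (auto intro: val)
    show ?thesis
      using adj[OF that(2,1)] hinner_commute[OF c(1) val[OF that(2)]]
        hinner_commute[OF val[OF that(1)] c(2)] by simp
  qed
  have 1: "localization X E T u (\<xi> u) = T \<xi> u" if "\<xi> \<in> C0_sections X E" for \<xi>
    by (rule localization_eval[where T' = T'])
      (use H TT that in \<open>simp_all add: val ex adj\<close>)
  have 2: "localization X E T' u (\<xi> u) = T' \<xi> u" if "\<xi> \<in> C0_sections X E" for \<xi>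
    by (rule localization_eval[where T' = T])
      (use H TT that in \<open>simp_all add: val ex adj'\<close>)
  show "localization X E T u (\<xi> u) = T \<xi> u" if "\<xi> \<in> C0_sections X E" for \<xi>
    by (rule 1[OF that])
  have "adjoint_pair (fibre E u) (localization X E T u) (localization X E T' u)"
    unfolding adjoint_pair_def
  proof (intro conjI ballI Pi_I)
    fix x assume "x \<in> carrier (fibre E u)"
    then obtain \<xi> where \<xi>: "\<xi> \<in> C0_sections X E" "\<xi> u = x" using ex by blast
    show "localization X E T u x \<in> carrier (fibre E u)" "localization X E T' u x \<in> carrier (fibre E u)"
      using 1[OF \<xi>(1)] 2[OF \<xi>(1)] \<xi> TT by (auto intro: val)
    fix y assume "y \<in> carrier (fibre E u)"
    then obtain \<eta> where \<eta>: "\<eta> \<in> C0_sections X E" "\<eta> u = y" using ex by blast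
    show "hinner (fibre E u) (localization X E T u x) y = hinner (fibre E u) x (localization X E T' u y)"
      using adj[OF \<xi>(1) \<eta>(1)] 1[OF \<xi>(1)] 2[OF \<eta>(1)] \<xi> \<eta> by simp
  qed
  then show "\<exists>S'. adjoint_pair (fibre E u) (localization X E T u) S'" by blast
qed

text \<open>Diagonal choice: \<open>\<kappa> n\<close> is the largest index whose property has
  already set in at time \<open>n\<close>, so it tends to infinity, but slowly enough.\<close>

lemma diagonal_index:
  fixes Q :: "nat \<Rightarrow> nat \<Rightarrow> bool"
  assumes "\<And>k. eventually (Q k) sequentially"
  obtains \<kappa> where "filterlim \<kappa> at_top sequentially" "eventually (\<lambda>n. Q (\<kappa> n) n) sequentially"
proof -
  obtain N where N: "\<And>k n. N k \<le> n \<Longrightarrow> Q k n"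
    using assms unfolding eventually_sequentially by metis
  \<comment> \<open>The bound \<open>k \<le> n\<close> makes the set finite, and admitting 0 makes
    it nonempty. The value 0 may be premature while \<open>n < N 0\<close>, so \<open>Q\<close> is
    claimed only from \<open>N 0\<close> on.\<close>
  define \<kappa> where "\<kappa> n = Max {k. k \<le> n \<and> (k = 0 \<or> N k \<le> n)}" for n
  have fin: "finite {k. k \<le> n \<and> (k = 0 \<or> N k \<le> n)}" for n by simp
  have ge: "k \<le> \<kappa> n" if "k \<le> n" "N k \<le> n" for k n
    unfolding \<kappa>_def using that by (intro Max_ge fin) auto
  have "\<kappa> n \<in> {k. k \<le> n \<and> (k = 0 \<or> N k \<le> n)}" for n
    unfolding \<kappa>_def by (intro Max_in fin) auto
  then have \<kappa>0: "\<kappa> n = 0 \<or> N (\<kappa> n) \<le> n" for n by blast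
  have Q: "Q (\<kappa> n) n" if "N 0 \<le> n" for n
    by (rule N) (use \<kappa>0[of n] that in \<open>elim disjE, simp_all\<close>)
  show ?thesis
  proof
    show "filterlim \<kappa> at_top sequentially"
      unfolding filterlim_at_top eventually_sequentially
      using ge by (metis max.bounded_iff)
    show "eventually (\<lambda>n. Q (\<kappa> n) n) sequentially"
      using Q unfolding eventually_sequentially by blast
  qed
qed

locale hls_representation =
  fixes \<Gamma> :: "('a, 'm) monoid_scheme" and K :: "nat \<Rightarrow> 'a set"
    and E :: "('a hls, 'v) hilbert_bundle" and \<pi> :: "'a hls \<Rightarrow> 'v \<Rightarrow> 'v"
  assumes approx: "approximated_group \<Gamma> K"
    and rep: "continuous_unitary_rep (hls_groupoid \<Gamma> K) E \<pi>"
begin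

section \<open>Units and arrows of the HLS groupoid\<close>

abbreviation "\<G> \<equiv> hls_groupoid \<Gamma> K"
abbreviation "X \<equiv> unit_space \<G>"
abbreviation "pt n \<equiv> At n (K n)"
abbreviation "pinf \<equiv> AtInfty \<one>\<^bsub>\<Gamma>\<^esub>"

text \<open>The arrow represented by \<open>g\<close> over a given unit; from the second argument
  only the fibre is read. This follows one group element through all fibres, as the basic
  neighbourhoods do. Different \<open>g\<close> may give the same arrow over a finite
  \<open>n\<close>.\<close>

fun arr :: "'a \<Rightarrow> 'a hls \<Rightarrow> 'a hls" where
  "arr g (At n c) = At n (K n #>\<^bsub>\<Gamma>\<^esub> g)"
| "arr g (AtInfty h) = AtInfty g"

sublocale group \<Gamma> using approx by (simp add: approximated_group_def)
sublocale rep: continuous_unitary_rep \<G> E \<pi> by (rule rep)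

lemma normal_K: "K n \<lhd> \<Gamma>"
  using approx by (simp add: approximated_group_def)

lemma one_quotient [simp]: "\<one>\<^bsub>\<Gamma> Mod K n\<^esub> = K n"
  by (simp add: FactGroup_def)

lemma coset_one [simp]: "K n #>\<^bsub>\<Gamma>\<^esub> \<one>\<^bsub>\<Gamma>\<^esub> = K n"
  using normal_K by (simp add: coset_mult_one normal_imp_subgroup subgroup.subset)

lemma carrier_quotient: "carrier (\<Gamma> Mod K n) = (\<lambda>g. K n #>\<^bsub>\<Gamma>\<^esub> g) ` carrier \<Gamma>"
  by (auto simp: FactGroup_def RCOSETS_def)

lemma finite_quotient: "finite (carrier (\<Gamma> Mod K n))"
  using approx by (simp add: approximated_group_def FactGroup_def)

lemma group_quotient: "group (\<Gamma> Mod K n)"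
  by (rule normal.factorgroup_is_group[OF normal_K])

lemma gtop_eq: "gtop \<G> = hls_topology \<Gamma> K"
  and gdom_eq [simp]: "gdom \<G> = hls_base \<Gamma> K"
  and grng_eq [simp]: "grng \<G> = hls_base \<Gamma> K"
  and gmult_eq [simp]: "gmult \<G> = hls_mult \<Gamma> K"
  and ginv_eq [simp]: "ginv \<G> = hls_inv \<Gamma> K"
  by (simp_all add: hls_groupoid_def)

lemma arrows_eq: "arrows \<G> = {At n c | n c. c \<in> carrier (\<Gamma> Mod K n)} \<union> AtInfty ` carrier \<Gamma>"
proof -
  let ?P = "{{At n c} | n c. c \<in> carrier (\<Gamma> Mod K n)}"
  let ?Q = "{insert (AtInfty g) {At n (K n #>\<^bsub>\<Gamma>\<^esub> g) | n. n > N} | g N. g \<in> carrier \<Gamma>}"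
  have p: "\<Union> ?P = {At n c | n c. c \<in> carrier (\<Gamma> Mod K n)}" by blast
  have q: "\<Union> ?Q \<subseteq> {At n c | n c. c \<in> carrier (\<Gamma> Mod K n)} \<union> AtInfty ` carrier \<Gamma>"
    unfolding carrier_quotient by blast
  have b: "AtInfty ` carrier \<Gamma> \<subseteq> \<Union> ?Q"
  proof
    fix x assume "x \<in> AtInfty ` carrier \<Gamma>"
    then obtain g where g: "g \<in> carrier \<Gamma>" "x = AtInfty g" by auto
    have "insert (AtInfty g) {At n (K n #>\<^bsub>\<Gamma>\<^esub> g) | n. n > 0} \<in> ?Q" using g by auto
    then show "x \<in> \<Union> ?Q" using g by (intro UnionI) auto
  qed
  have "P \<union> Q = A \<union> B" if "P = A" "Q \<subseteq> A \<union> B" "B \<subseteq> Q" for P Q A B :: "'a hls set"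
    using that by blast
  from this[OF p q b] show ?thesis
    unfolding gtop_eq hls_topology_def topology_generated_by_topspace Union_Un_distrib .
qed

lemma units_eq: "units \<G> = insert pinf (range pt)"
proof
  show "units \<G> \<subseteq> insert pinf (range pt)"
    unfolding units_def arrows_eq by auto
  have "pt n \<in> units \<G>" for n
  proof -
    have "K n \<in> carrier (\<Gamma> Mod K n)"
      using monoid.one_closed[OF group.is_monoid[OF group_quotient], of n] by simp
    then have "pt n \<in> arrows \<G>" unfolding arrows_eq by blast
    then show ?thesis unfolding units_def by (rule rev_image_eqI) simp
  qed
  moreover have "pinf \<in> units \<G>"
  proof -
    have "pinf \<in> arrows \<G>" unfolding arrows_eq by blast
    then show ?thesis unfolding units_def by (rule rev_image_eqI) simp
  qed
  ultimately show "insert pinf (range pt) \<subseteq> units \<G>" by blast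
qed

lemma units_cases:
  assumes "u \<in> units \<G>"
  obtains (finite) n where "u = pt n" | (infinity) "u = pinf"
  using assms by (auto simp: units_eq)

lemma pt_units [simp]: "pt n \<in> units \<G>" and pinf_units [simp]: "pinf \<in> units \<G>"
  by (auto simp: units_eq)

lemma units_subset: "units \<G> \<subseteq> arrows \<G>"
  using one_closed coset_one unfolding units_eq arrows_eq carrier_quotient by blast

lemma topspace_X [simp]: "topspace X = units \<G>"
  using units_subset by (auto simp: unit_space_def)

lemma arr_one: "u \<in> units \<G> \<Longrightarrow> arr \<one>\<^bsub>\<Gamma>\<^esub> u = u"
  by (auto elim: units_cases)

lemma arr_arrow: "g \<in> carrier \<Gamma> \<Longrightarrow> u \<in> units \<G> \<Longrightarrow> arr g u \<in> arrows \<G>"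
  by (erule units_cases) (auto simp: arrows_eq carrier_quotient)

lemma base_arr: "u \<in> units \<G> \<Longrightarrow> hls_base \<Gamma> K (arr g u) = u"
  by (auto elim: units_cases)

lemma mult_arr:
  "g \<in> carrier \<Gamma> \<Longrightarrow> h \<in> carrier \<Gamma> \<Longrightarrow> u \<in> units \<G> \<Longrightarrow>
    hls_mult \<Gamma> K (arr g u) (arr h u) = arr (g \<otimes>\<^bsub>\<Gamma>\<^esub> h) u"
  by (erule units_cases) (simp_all add: FactGroup_def normal.rcos_sum[OF normal_K])

lemma inv_arr:
  "g \<in> carrier \<Gamma> \<Longrightarrow> u \<in> units \<G> \<Longrightarrow> hls_inv \<Gamma> K (arr g u) = arr (inv\<^bsub>\<Gamma>\<^esub> g) u"
  by (erule units_cases)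
    (simp_all add: normal.inv_FactGroup[OF normal_K] carrier_quotient normal.rcos_inv[OF normal_K])

lemma arrow_cases:
  assumes "x \<in> arrows \<G>"
  obtains g u where "g \<in> carrier \<Gamma>" "u \<in> units \<G>" "x = arr g u"
proof -
  consider n g where "g \<in> carrier \<Gamma>" "x = At n (K n #>\<^bsub>\<Gamma>\<^esub> g)" | g where "g \<in> carrier \<Gamma>" "x = AtInfty g"
    using assms unfolding arrows_eq carrier_quotient by blast
  then show ?thesis
  proof cases
    case (1 n g)
    then show ?thesis using that[of g "pt n"] by simp
  next
    case (2 g)
    then show ?thesis using that[of g pinf] by simp
  qed
qed

section \<open>Convergence to infinity and compact sets\<close>

lemma openin_arr_nbhd:
  assumes "g \<in> carrier \<Gamma>"
  shows "openin (gtop \<G>) (insert (arr g pinf) {arr g (pt n) | n. n > N})"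
  unfolding gtop_eq hls_topology_def
  by (rule topology_generated_by_Basis) (use assms in auto)

lemma openin_arr_pt:
  assumes "g \<in> carrier \<Gamma>"
  shows "openin (gtop \<G>) {arr g (pt n)}"
  unfolding gtop_eq hls_topology_def
  by (rule topology_generated_by_Basis) (use assms in \<open>auto simp: carrier_quotient\<close>)

text \<open>Induction on how \<open>W\<close> is generated: the only generators containing
  \<open>arr g pinf\<close> are the tails along the same \<open>g\<close>. Continuity at infinity
  thereby becomes convergence of sequences.\<close>

lemma eventually_arr_in_open:
  assumes W: "openin (gtop \<G>) W" and g: "arr g pinf \<in> W"
  shows "eventually (\<lambda>n. arr g (pt n) \<in> W) sequentially"
proof -
  have "generate_topology_on
     ({{At n c} | n c. c \<in> carrier (\<Gamma> Mod K n)} \<union>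
      {insert (AtInfty g) {At n (K n #>\<^bsub>\<Gamma>\<^esub> g) | n. n > N} | g N. g \<in> carrier \<Gamma>}) W"
    using W unfolding gtop_eq hls_topology_def by (rule openin_topology_generated_by)
  then show ?thesis using g
  proof (induction rule: generate_topology_on.induct)
    case (Int a b)
    then show ?case by (auto intro: eventually_conj)
  next
    case (UN \<K>)
    then obtain k where k: "k \<in> \<K>" "arr g pinf \<in> k" by blast
    then have "eventually (\<lambda>n. arr g (pt n) \<in> k) sequentially" using UN by blast
    then show ?case by eventually_elim (use k in blast)
  next
    case (Basis s)
    then obtain N where "s = insert (AtInfty g) {At n (K n #>\<^bsub>\<Gamma>\<^esub> g) | n. n > N}" by auto
    then show ?case using eventually_gt_at_top[of N] by (auto elim: eventually_mono)
  qed simp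
qed

lemma continuous_arr_tendsto:
  assumes f: "continuous_map (gtop \<G>) euclidean f" and g: "g \<in> carrier \<Gamma>"
  shows "(\<lambda>n. f (arr g (pt n))) \<longlonglongrightarrow> f (arr g pinf)"
proof (rule topological_tendstoI)
  fix S assume S: "open S" "f (arr g pinf) \<in> S"
  have "openin (gtop \<G>) {x \<in> arrows \<G>. f x \<in> S}"
    using openin_continuous_map_preimage[OF f] S by simp
  then have "eventually (\<lambda>n. arr g (pt n) \<in> {x \<in> arrows \<G>. f x \<in> S}) sequentially"
    by (rule eventually_arr_in_open) (use S arr_arrow[OF g pinf_units] in auto)
  then show "eventually (\<lambda>n. f (arr g (pt n)) \<in> S) sequentially"
    by eventually_elim simp
qed

lemma eventually_pt_in_open:
  assumes W: "openin X W" and u: "pinf \<in> W"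
  shows "eventually (\<lambda>n. pt n \<in> W) sequentially"
proof -
  obtain W' where W': "openin (gtop \<G>) W'" "W = W' \<inter> units \<G>"
    using W by (auto simp: unit_space_def openin_subtopology)
  have "eventually (\<lambda>n. arr \<one>\<^bsub>\<Gamma>\<^esub> (pt n) \<in> W') sequentially"
    by (rule eventually_arr_in_open[OF W'(1)]) (use u W' in simp)
  then show ?thesis by eventually_elim (use W' in simp)
qed

lemma continuous_pt_tendsto:
  assumes f: "continuous_map X euclidean f"
  shows "(\<lambda>n. f (pt n)) \<longlonglongrightarrow> f pinf"
proof (rule topological_tendstoI)
  fix S assume S: "open S" "f pinf \<in> S"
  have "openin X {x \<in> topspace X. f x \<in> S}"
    using openin_continuous_map_preimage[OF f] S by simp
  then have "eventually (\<lambda>n. pt n \<in> {x \<in> topspace X. f x \<in> S}) sequentially"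
    by (rule eventually_pt_in_open) (use S in auto)
  then show "eventually (\<lambda>n. f (pt n) \<in> S) sequentially"
    by eventually_elim simp
qed

lemma openin_pt: "openin X {pt n}"
proof -
  have "openin (gtop \<G>) {pt n}" using openin_arr_pt[OF one_closed, of n] by simp
  moreover have "{pt n} = {pt n} \<inter> units \<G>" by auto
  ultimately show ?thesis unfolding unit_space_def openin_subtopology by blast
qed

lemma openin_nbhd_pinf: "openin X (insert pinf {pt n | n. n > N})"
proof -
  have "openin (gtop \<G>) (insert pinf {pt n | n. n > N})"
    using openin_arr_nbhd[OF one_closed, of N] by simp
  moreover have "insert pinf {pt n | n. n > N} = insert pinf {pt n | n. n > N} \<inter> units \<G>" by auto
  ultimately show ?thesis unfolding unit_space_def openin_subtopology by blast
qed

text \<open>Any open set around \<open>pinf\<close> misses only finitely many units. As a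
  consequence vanishing at infinity is automatic, and all continuous sections are
  \<open>C0_sections\<close>.\<close>

lemma compact_X: "compactin X (units \<G>)"
  unfolding compactin_def
proof (intro conjI allI impI)
  fix \<U> assume U: "Ball \<U> (openin X) \<and> units \<G> \<subseteq> \<Union> \<U>"
  obtain W where W: "W \<in> \<U>" "pinf \<in> W" using U pinf_units by blast
  have "eventually (\<lambda>n. pt n \<in> W) sequentially"
    by (rule eventually_pt_in_open) (use U W in auto)
  then obtain N where N: "\<And>n. n \<ge> N \<Longrightarrow> pt n \<in> W"
    unfolding eventually_sequentially by blast
  have "\<exists>V. V \<in> \<U> \<and> pt n \<in> V" for n
  proof -
    have "pt n \<in> \<Union> \<U>" using U by (auto dest: subsetD[OF _ pt_units[of n]])
    then show ?thesis by auto
  qed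
  then obtain V where V: "\<And>n. V n \<in> \<U>" "\<And>n. pt n \<in> V n" by metis
  have "units \<G> \<subseteq> \<Union> (insert W (V ` {..<N}))"
  proof
    fix u assume "u \<in> units \<G>"
    then show "u \<in> \<Union> (insert W (V ` {..<N}))"
    proof (cases rule: units_cases)
      case (finite n)
      show ?thesis
      proof (cases "n < N")
        case True
        then have "V n \<in> insert W (V ` {..<N})" by simp
        then show ?thesis using V(2)[of n] finite by blast
      next
        case False
        then show ?thesis using N[of n] finite by simp
      qed
    qed (use W in simp)
  qed
  then show "\<exists>\<F>. finite \<F> \<and> \<F> \<subseteq> \<U> \<and> units \<G> \<subseteq> \<Union> \<F>"
    using W V by (intro exI[of _ "insert W (V ` {..<N})"]) auto
qed simp

text \<open>The sheets \<open>W g\<close> are open and cover all arrows, so finitely many of them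
  cover \<open>C\<close>.\<close>

lemma compact_arrows:
  assumes C: "compactin (gtop \<G>) C"
  obtains A where "finite A" "A \<subseteq> carrier \<Gamma>" "\<And>x. x \<in> C \<Longrightarrow> \<exists>g\<in>A. \<exists>u\<in>units \<G>. x = arr g u"
proof -
  define W where "W g = arr g ` units \<G>" for g
  have "openin (gtop \<G>) (W g)" if g: "g \<in> carrier \<Gamma>" for g
  proof -
    \<comment> \<open>Neighbourhoods are given by \<open>n > N\<close>, so even for
      \<open>N = 0\<close> the arrow over 0 is missing and its singleton is added.\<close>
    have "W g = insert (arr g pinf) {arr g (pt n) | n. n > 0} \<union> {arr g (pt 0)}"
      unfolding W_def units_eq by (auto simp: image_iff)
    then show ?thesis
      using openin_Un[OF openin_arr_nbhd[OF g, of 0] openin_arr_pt[OF g, of 0]] by simp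
  qed
  moreover have "C \<subseteq> \<Union> (W ` carrier \<Gamma>)"
  proof
    fix x assume "x \<in> C"
    then have "x \<in> arrows \<G>" using compactin_subset_topspace[OF C] by blast
    then show "x \<in> \<Union> (W ` carrier \<Gamma>)" by (cases rule: arrow_cases) (auto simp: W_def)
  qed
  ultimately obtain \<F> where F: "finite \<F>" "\<F> \<subseteq> W ` carrier \<Gamma>" "C \<subseteq> \<Union> \<F>"
    using compactinD[OF C, of "W ` carrier \<Gamma>"] by auto
  obtain A where A: "A \<subseteq> carrier \<Gamma>" "finite A" "\<F> = W ` A"
    using finite_subset_image[OF F(1,2)] by blast
  show ?thesis
  proof (rule that[OF A(2,1)])
    fix x assume "x \<in> C"
    then obtain g where "g \<in> A" "x \<in> W g" using F(3) A(3) by blast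
    then show "\<exists>g\<in>A. \<exists>u\<in>units \<G>. x = arr g u" unfolding W_def by blast
  qed
qed

section \<open>Continuous sections over the unit space\<close>

lemma fibre_hilbert: "u \<in> units \<G> \<Longrightarrow> complex_hilbert_space (fibre E u)"
  using rep.fibre_hilbert by simp

lemma section_value:
  "\<xi> \<in> csections E \<Longrightarrow> u \<in> units \<G> \<Longrightarrow> \<xi> u \<in> carrier (fibre E u)"
  using rep.csections_subset by (auto simp: PiE_iff)

lemma section_extensional: "\<xi> \<in> csections E \<Longrightarrow> \<xi> \<in> extensional (units \<G>)"
  using rep.csections_subset by (auto simp: PiE_iff)

lemma C0_sections_eq: "C0_sections X E = csections E"
  unfolding C0_sections_def using compact_X by auto

text \<open>Over an isolated point the singleton is an open neighbourhood, and density of the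
  section values suffices there. Only the local condition at infinity remains.\<close>

lemma sectionI:
  assumes \<xi>: "\<xi> \<in> (\<Pi>\<^sub>E u\<in>units \<G>. carrier (fibre E u))"
    and approx: "\<And>\<epsilon>. \<epsilon> > 0 \<Longrightarrow> \<exists>\<eta>\<in>csections E. hdist (fibre E pinf) (\<xi> pinf) (\<eta> pinf) \<le> \<epsilon> \<and>
      (\<forall>\<^sub>F n in sequentially. hdist (fibre E (pt n)) (\<xi> (pt n)) (\<eta> (pt n)) \<le> \<epsilon>)"
  shows "\<xi> \<in> csections E"
proof (rule rep.csections_local)
  show "\<xi> \<in> (\<Pi>\<^sub>E u\<in>topspace X. carrier (fibre E u))" using \<xi> by simp
  show "\<forall>u\<in>topspace X. \<forall>\<epsilon>>0. \<exists>\<eta>\<in>csections E. \<exists>W. openin X W \<and> u \<in> W \<and>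
          (\<forall>w\<in>W. hdist (fibre E w) (\<xi> w) (\<eta> w) \<le> \<epsilon>)"
  proof (intro ballI allI impI)
    fix u and \<epsilon> :: real assume u: "u \<in> topspace X" and e: "\<epsilon> > 0"
    from u have "u \<in> units \<G>" by simp
    then show "\<exists>\<eta>\<in>csections E. \<exists>W. openin X W \<and> u \<in> W \<and> (\<forall>w\<in>W. hdist (fibre E w) (\<xi> w) (\<eta> w) \<le> \<epsilon>)"
    proof (cases rule: units_cases)
      case (finite n)
      have "\<xi> u \<in> carrier (fibre E u)" using \<xi> u by auto
      then obtain \<eta> where "\<eta> \<in> csections E" "hdist (fibre E u) (\<xi> u) (\<eta> u) < \<epsilon>"
        using rep.csections_dense[OF u] e unfolding dense_in_hilbert_def by blast
      then show ?thesis using openin_pt[of n] finite by force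
    next
      case infinity
      obtain \<eta> where \<eta>: "\<eta> \<in> csections E" "hdist (fibre E pinf) (\<xi> pinf) (\<eta> pinf) \<le> \<epsilon>"
        "\<forall>\<^sub>F n in sequentially. hdist (fibre E (pt n)) (\<xi> (pt n)) (\<eta> (pt n)) \<le> \<epsilon>"
        using approx[OF e] by blast
      then obtain N where N: "\<And>n. n \<ge> N \<Longrightarrow> hdist (fibre E (pt n)) (\<xi> (pt n)) (\<eta> (pt n)) \<le> \<epsilon>"
        unfolding eventually_sequentially by blast
      show ?thesis
        using \<eta> N openin_nbhd_pinf[of N] infinity
        by (intro bexI[of _ \<eta>] exI[of _ "insert pinf {pt n | n. n > N}"]) auto
    qed
  qed
qed

text \<open>Isolated points impose no continuity condition. This freedom is what later permits
  replacing an operator over finitely many \<open>n\<close>.\<close>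

lemma section_modify:
  assumes \<xi>: "\<xi> \<in> (\<Pi>\<^sub>E u\<in>units \<G>. carrier (fibre E u))" and \<eta>: "\<eta> \<in> csections E"
    and eq: "\<xi> pinf = \<eta> pinf" "\<forall>\<^sub>F n in sequentially. \<xi> (pt n) = \<eta> (pt n)"
  shows "\<xi> \<in> csections E"
proof (rule sectionI[OF \<xi>])
  fix \<epsilon> :: real assume e: "\<epsilon> > 0"
  have z: "hdist (fibre E u) (\<eta> u) (\<eta> u) = 0" if "u \<in> units \<G>" for u
    using complex_hilbert_space.hdist_refl[OF fibre_hilbert] section_value[OF \<eta>] that by blast
  have "\<forall>\<^sub>F n in sequentially. hdist (fibre E (pt n)) (\<xi> (pt n)) (\<eta> (pt n)) \<le> \<epsilon>"
    using eq(2) by eventually_elim (use z e in simp)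
  then show "\<exists>\<eta>\<in>csections E. hdist (fibre E pinf) (\<xi> pinf) (\<eta> pinf) \<le> \<epsilon> \<and>
      (\<forall>\<^sub>F n in sequentially. hdist (fibre E (pt n)) (\<xi> (pt n)) (\<eta> (pt n)) \<le> \<epsilon>)"
    using \<eta> eq(1) z[OF pinf_units] e by (intro bexI[of _ \<eta>]) auto
qed

lemma section_norm_tendsto:
  "\<xi> \<in> csections E \<Longrightarrow> (\<lambda>n. hnorm (fibre E (pt n)) (\<xi> (pt n))) \<longlonglongrightarrow> hnorm (fibre E pinf) (\<xi> pinf)"
  using continuous_pt_tendsto[OF rep.csections_norm] by simp

lemma section_smult_const:
  "\<xi> \<in> csections E \<Longrightarrow> (\<lambda>u\<in>units \<G>. a \<odot>\<^bsub>fibre E u\<^esub> \<xi> u) \<in> csections E"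
  using rep.csections_smult[of \<xi> a] by simp

lemma section_add:
  "\<xi> \<in> csections E \<Longrightarrow> \<eta> \<in> csections E \<Longrightarrow> (\<lambda>u\<in>units \<G>. \<xi> u \<oplus>\<^bsub>fibre E u\<^esub> \<eta> u) \<in> csections E"
  using rep.csections_add[of \<xi> \<eta>] by simp

lemma section_dist_tendsto:
  assumes \<xi>: "\<xi> \<in> csections E" and \<eta>: "\<eta> \<in> csections E"
  shows "(\<lambda>n. hdist (fibre E (pt n)) (\<xi> (pt n)) (\<eta> (pt n))) \<longlonglongrightarrow> hdist (fibre E pinf) (\<xi> pinf) (\<eta> pinf)"
proof -
  define \<zeta> where "\<zeta> = (\<lambda>u\<in>units \<G>. \<xi> u \<oplus>\<^bsub>fibre E u\<^esub> (\<lambda>u\<in>units \<G>. (-1) \<odot>\<^bsub>fibre E u\<^esub> \<eta> u) u)"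
  have z: "\<zeta> \<in> csections E"
    unfolding \<zeta>_def by (intro section_add \<xi> section_smult_const \<eta>)
  have "hnorm (fibre E u) (\<zeta> u) = hdist (fibre E u) (\<xi> u) (\<eta> u)" if u: "u \<in> units \<G>" for u
  proof -
    interpret complex_hilbert_space "fibre E u" by (rule fibre_hilbert[OF u])
    have c: "\<xi> u \<in> carrier (fibre E u)" "\<eta> u \<in> carrier (fibre E u)" "\<zeta> u \<in> carrier (fibre E u)"
      using \<xi> \<eta> z u by (simp_all add: section_value)
    have "\<zeta> u = \<xi> u \<ominus>\<^bsub>fibre E u\<^esub> \<eta> u"
      by (rule eq_of_hinner_eq)
        (use c u in \<open>simp_all add: \<zeta>_def hinner_add_left hinner_minus_left hinner_smult_left\<close>)
    then show ?thesis by (simp add: hdist_def)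
  qed
  then show ?thesis using section_norm_tendsto[OF z] by simp
qed

text \<open>The axioms give constant multiples only. Near infinity the product is compared with the
  constant multiple by \<open>f pinf\<close>; the error is the distance of the scalars times a
  convergent, hence bounded, norm.\<close>

lemma section_smult:
  assumes \<xi>: "\<xi> \<in> csections E" and f: "(\<lambda>n. f (pt n)) \<longlonglongrightarrow> f pinf"
  shows "(\<lambda>u\<in>units \<G>. f u \<odot>\<^bsub>fibre E u\<^esub> \<xi> u) \<in> csections E"
proof (rule sectionI)
  have cl: "f u \<odot>\<^bsub>fibre E u\<^esub> \<xi> u \<in> carrier (fibre E u)" if "u \<in> units \<G>" for u
    using complex_hilbert_space.smult_carrier[OF fibre_hilbert] section_value[OF \<xi>] that by blast
  then show "(\<lambda>u\<in>units \<G>. f u \<odot>\<^bsub>fibre E u\<^esub> \<xi> u) \<in> (\<Pi>\<^sub>E u\<in>units \<G>. carrier (fibre E u))"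
    by auto
  fix \<epsilon> :: real assume e: "\<epsilon> > 0"
  let ?\<eta> = "\<lambda>u\<in>units \<G>. f pinf \<odot>\<^bsub>fibre E u\<^esub> \<xi> u"
  have d: "hdist (fibre E u) (f u \<odot>\<^bsub>fibre E u\<^esub> \<xi> u) (?\<eta> u) = cmod (f u - f pinf) * hnorm (fibre E u) (\<xi> u)"
    if "u \<in> units \<G>" for u
    using complex_hilbert_space.hdist_smult[OF fibre_hilbert section_value[OF \<xi>]] that by simp
  have "(\<lambda>n. cmod (f (pt n) - f pinf) * hnorm (fibre E (pt n)) (\<xi> (pt n)))
      \<longlonglongrightarrow> 0 * hnorm (fibre E pinf) (\<xi> pinf)"
    by (intro tendsto_mult section_norm_tendsto[OF \<xi>] tendsto_norm_zero LIM_zero f)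
  then have "\<forall>\<^sub>F n in sequentially. cmod (f (pt n) - f pinf) * hnorm (fibre E (pt n)) (\<xi> (pt n)) < \<epsilon>"
    using e by (auto dest: order_tendstoD)
  then have "\<forall>\<^sub>F n in sequentially.
      hdist (fibre E (pt n)) ((\<lambda>u\<in>units \<G>. f u \<odot>\<^bsub>fibre E u\<^esub> \<xi> u) (pt n)) (?\<eta> (pt n)) \<le> \<epsilon>"
    by eventually_elim (use d in \<open>simp del: restrict_apply add: restrict_apply'\<close>)
  then show "\<exists>\<eta>\<in>csections E.
      hdist (fibre E pinf) ((\<lambda>u\<in>units \<G>. f u \<odot>\<^bsub>fibre E u\<^esub> \<xi> u) pinf) (\<eta> pinf) \<le> \<epsilon> \<and>
      (\<forall>\<^sub>F n in sequentially.
        hdist (fibre E (pt n)) ((\<lambda>u\<in>units \<G>. f u \<odot>\<^bsub>fibre E u\<^esub> \<xi> u) (pt n)) (\<eta> (pt n)) \<le> \<epsilon>)"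
    using section_smult_const[OF \<xi>, of "f pinf"] d[OF pinf_units] e
    by (intro bexI[of _ ?\<eta>]) auto
qed

lemma section_finsum:
  assumes "finite I" "\<And>i. i \<in> I \<Longrightarrow> \<xi> i \<in> csections E"
  shows "(\<lambda>u\<in>units \<G>. finsum (fibre E u) (\<lambda>i. \<xi> i u) I) \<in> csections E"
  using assms
proof (induction I rule: finite_induct)
  case empty
  have "(\<lambda>u\<in>units \<G>. finsum (fibre E u) (\<lambda>i. \<xi> i u) {}) = (\<lambda>u\<in>units \<G>. \<zero>\<^bsub>fibre E u\<^esub>)"
  proof (rule restrict_ext)
    fix u assume "u \<in> units \<G>"
    then interpret complex_hilbert_space "fibre E u" by (rule fibre_hilbert)
    show "finsum (fibre E u) (\<lambda>i. \<xi> i u) {} = \<zero>\<^bsub>fibre E u\<^esub>" by simp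
  qed
  then show ?case using rep.csections_zero by (simp only: topspace_X)
next
  case (insert i I)
  have IH: "(\<lambda>u\<in>units \<G>. finsum (fibre E u) (\<lambda>i. \<xi> i u) I) \<in> csections E"
    by (rule insert.IH) (rule insert.prems, simp)
  have "(\<lambda>u\<in>units \<G>. finsum (fibre E u) (\<lambda>i. \<xi> i u) (insert i I))
     = (\<lambda>u\<in>units \<G>. \<xi> i u \<oplus>\<^bsub>fibre E u\<^esub> (\<lambda>u\<in>units \<G>. finsum (fibre E u) (\<lambda>i. \<xi> i u) I) u)"
  proof (rule restrict_ext)
    fix u assume u: "u \<in> units \<G>"
    then interpret complex_hilbert_space "fibre E u" by (rule fibre_hilbert)
    show "finsum (fibre E u) (\<lambda>i. \<xi> i u) (insert i I)
      = \<xi> i u \<oplus>\<^bsub>fibre E u\<^esub> (\<lambda>u\<in>units \<G>. finsum (fibre E u) (\<lambda>i. \<xi> i u) I) u"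
      using insert u by (simp add: section_value)
  qed
  moreover have "\<xi> i \<in> csections E" by (rule insert.prems) simp
  ultimately show ?case using section_add[OF _ IH, of "\<xi> i"] by (simp only:)
qed

text \<open>The zero section with one value over an isolated point replaced.\<close>

lemma section_through_pt:
  assumes v: "v \<in> carrier (fibre E (pt n))"
  shows "\<exists>\<xi>\<in>csections E. \<xi> (pt n) = v"
proof -
  define \<zeta> where "\<zeta> = (\<lambda>u\<in>units \<G>. \<zero>\<^bsub>fibre E u\<^esub>)"
  have z: "\<zeta> \<in> csections E" unfolding \<zeta>_def using rep.csections_zero by simp
  have "\<zeta>(pt n := v) \<in> csections E"
  proof (rule section_modify[OF _ z])
    show "\<zeta>(pt n := v) \<in> (\<Pi>\<^sub>E u\<in>units \<G>. carrier (fibre E u))"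
      using v section_value[OF z] section_extensional[OF z] by (auto simp: PiE_iff extensional_def)
    show "\<forall>\<^sub>F k in sequentially. (\<zeta>(pt n := v)) (pt k) = \<zeta> (pt k)"
      using eventually_gt_at_top[of n] by eventually_elim auto
  qed simp
  then show ?thesis by (intro bexI[of _ "\<zeta>(pt n := v)"]) auto
qed

text \<open>The axioms only make the section values dense at infinity. Sections
  \<open>\<eta> k\<close> whose values approach \<open>v\<close> are glued by a diagonal choice:
  over \<open>pt n\<close> the section \<open>\<eta> (\<kappa> n)\<close> is used, which stays near
  every earlier \<open>\<eta> j\<close>, so \<open>sectionI\<close> applies with
  \<open>\<eta> j\<close> as the comparison section.\<close>

lemma section_through_pinf:
  assumes v: "v \<in> carrier (fibre E pinf)"
  shows "\<exists>\<xi>\<in>csections E. \<xi> pinf = v"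
proof -
  interpret H: complex_hilbert_space "fibre E pinf" by (rule fibre_hilbert) simp
  have "\<exists>\<eta>\<in>csections E. hdist (fibre E pinf) v (\<eta> pinf) < 1 / real (Suc k)" for k
    using rep.csections_dense[of pinf] v unfolding dense_in_hilbert_def by fastforce
  then obtain \<eta> where \<eta>: "\<And>k. \<eta> k \<in> csections E"
    "\<And>k. hdist (fibre E pinf) v (\<eta> k pinf) < 1 / real (Suc k)" by metis
  \<comment> \<open>At infinity the distance of \<open>\<eta> k\<close> and \<open>\<eta> j\<close>
    is below the sum of their two errors, hence below twice the larger one, that of the smaller
    index \<open>j\<close>.\<close>
  define Q where "Q k n \<longleftrightarrow>
     (\<forall>j\<le>k. hdist (fibre E (pt n)) (\<eta> k (pt n)) (\<eta> j (pt n)) < 2 / real (Suc j))" for k n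
  have c: "\<eta> k pinf \<in> carrier (fibre E pinf)" for k using \<eta>(1) by (simp add: section_value)
  have "eventually (Q k) sequentially" for k
  proof -
    have "eventually (\<lambda>n. hdist (fibre E (pt n)) (\<eta> k (pt n)) (\<eta> j (pt n)) < 2 / real (Suc j)) sequentially"
      if "j \<le> k" for j
    proof -
      have "hdist (fibre E pinf) (\<eta> k pinf) (\<eta> j pinf)
          \<le> hdist (fibre E pinf) v (\<eta> k pinf) + hdist (fibre E pinf) v (\<eta> j pinf)"
        using H.hdist_triangle[OF c v c, of k j] H.hdist_sym[OF c v, of k] by simp
      also have "\<dots> < 1 / real (Suc k) + 1 / real (Suc j)"
        by (intro add_strict_mono \<eta>)
      also have "\<dots> \<le> 1 / real (Suc j) + 1 / real (Suc j)"
        using that by (intro add_right_mono frac_le) auto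
      finally have "hdist (fibre E pinf) (\<eta> k pinf) (\<eta> j pinf) < 2 / real (Suc j)" by simp
      then show ?thesis using section_dist_tendsto[OF \<eta>(1) \<eta>(1)] order_tendstoD(2) by blast
    qed
    then have "eventually (\<lambda>n. \<forall>j\<in>{..k}.
        hdist (fibre E (pt n)) (\<eta> k (pt n)) (\<eta> j (pt n)) < 2 / real (Suc j)) sequentially"
      by (intro eventually_ball_finite) auto
    then show ?thesis unfolding Q_def by (rule eventually_mono) simp
  qed
  then obtain \<kappa> where \<kappa>: "filterlim \<kappa> at_top sequentially" "eventually (\<lambda>n. Q (\<kappa> n) n) sequentially"
    using diagonal_index by blast
  define \<xi> where "\<xi> = (\<lambda>u\<in>units \<G>. case u of At n _ \<Rightarrow> \<eta> (\<kappa> n) u | AtInfty _ \<Rightarrow> v)"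
  have \<xi>pt: "\<xi> (pt n) = \<eta> (\<kappa> n) (pt n)" for n by (simp add: \<xi>_def)
  have \<xi>inf: "\<xi> pinf = v" by (simp add: \<xi>_def)
  have "\<xi> \<in> csections E"
  proof (rule sectionI)
    show "\<xi> \<in> (\<Pi>\<^sub>E u\<in>units \<G>. carrier (fibre E u))"
    proof (rule PiE_I)
      fix u assume "u \<in> units \<G>"
      then show "\<xi> u \<in> carrier (fibre E u)"
        by (cases rule: units_cases) (use \<xi>pt \<xi>inf \<eta>(1) v section_value in auto)
    qed (simp add: \<xi>_def)
    fix \<epsilon> :: real assume "\<epsilon> > 0"
    then obtain j where j: "1 / real (Suc j) < \<epsilon> / 2"
      using nat_approx_posE[of "\<epsilon> / 2"] by auto
    have "eventually (\<lambda>n. \<kappa> n \<ge> j) sequentially"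
      using \<kappa>(1) by (simp add: filterlim_at_top)
    with \<kappa>(2) have "eventually (\<lambda>n. hdist (fibre E (pt n)) (\<xi> (pt n)) (\<eta> j (pt n)) \<le> \<epsilon>) sequentially"
      by eventually_elim (use j in \<open>force simp: Q_def \<xi>pt\<close>)
    moreover have "hdist (fibre E pinf) (\<xi> pinf) (\<eta> j pinf) \<le> \<epsilon>"
      using \<eta>(2)[of j] j \<open>\<epsilon> > 0\<close> by (simp add: \<xi>inf)
    ultimately show "\<exists>\<eta>\<in>csections E. hdist (fibre E pinf) (\<xi> pinf) (\<eta> pinf) \<le> \<epsilon> \<and>
        (\<forall>\<^sub>F n in sequentially. hdist (fibre E (pt n)) (\<xi> (pt n)) (\<eta> (pt n)) \<le> \<epsilon>)"
      using \<eta>(1) by blast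
  qed
  then show ?thesis using \<xi>inf by blast
qed

lemma section_through:
  assumes "u \<in> units \<G>" "v \<in> carrier (fibre E u)"
  shows "\<exists>\<xi>\<in>csections E. \<xi> u = v"
  using assms by (cases rule: units_cases) (auto intro: section_through_pt section_through_pinf)

section \<open>The unitaries over a unit and their matrix coefficients\<close>

lemma unitary_arr:
  assumes g: "g \<in> carrier \<Gamma>" and u: "u \<in> units \<G>"
  shows "unitary_between (fibre E u) (fibre E u) (\<pi> (arr g u))"
  using rep.rep_unitary[OF arr_arrow[OF g u]] base_arr[OF u] by simp

lemma rep_arr_mult:
  assumes "g \<in> carrier \<Gamma>" "h \<in> carrier \<Gamma>" "u \<in> units \<G>" "v \<in> carrier (fibre E u)"
  shows "\<pi> (arr (g \<otimes>\<^bsub>\<Gamma>\<^esub> h) u) v = \<pi> (arr g u) (\<pi> (arr h u) v)"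
proof -
  have "\<pi> (gmult \<G> (arr g u) (arr h u)) v = \<pi> (arr g u) (\<pi> (arr h u) v)"
    by (rule rep.rep_mult) (use assms arr_arrow base_arr in \<open>simp_all only: gdom_eq grng_eq\<close>)
  then show ?thesis by (simp only: gmult_eq mult_arr[OF assms(1-3)])
qed

lemma rep_arr_closed:
  "g \<in> carrier \<Gamma> \<Longrightarrow> u \<in> units \<G> \<Longrightarrow> v \<in> carrier (fibre E u) \<Longrightarrow> \<pi> (arr g u) v \<in> carrier (fibre E u)"
  using unitary_arr[of g u] bij_betwE[of "\<pi> (arr g u)"] unfolding unitary_between_def by blast

lemma rep_arr_one:
  "u \<in> units \<G> \<Longrightarrow> v \<in> carrier (fibre E u) \<Longrightarrow> \<pi> (arr \<one>\<^bsub>\<Gamma>\<^esub> u) v = v"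
  using rep.rep_unit arr_one by simp

lemma rep_arr_hinner:
  "\<lbrakk>g \<in> carrier \<Gamma>; u \<in> units \<G>; v \<in> carrier (fibre E u); w \<in> carrier (fibre E u)\<rbrakk> \<Longrightarrow>
    hinner (fibre E u) (\<pi> (arr g u) v) (\<pi> (arr g u) w) = hinner (fibre E u) v w"
  using unitary_arr[of g u] unfolding unitary_between_def by simp

lemma rep_arr_smult:
  "\<lbrakk>g \<in> carrier \<Gamma>; u \<in> units \<G>; v \<in> carrier (fibre E u)\<rbrakk> \<Longrightarrow>
    \<pi> (arr g u) (a \<odot>\<^bsub>fibre E u\<^esub> v) = a \<odot>\<^bsub>fibre E u\<^esub> \<pi> (arr g u) v"
  using unitary_arr[of g u] unfolding unitary_between_def by simp

lemma rep_arr_hnorm: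
  "\<lbrakk>g \<in> carrier \<Gamma>; u \<in> units \<G>; v \<in> carrier (fibre E u)\<rbrakk> \<Longrightarrow>
    hnorm (fibre E u) (\<pi> (arr g u) v) = hnorm (fibre E u) v"
  by (simp add: hnorm_def rep_arr_hinner)

lemma rep_arr_adjoint_pair:
  assumes g: "g \<in> carrier \<Gamma>" and u: "u \<in> units \<G>"
  shows "adjoint_pair (fibre E u) (\<pi> (arr g u)) (\<pi> (arr (inv\<^bsub>\<Gamma>\<^esub> g) u))"
  unfolding adjoint_pair_def
proof (intro conjI ballI)
  show "\<pi> (arr g u) \<in> carrier (fibre E u) \<rightarrow> carrier (fibre E u)"
    "\<pi> (arr (inv\<^bsub>\<Gamma>\<^esub> g) u) \<in> carrier (fibre E u) \<rightarrow> carrier (fibre E u)"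
    using g u rep_arr_closed by auto
  fix x y assume x: "x \<in> carrier (fibre E u)" and y: "y \<in> carrier (fibre E u)"
  let ?z = "\<pi> (arr (inv\<^bsub>\<Gamma>\<^esub> g) u) y"
  have z: "?z \<in> carrier (fibre E u)" using g u y rep_arr_closed by simp
  have "\<pi> (arr g u) ?z = y"
    using rep_arr_mult[OF g inv_closed[OF g] u y] rep_arr_one[OF u y] g by simp
  then show "hinner (fibre E u) (\<pi> (arr g u) x) y = hinner (fibre E u) x ?z"
    using rep_arr_hinner[OF g u x z] by simp
qed

lemma coefficient_tendsto:
  assumes \<xi>: "\<xi> \<in> csections E" and \<eta>: "\<eta> \<in> csections E" and g: "g \<in> carrier \<Gamma>"
  shows "(\<lambda>n. hinner (fibre E (pt n)) (\<pi> (arr g (pt n)) (\<xi> (pt n))) (\<eta> (pt n)))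
    \<longlonglongrightarrow> hinner (fibre E pinf) (\<pi> (arr g pinf) (\<xi> pinf)) (\<eta> pinf)"
  using continuous_arr_tendsto[OF rep.rep_continuous g, of \<xi> \<eta>] \<xi> \<eta> base_arr
  by (simp add: C0_sections_eq)

text \<open>The bundle axioms speak of norms only; inner products are obtained without polarization,
  as the matrix coefficients of the identity.\<close>

lemma inner_tendsto:
  assumes \<xi>: "\<xi> \<in> csections E" and \<eta>: "\<eta> \<in> csections E"
  shows "(\<lambda>n. hinner (fibre E (pt n)) (\<xi> (pt n)) (\<eta> (pt n))) \<longlonglongrightarrow> hinner (fibre E pinf) (\<xi> pinf) (\<eta> pinf)"
proof -
  have "\<pi> (arr \<one>\<^bsub>\<Gamma>\<^esub> u) (\<xi> u) = \<xi> u" if "u \<in> units \<G>" for u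
    using rep_arr_one section_value[OF \<xi>] that by blast
  from this[OF pt_units] this[OF pinf_units] show ?thesis
    using coefficient_tendsto[OF \<xi> \<eta> one_closed] by simp
qed

lemma section_finite_rank:
  assumes I: "finite I" "\<And>i. i \<in> I \<Longrightarrow> a i \<in> csections E" "\<And>i. i \<in> I \<Longrightarrow> b i \<in> csections E"
    and \<xi>: "\<xi> \<in> csections E"
  shows "(\<lambda>u\<in>units \<G>. finite_rank (fibre E u) I (\<lambda>i. a i u) (\<lambda>i. b i u) (\<xi> u)) \<in> csections E"
proof -
  define f where "f i u = hinner (fibre E u) (\<xi> u) (b i u)" for i u
  have "(\<lambda>u\<in>units \<G>. finsum (fibre E u) (\<lambda>i. (\<lambda>u\<in>units \<G>. f i u \<odot>\<^bsub>fibre E u\<^esub> a i u) u) I) \<in> csections E"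
    using I \<xi> unfolding f_def by (intro section_finsum section_smult inner_tendsto) auto
  also have "(\<lambda>u\<in>units \<G>. finsum (fibre E u) (\<lambda>i. (\<lambda>u\<in>units \<G>. f i u \<odot>\<^bsub>fibre E u\<^esub> a i u) u) I)
     = (\<lambda>u\<in>units \<G>. finite_rank (fibre E u) I (\<lambda>i. a i u) (\<lambda>i. b i u) (\<xi> u))"
    by (rule restrict_ext) (simp add: finite_rank_def f_def)
  finally show ?thesis .
qed

end

section \<open>Matrix coefficients and almost invariant operators\<close>

context hls_representation
begin

text \<open>With Hilbert-Schmidt norm 1 in every fibre, the trace function is the constant 1, which
  lies in \<open>C0 X\<close> because the unit space is compact. Hence a family of operators that
  preserves sections, together with its adjoints, is already Hilbert-Schmidt.\<close>

lemma fibrewise_operator: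
  assumes R: "\<And>u. u \<in> units \<G> \<Longrightarrow> adjoint_pair (fibre E u) (R u) (R' u)"
    and sec: "\<And>\<xi>. \<xi> \<in> csections E \<Longrightarrow> (\<lambda>u\<in>units \<G>. R u (\<xi> u)) \<in> csections E"
      "\<And>\<xi>. \<xi> \<in> csections E \<Longrightarrow> (\<lambda>u\<in>units \<G>. R' u (\<xi> u)) \<in> csections E"
    and norm: "\<And>u. u \<in> units \<G> \<Longrightarrow>
      ((\<lambda>e. (hnorm (fibre E u) (R u e))\<^sup>2) has_sum 1) (chosen_basis (fibre E u))"
    and T: "T = (\<lambda>\<xi>. \<lambda>u\<in>units \<G>. R u (\<xi> u))"
  shows "hilbert_schmidt X E T"
    and "bundle_hs_norm X E T \<le> 1"
    and "\<And>u. u \<in> units \<G> \<Longrightarrow> hs_norm (fibre E u) (localization X E T u) = 1"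
    and "\<And>u v. u \<in> units \<G> \<Longrightarrow> v \<in> carrier (fibre E u) \<Longrightarrow> localization X E T u v = R u v"
proof -
  have T_eq: "T \<xi> u = R u (\<xi> u)" if "u \<in> units \<G>" for \<xi> u using that by (simp add: T)
  have adj: "adjointable X E T"
    unfolding adjointable_def C0_sections_eq topspace_X
  proof (intro conjI bexI[of _ "\<lambda>\<xi>. \<lambda>u\<in>units \<G>. R' u (\<xi> u)"] ballI)
    fix \<xi> \<eta> u assume *: "\<xi> \<in> csections E" "\<eta> \<in> csections E" "u \<in> units \<G>"
    then show "hinner (fibre E u) (T \<xi> u) (\<eta> u)
        = hinner (fibre E u) (\<xi> u) ((\<lambda>u\<in>units \<G>. R' u (\<eta> u)) u)"
      using complex_hilbert_space.adjoint_pair_hinner[OF fibre_hilbert R, of u "\<xi> u" "\<eta> u"]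
        section_value T_eq by simp
  qed (use sec in \<open>simp_all only: T Pi_iff\<close>, blast+)
  have loc: "localization X E T u v = R u v" if u: "u \<in> units \<G>" and v: "v \<in> carrier (fibre E u)" for u v
  proof -
    obtain \<xi> where \<xi>: "\<xi> \<in> csections E" "\<xi> u = v" using section_through[OF u v] by blast
    have "localization X E T u (\<xi> u) = T \<xi> u"
      by (rule localization_adjoint_pair(1)[OF fibre_hilbert[OF u] _ _ _ adj])
        (use u \<xi> section_through section_value in \<open>auto simp: C0_sections_eq\<close>)
    then show ?thesis using \<xi> T_eq u by simp
  qed
  show "localization X E T u v = R u v" if "u \<in> units \<G>" "v \<in> carrier (fibre E u)" for u v
    by (rule loc[OF that])
  have pair: "adjoint_pair (fibre E u) (localization X E T u) (R' u)" if u: "u \<in> units \<G>" for u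
    using R[OF u] loc[OF u] by (auto simp: adjoint_pair_def Pi_iff)
  have norm': "((\<lambda>e. (hnorm (fibre E u) (localization X E T u e))\<^sup>2) has_sum 1) (chosen_basis (fibre E u))"
    if u: "u \<in> units \<G>" for u
    using norm[OF u] loc[OF u] complex_hilbert_space.chosen_basis_carrier[OF fibre_hilbert[OF u]]
    by (simp cong: has_sum_cong)
  have tr: "htrace (fibre E u) (abs_square (fibre E u) (localization X E T u)) = 1" if u: "u \<in> units \<G>" for u
    using complex_hilbert_space.htrace_abs_square[OF fibre_hilbert pair norm'] u by simp
  show hn: "hs_norm (fibre E u) (localization X E T u) = 1" if u: "u \<in> units \<G>" for u
    using tr[OF u] by (simp add: hs_norm_def)
  have "continuous_map X euclidean (\<lambda>_. 1 :: complex)" by simp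
  then have "continuous_map X euclidean
      (\<lambda>u. htrace (fibre E u) (abs_square (fibre E u) (localization X E T u)))"
    by (rule continuous_map_eq) (simp add: tr)
  then have "(\<lambda>u. htrace (fibre E u) (abs_square (fibre E u) (localization X E T u))) \<in> C0 X"
    unfolding C0_def using compact_X by auto
  moreover have "finite_htrace (fibre E u) (abs_square (fibre E u) (localization X E T u))"
    if u: "u \<in> units \<G>" for u
    using complex_hilbert_space.finite_htrace_iff[OF fibre_hilbert pair] norm'[OF u] u
    by (auto simp: summable_on_def)
  ultimately show "hilbert_schmidt X E T"
    unfolding hilbert_schmidt_def using adj by simp
  show "bundle_hs_norm X E T \<le> 1"
    unfolding bundle_hs_norm_def topspace_X
    by (rule cSUP_least) (use hn in \<open>auto simp: units_eq\<close>)
qed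

text \<open>The Hilbert-Schmidt inner product of the translate by \<open>g\<close> of a finite rank
  operator with that operator itself, as \<open>coeff_has_sum\<close> shows; at the identity it is
  the squared norm.\<close>

definition coeff :: "'i set \<Rightarrow> ('i \<Rightarrow> 'v) \<Rightarrow> ('i \<Rightarrow> 'v) \<Rightarrow> 'a hls \<Rightarrow> 'a \<Rightarrow> complex" where
  "coeff J a b u g = (\<Sum>i\<in>J. \<Sum>j\<in>J. hinner (fibre E u) (\<pi> (arr g u) (a i)) (a j) *
     hinner (fibre E u) (b j) (\<pi> (arr g u) (b i)))"

lemma coeff_has_sum:
  assumes J: "finite J" "a \<in> J \<rightarrow> carrier (fibre E u)" "b \<in> J \<rightarrow> carrier (fibre E u)"
    and u: "u \<in> units \<G>" and g: "g \<in> carrier \<Gamma>" and B: "orthonormal_basis (fibre E u) B"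
  shows "((\<lambda>e. hinner (fibre E u)
      (\<pi> (arr g u) (finite_rank (fibre E u) J a b (\<pi> (arr (inv\<^bsub>\<Gamma>\<^esub> g) u) e)))
      (finite_rank (fibre E u) J a b e)) has_sum coeff J a b u g) B"
proof -
  interpret H: complex_hilbert_space "fibre E u" by (rule fibre_hilbert[OF u])
  have U: "(\<lambda>i. \<pi> (arr g u) (a i)) \<in> J \<rightarrow> carrier (fibre E u)"
    "(\<lambda>i. \<pi> (arr g u) (b i)) \<in> J \<rightarrow> carrier (fibre E u)"
    using J rep_arr_closed[OF g u] by (auto simp: Pi_iff)
  have "((\<lambda>e. hinner (fibre E u)
      (finite_rank (fibre E u) J (\<lambda>i. \<pi> (arr g u) (a i)) (\<lambda>i. \<pi> (arr g u) (b i)) e)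
      (finite_rank (fibre E u) J a b e)) has_sum coeff J a b u g) B"
    unfolding coeff_def by (rule H.finite_rank_has_sum[OF B J(1) U J])
  also have "?this \<longleftrightarrow> ?thesis"
    by (rule has_sum_cong)
      (simp only: H.conj_finite_rank[OF rep_arr_adjoint_pair[OF g u] J H.basis_carrier[OF B]])
  finally show ?thesis .
qed

lemma coeff_one:
  assumes J: "a \<in> J \<rightarrow> carrier (fibre E u)" "b \<in> J \<rightarrow> carrier (fibre E u)" and u: "u \<in> units \<G>"
  shows "coeff J a b u \<one>\<^bsub>\<Gamma>\<^esub> =
    (\<Sum>i\<in>J. \<Sum>j\<in>J. hinner (fibre E u) (a i) (a j) * hinner (fibre E u) (b j) (b i))"
  unfolding coeff_def by (intro sum.cong refl) (use J rep_arr_one[OF u] in \<open>auto simp: Pi_iff\<close>)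

lemma coeff_one_has_sum:
  assumes J: "finite J" "a \<in> J \<rightarrow> carrier (fibre E u)" "b \<in> J \<rightarrow> carrier (fibre E u)"
    and u: "u \<in> units \<G>" and one: "coeff J a b u \<one>\<^bsub>\<Gamma>\<^esub> = 1" and B: "orthonormal_basis (fibre E u) B"
  shows "((\<lambda>e. (hnorm (fibre E u) (finite_rank (fibre E u) J a b e))\<^sup>2) has_sum 1) B"
proof -
  interpret H: complex_hilbert_space "fibre E u" by (rule fibre_hilbert[OF u])
  have "((\<lambda>e. hinner (fibre E u) (finite_rank (fibre E u) J a b e)
      (finite_rank (fibre E u) J a b e)) has_sum 1) B"
    using H.finite_rank_has_sum[OF B J J] one coeff_one[OF J(2,3) u] by simp
  from has_sum_Re[OF this] show ?thesis
    using J by (simp add: H.hnorm_sq)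
qed

text \<open>Scaling the family \<open>a\<close> alone scales the operator by \<open>c\<close>. It is
  applied with \<open>c\<close> the inverse square root of the squared norm.\<close>

lemma coeff_smult:
  assumes J: "a \<in> J \<rightarrow> carrier (fibre E u)" and u: "u \<in> units \<G>" and g: "g \<in> carrier \<Gamma>"
  shows "coeff J (\<lambda>i. of_real c \<odot>\<^bsub>fibre E u\<^esub> a i) b u g = of_real (c\<^sup>2) * coeff J a b u g"
proof -
  interpret H: complex_hilbert_space "fibre E u" by (rule fibre_hilbert[OF u])
  show ?thesis
    unfolding coeff_def sum_distrib_left
  proof (intro sum.cong refl)
    fix i j assume "i \<in> J" "j \<in> J"
    then have "a i \<in> carrier (fibre E u)" "a j \<in> carrier (fibre E u)" using J by auto
    then show "hinner (fibre E u) (\<pi> (arr g u) (of_real c \<odot>\<^bsub>fibre E u\<^esub> a i)) (of_real c \<odot>\<^bsub>fibre E u\<^esub> a j) *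
        hinner (fibre E u) (b j) (\<pi> (arr g u) (b i)) =
      of_real (c\<^sup>2) * (hinner (fibre E u) (\<pi> (arr g u) (a i)) (a j) *
        hinner (fibre E u) (b j) (\<pi> (arr g u) (b i)))"
      using rep_arr_smult[OF g u] rep_arr_closed[OF g u]
      by (simp add: H.hinner_smult_left H.hinner_smult_right power2_eq_square)
  qed
qed

text \<open>The second factor has the translated vector on the right, so it is the conjugate of a
  matrix coefficient of sections.\<close>

lemma coeff_tendsto:
  assumes "finite J" "\<And>i. i \<in> J \<Longrightarrow> a i \<in> csections E" "\<And>i. i \<in> J \<Longrightarrow> b i \<in> csections E"
    and g: "g \<in> carrier \<Gamma>"
  shows "(\<lambda>n. coeff J (\<lambda>i. a i (pt n)) (\<lambda>i. b i (pt n)) (pt n) g)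
    \<longlonglongrightarrow> coeff J (\<lambda>i. a i pinf) (\<lambda>i. b i pinf) pinf g"
proof -
  have cnj_eq: "hinner (fibre E u) (b j u) (\<pi> (arr g u) (b i u))
      = cnj (hinner (fibre E u) (\<pi> (arr g u) (b i u)) (b j u))" if "i \<in> J" "j \<in> J" "u \<in> units \<G>" for i j u
    using that assms by (intro complex_hilbert_space.hinner_commute[OF fibre_hilbert])
      (auto intro: section_value rep_arr_closed)
  have "(\<lambda>n. hinner (fibre E (pt n)) (b j (pt n)) (\<pi> (arr g (pt n)) (b i (pt n))))
      \<longlonglongrightarrow> hinner (fibre E pinf) (b j pinf) (\<pi> (arr g pinf) (b i pinf))" if "i \<in> J" "j \<in> J" for i j
    unfolding cnj_eq[OF that pt_units] cnj_eq[OF that pinf_units]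
    by (intro tendsto_cnj coefficient_tendsto assms that)
  then show ?thesis unfolding coeff_def
    by (intro tendsto_sum tendsto_mult coefficient_tendsto assms) auto
qed

text \<open>The sum of all translates of a rank-one projection is invariant, and it is nonzero because
  its diagonal terms are positive.\<close>

lemma invariant_operator:
  obtains J :: "'a set set" and a b where "finite J" "a \<in> J \<rightarrow> carrier (fibre E (pt n))"
    "b \<in> J \<rightarrow> carrier (fibre E (pt n))" "\<And>g. g \<in> carrier \<Gamma> \<Longrightarrow> coeff J a b (pt n) g = 1"
proof -
  interpret H: complex_hilbert_space "fibre E (pt n)" by (rule fibre_hilbert) simp
  interpret Q: group "\<Gamma> Mod K n" by (rule group_quotient)
  let ?H = "fibre E (pt n)" and ?Q = "\<Gamma> Mod K n"
  obtain v where v: "v \<in> carrier ?H" "v \<noteq> \<zero>\<^bsub>?H\<^esub>"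
    using rep.fibre_nonzero[OF pt_units[of n]] H.zero_closed by blast
  \<comment> \<open>The orbit of \<open>v\<close> is indexed by the quotient group, so that vectors
    fixed by part of the group are counted with multiplicity and translation permutes the
    indices.\<close>
  define w where "w c = \<pi> (At n c) v" for c
  have Qarr: "\<exists>h\<in>carrier \<Gamma>. At n c = arr h (pt n)" if "c \<in> carrier ?Q" for c
    using that by (auto simp: carrier_quotient)
  have w: "w \<in> carrier ?Q \<rightarrow> carrier ?H"
    using Qarr rep_arr_closed[OF _ pt_units v(1)] by (fastforce simp: w_def)
  have Uw: "\<pi> (arr g (pt n)) (w c) = w ((K n #>\<^bsub>\<Gamma>\<^esub> g) \<otimes>\<^bsub>?Q\<^esub> c)"
    if g: "g \<in> carrier \<Gamma>" and c: "c \<in> carrier ?Q" for g c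
  proof -
    obtain h where h: "h \<in> carrier \<Gamma>" "At n c = arr h (pt n)" using Qarr[OF c] by blast
    have "hls_mult \<Gamma> K (arr g (pt n)) (arr h (pt n)) = At n ((K n #>\<^bsub>\<Gamma>\<^esub> g) \<otimes>\<^bsub>?Q\<^esub> c)"
      using h by simp
    then have "w ((K n #>\<^bsub>\<Gamma>\<^esub> g) \<otimes>\<^bsub>?Q\<^esub> c) = \<pi> (arr (g \<otimes>\<^bsub>\<Gamma>\<^esub> h) (pt n)) v"
      using mult_arr[OF g h(1) pt_units] by (simp only: w_def)
    also have "\<dots> = \<pi> (arr g (pt n)) (w c)"
      unfolding w_def h(2) by (rule rep_arr_mult[OF g h(1) pt_units v(1)])
    finally show ?thesis by simp
  qed
  define S where "S = (\<Sum>c\<in>carrier ?Q. \<Sum>c'\<in>carrier ?Q. (cmod (hinner ?H (w c) (w c')))\<^sup>2)"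
  have trm: "hinner ?H (w c) (w c') * hinner ?H (w c') (w c) = of_real ((cmod (hinner ?H (w c) (w c')))\<^sup>2)"
    if "c \<in> carrier ?Q" "c' \<in> carrier ?Q" for c c'
  proof -
    have "w c \<in> carrier ?H" "w c' \<in> carrier ?H" using w that by auto
    then show ?thesis
      using H.hinner_commute[of "w c'" "w c"] by (simp only: complex_norm_square)
  qed
  have coeffS: "coeff (carrier ?Q) w w (pt n) g = of_real S" if g: "g \<in> carrier \<Gamma>" for g
  proof -
    let ?k = "K n #>\<^bsub>\<Gamma>\<^esub> g"
    have k: "?k \<in> carrier ?Q" using g by (auto simp: carrier_quotient)
    \<comment> \<open>The group element acts only on the outer index of the double sum, where left
      multiplication by its coset is a bijection.\<close>
    have bij: "bij_betw (\<lambda>c. ?k \<otimes>\<^bsub>?Q\<^esub> c) (carrier ?Q) (carrier ?Q)"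
      unfolding bij_betw_def using Q.inj_on_cmult[OF k] Q.surj_const_mult[OF k] by blast
    have "coeff (carrier ?Q) w w (pt n) g
        = (\<Sum>c\<in>carrier ?Q. \<Sum>c'\<in>carrier ?Q. hinner ?H (w (?k \<otimes>\<^bsub>?Q\<^esub> c)) (w c') * hinner ?H (w c') (w (?k \<otimes>\<^bsub>?Q\<^esub> c)))"
      unfolding coeff_def by (intro sum.cong refl) (simp only: Uw[OF g])
    also have "\<dots> = (\<Sum>c\<in>carrier ?Q. \<Sum>c'\<in>carrier ?Q. hinner ?H (w c) (w c') * hinner ?H (w c') (w c))"
      by (rule sum.reindex_bij_betw[OF bij])
    also have "\<dots> = of_real S"
      unfolding S_def of_real_sum by (intro sum.cong refl) (rule trm)
    finally show ?thesis .
  qed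
  have S: "S > 0"
  proof -
    let ?o = "\<one>\<^bsub>?Q\<^esub>"
    have "w ?o = v" using rep_arr_one[OF pt_units v(1)] by (simp add: w_def)
    then have "hinner ?H (w ?o) (w ?o) \<noteq> 0" using v H.hinner_eq_zero by auto
    then have "0 < (cmod (hinner ?H (w ?o) (w ?o)))\<^sup>2" by simp
    also have "\<dots> \<le> (\<Sum>c'\<in>carrier ?Q. (cmod (hinner ?H (w ?o) (w c')))\<^sup>2)"
      by (rule member_le_sum) (use finite_quotient Q.one_closed in auto)
    also have "\<dots> \<le> S"
      unfolding S_def
      by (rule member_le_sum[where f = "\<lambda>c. \<Sum>c'\<in>carrier ?Q. (cmod (hinner ?H (w c) (w c')))\<^sup>2"])
        (use finite_quotient Q.one_closed in \<open>auto intro: sum_nonneg\<close>)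
    finally show ?thesis .
  qed
  define a where "a c = complex_of_real (1 / sqrt S) \<odot>\<^bsub>?H\<^esub> w c" for c
  have a: "a \<in> carrier ?Q \<rightarrow> carrier ?H" using w by (auto simp: a_def Pi_iff)
  show ?thesis
  proof (rule that[OF finite_quotient a w])
    fix g assume g: "g \<in> carrier \<Gamma>"
    show "coeff (carrier ?Q) a w (pt n) g = 1"
      using coeff_smult[OF w pt_units g, of "1 / sqrt S" w] coeffS[OF g] S
      unfolding a_def by (simp add: power_divide flip: of_real_mult of_real_power of_real_divide)
  qed
qed

section \<open>The group as a groupoid over one point\<close>

abbreviation "\<H> \<equiv> group_groupoid \<Gamma>"
abbreviation "Y \<equiv> unit_space \<H>"
abbreviation "Einf \<equiv> bundle_at_infinity \<Gamma> E"

lemma units_group [simp]: "units \<H> = {\<one>\<^bsub>\<Gamma>\<^esub>}"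
  using one_closed by (auto simp: units_def group_groupoid_def)

lemma topspace_Y [simp]: "topspace Y = {\<one>\<^bsub>\<Gamma>\<^esub>}"
  using one_closed by (auto simp: unit_space_def group_groupoid_def units_def)

lemma fibre_infinity [simp]: "fibre Einf u = fibre E pinf"
  by (simp add: bundle_at_infinity_def)

lemma compactin_Y: "compactin Y {\<one>\<^bsub>\<Gamma>\<^esub>}"
  by (simp add: compactin_sing)

lemma C0_sections_Y: "C0_sections Y Einf = (\<Pi>\<^sub>E u\<in>{\<one>\<^bsub>\<Gamma>\<^esub>}. carrier (fibre E pinf))"
proof -
  have "C0_sections Y Einf = csections Einf"
    unfolding C0_sections_def using compactin_Y
    by (auto intro!: exI[of _ "{\<one>\<^bsub>\<Gamma>\<^esub>}"] simp del: compactin_sing)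
  then show ?thesis by (simp add: bundle_at_infinity_def)
qed

lemma C0_Y: "f \<in> C0 Y"
proof -
  have "carrier \<Gamma> \<inter> {\<one>\<^bsub>\<Gamma>\<^esub>} = {\<one>\<^bsub>\<Gamma>\<^esub>}" using one_closed by blast
  then have "Y = discrete_topology {\<one>\<^bsub>\<Gamma>\<^esub>}"
    unfolding unit_space_def units_group by (simp add: group_groupoid_def)
  then have "continuous_map Y euclidean f" by simp
  then show ?thesis unfolding C0_def using compactin_Y
    by (auto intro!: exI[of _ "{\<one>\<^bsub>\<Gamma>\<^esub>}"] simp del: compactin_sing)
qed

lemma bundle_hs_norm_Y:
  "bundle_hs_norm Y Einf T = hs_norm (fibre E pinf) (localization Y Einf T \<one>\<^bsub>\<Gamma>\<^esub>)"
  by (simp add: bundle_hs_norm_def)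

lemma translate_infinity:
  "translate \<H> (rep_at_infinity \<pi>) g S = \<pi> (arr g pinf) \<circ> S \<circ> \<pi> (arr (inv\<^bsub>\<Gamma>\<^esub> g) pinf)"
  by (simp add: translate_def rep_at_infinity_def group_groupoid_def)

lemma translate_arr:
  assumes "g \<in> carrier \<Gamma>" "u \<in> units \<G>"
  shows "translate \<G> \<pi> (arr g u) S = \<pi> (arr g u) \<circ> S \<circ> \<pi> (arr (inv\<^bsub>\<Gamma>\<^esub> g) u)"
  using inv_arr[OF assms] by (simp only: translate_def ginv_eq)

lemma hs_inner_translate:
  assumes g: "g \<in> carrier \<Gamma>" and u: "u \<in> units \<G>" and S: "adjoint_pair (fibre E u) S S'"
  shows "hs_inner (fibre E u) (\<pi> (arr g u) \<circ> S \<circ> \<pi> (arr (inv\<^bsub>\<Gamma>\<^esub> g) u)) S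
    = (\<Sum>\<^sub>\<infinity>e\<in>chosen_basis (fibre E u).
        hinner (fibre E u) (\<pi> (arr g u) (S (\<pi> (arr (inv\<^bsub>\<Gamma>\<^esub> g) u) e))) (S e))"
proof -
  interpret H: complex_hilbert_space "fibre E u" by (rule fibre_hilbert[OF u])
  have "\<pi> (arr g u) \<circ> S \<circ> \<pi> (arr (inv\<^bsub>\<Gamma>\<^esub> g) u) \<in> carrier (fibre E u) \<rightarrow> carrier (fibre E u)"
    using S rep_arr_closed[OF g u] rep_arr_closed[OF inv_closed[OF g] u]
    by (auto simp: adjoint_pair_def Pi_iff)
  from H.hs_inner_eq[OF S this] show ?thesis by simp
qed

text \<open>One member of the net is singled out. A lower bound for its norm can be recovered by
  letting \<open>A\<close> contain the identity.\<close>

lemma almost_invariant_at_infinity: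
  assumes am: "amenable_rep \<H> Einf (rep_at_infinity \<pi>)"
    and A: "finite A" "A \<subseteq> carrier \<Gamma>" and eps: "\<epsilon> > 0"
  obtains S S' s where "adjoint_pair (fibre E pinf) S S'"
    "((\<lambda>e. (hnorm (fibre E pinf) (S e))\<^sup>2) has_sum s) (chosen_basis (fibre E pinf))" "s \<le> 1"
    "\<And>g. g \<in> A \<Longrightarrow> cmod ((\<Sum>\<^sub>\<infinity>e\<in>chosen_basis (fibre E pinf). hinner (fibre E pinf)
       (\<pi> (arr g pinf) (S (\<pi> (arr (inv\<^bsub>\<Gamma>\<^esub> g) pinf) e))) (S e)) - 1) < \<epsilon>"
proof -
  let ?H = "fibre E pinf"
  interpret H: complex_hilbert_space ?H by (rule fibre_hilbert) simp
  let ?loc = "\<lambda>T. localization Y Einf T \<one>\<^bsub>\<Gamma>\<^esub>"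
  obtain F where F: "F \<noteq> bot"
    and hs: "\<forall>\<^sub>F T in F. hilbert_schmidt Y Einf T \<and> bundle_hs_norm Y Einf T \<le> 1"
    and lim: "\<And>C. compactin (gtop \<H>) C \<Longrightarrow> uniform_limit C
             (\<lambda>T x. hs_inner (fibre Einf (grng \<H> x))
                (translate \<H> (rep_at_infinity \<pi>) x (localization Y Einf T (gdom \<H> x)))
                (localization Y Einf T (grng \<H> x))) (\<lambda>_. 1) F"
    using am unfolding amenable_rep_def Let_def by blast
  have dom: "gdom \<H> x = \<one>\<^bsub>\<Gamma>\<^esub>" "grng \<H> x = \<one>\<^bsub>\<Gamma>\<^esub>" for x by (simp_all add: group_groupoid_def)
  have "compactin (gtop \<H>) A"
    using A by (simp add: group_groupoid_def compactin_discrete_topology)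
  from lim[OF this] have "uniform_limit A (\<lambda>T x. hs_inner ?H
      (\<pi> (arr x pinf) \<circ> ?loc T \<circ> \<pi> (arr (inv\<^bsub>\<Gamma>\<^esub> x) pinf)) (?loc T)) (\<lambda>_. 1) F"
    by (simp only: dom fibre_infinity translate_infinity)
  then have "\<forall>\<^sub>F T in F. \<forall>g\<in>A. dist (hs_inner ?H
      (\<pi> (arr g pinf) \<circ> ?loc T \<circ> \<pi> (arr (inv\<^bsub>\<Gamma>\<^esub> g) pinf)) (?loc T)) 1 < \<epsilon>"
    using eps by (simp only: uniform_limit_iff)
  with hs have "\<forall>\<^sub>F T in F. hilbert_schmidt Y Einf T \<and> bundle_hs_norm Y Einf T \<le> 1 \<and>
      (\<forall>g\<in>A. dist (hs_inner ?H
      (\<pi> (arr g pinf) \<circ> ?loc T \<circ> \<pi> (arr (inv\<^bsub>\<Gamma>\<^esub> g) pinf)) (?loc T)) 1 < \<epsilon>)"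
    by eventually_elim blast
  then obtain T where T: "hilbert_schmidt Y Einf T" "bundle_hs_norm Y Einf T \<le> 1"
    "\<And>g. g \<in> A \<Longrightarrow> dist (hs_inner ?H
      (\<pi> (arr g pinf) \<circ> ?loc T \<circ> \<pi> (arr (inv\<^bsub>\<Gamma>\<^esub> g) pinf)) (?loc T)) 1 < \<epsilon>"
    using eventually_happens'[OF F] by blast
  have "\<exists>S'. adjoint_pair (fibre Einf \<one>\<^bsub>\<Gamma>\<^esub>) (?loc T) S'"
  proof (rule localization_adjoint_pair(2))
    show "\<exists>\<xi>\<in>C0_sections Y Einf. \<xi> \<one>\<^bsub>\<Gamma>\<^esub> = v" if "v \<in> carrier (fibre Einf \<one>\<^bsub>\<Gamma>\<^esub>)" for v
      using that unfolding C0_sections_Y by (intro bexI[of _ "\<lambda>u\<in>{\<one>\<^bsub>\<Gamma>\<^esub>}. v"]) auto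
  qed (use T(1) H.complex_hilbert_space_axioms in \<open>auto simp: C0_sections_Y hilbert_schmidt_def\<close>)
  then obtain S' where S: "adjoint_pair ?H (?loc T) S'" by auto
  have "finite_htrace ?H (abs_square ?H (?loc T))"
    using T(1) by (simp add: hilbert_schmidt_def)
  then obtain s where s: "((\<lambda>e. (hnorm ?H (?loc T e))\<^sup>2) has_sum s) (chosen_basis ?H)"
    unfolding H.finite_htrace_iff[OF S] summable_on_def by blast
  have "s \<le> 1"
    using T(2) H.hs_norm_eq[OF S s] by (simp add: bundle_hs_norm_Y)
  then show ?thesis
  proof (rule that[OF S s])
    fix g assume g: "g \<in> A"
    then have "g \<in> carrier \<Gamma>" using A by blast
    from hs_inner_translate[OF this pinf_units S] T(3)[OF g]
    show "cmod ((\<Sum>\<^sub>\<infinity>e\<in>chosen_basis ?H. hinner ?H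
       (\<pi> (arr g pinf) (?loc T (\<pi> (arr (inv\<^bsub>\<Gamma>\<^esub> g) pinf) e))) (?loc T e)) - 1) < \<epsilon>"
      by (simp only: dist_norm)
  qed
qed

end

section \<open>Transfer between the groupoid and its fibre at infinity\<close>

context hls_representation
begin

text \<open>The extension of the truncated operator is rescaled by a scalar function of the unit,
  not by a constant, so that its norm is exactly 1 at infinity and at all large \<open>n\<close>.
  Convergence of the coefficients keeps that function positive near infinity.\<close>

lemma lift_almost_invariant:
  assumes am: "amenable_rep \<H> Einf (rep_at_infinity \<pi>)"
    and A: "finite A" "A \<subseteq> carrier \<Gamma>" and eps: "\<epsilon> > 0"
  obtains J :: "'v set" and a b where "finite J"
    "\<And>i. i \<in> J \<Longrightarrow> a i \<in> csections E" "\<And>i. i \<in> J \<Longrightarrow> b i \<in> csections E"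
    "coeff J (\<lambda>i. a i pinf) (\<lambda>i. b i pinf) pinf \<one>\<^bsub>\<Gamma>\<^esub> = 1"
    "\<And>g. g \<in> A \<Longrightarrow> cmod (coeff J (\<lambda>i. a i pinf) (\<lambda>i. b i pinf) pinf g - 1) < \<epsilon>"
    "\<forall>\<^sub>F n in sequentially. coeff J (\<lambda>i. a i (pt n)) (\<lambda>i. b i (pt n)) (pt n) \<one>\<^bsub>\<Gamma>\<^esub> = 1 \<and>
       (\<forall>g\<in>A. cmod (coeff J (\<lambda>i. a i (pt n)) (\<lambda>i. b i (pt n)) (pt n) g - 1) < \<epsilon>)"
proof -
  let ?H = "fibre E pinf" and ?one = "\<one>\<^bsub>\<Gamma>\<^esub>"
  let ?B = "chosen_basis ?H"
  interpret H: complex_hilbert_space ?H by (rule fibre_hilbert) simp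
  \<comment> \<open>Coefficients of the truncation will lie within \<delta> of 1, one half lost in
    the choice of \<open>S\<close> and one half, \<open>2 * (\<delta> / 4)\<close>, in truncating.
    Two of them differ by less than 2\<delta>, and dividing by a squared norm above 1/2 gives
    4\<delta>; the cap 1/2 ensures that lower bound.\<close>
  define \<delta> where "\<delta> = min (1/2) (\<epsilon> / 4)"
  have \<delta>: "\<delta> > 0" "\<delta> \<le> 1/2" "4 * \<delta> \<le> \<epsilon>" using eps by (auto simp: \<delta>_def)
  have A1: "finite (insert ?one A)" "insert ?one A \<subseteq> carrier \<Gamma>" using A by auto
  obtain S S' s where S: "adjoint_pair ?H S S'"
    and s: "((\<lambda>e. (hnorm ?H (S e))\<^sup>2) has_sum s) ?B" "s \<le> 1"
    and inv: "\<And>g. g \<in> insert ?one A \<Longrightarrow> cmod ((\<Sum>\<^sub>\<infinity>e\<in>?B. hinner ?H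
       (\<pi> (arr g pinf) (S (\<pi> (arr (inv\<^bsub>\<Gamma>\<^esub> g) pinf) e))) (S e)) - 1) < \<delta> / 2"
    using almost_invariant_at_infinity[OF am A1, of "\<delta> / 2"] \<delta>(1) by auto
  have "\<delta> / 4 > 0" using \<delta> by simp
  from H.finite_rank_approx[OF H.chosen_basis S s this] obtain J where J: "finite J" "J \<subseteq> ?B"
    and close: "\<And>U V. adjoint_pair ?H U V \<Longrightarrow> (\<And>x. x \<in> carrier ?H \<Longrightarrow> hnorm ?H (U x) = hnorm ?H x) \<Longrightarrow>
       cmod ((\<Sum>\<^sub>\<infinity>e\<in>?B. hinner ?H (U (S (V e))) (S e)) -
         (\<Sum>\<^sub>\<infinity>e\<in>?B. hinner ?H (U (finite_rank ?H J S (\<lambda>f. f) (V e))) (finite_rank ?H J S (\<lambda>f. f) e)))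
       \<le> 2 * (\<delta> / 4)" by blast
  have JC: "J \<subseteq> carrier ?H" using J H.chosen_basis_carrier by blast
  have SJ: "S \<in> J \<rightarrow> carrier ?H" "(\<lambda>f. f) \<in> J \<rightarrow> carrier ?H"
    using JC H.adjoint_pair_closed[OF S] by auto
  have c0: "cmod (coeff J S (\<lambda>f. f) pinf g - 1) < \<delta>" if g: "g \<in> insert ?one A" for g
  proof -
    have gC: "g \<in> carrier \<Gamma>" using g A1 by blast
    let ?c = "coeff J S (\<lambda>f. f) pinf g"
    let ?s = "\<Sum>\<^sub>\<infinity>e\<in>?B. hinner ?H (\<pi> (arr g pinf) (S (\<pi> (arr (inv\<^bsub>\<Gamma>\<^esub> g) pinf) e))) (S e)"
    have "cmod (?s - ?c) \<le> 2 * (\<delta> / 4)"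
      using close[OF rep_arr_adjoint_pair[OF gC pinf_units]] rep_arr_hnorm[OF gC pinf_units]
        infsumI[OF coeff_has_sum[OF J(1) SJ pinf_units gC H.chosen_basis]] by simp
    moreover have "cmod (?c - 1) \<le> cmod (?c - ?s) + cmod (?s - 1)"
      using norm_triangle_ineq[of "?c - ?s" "?s - 1"] by simp
    ultimately show ?thesis using inv[OF g] norm_minus_commute[of ?c ?s] by linarith
  qed
  have "\<exists>a. \<forall>i\<in>J. a i \<in> csections E \<and> a i pinf = S i"
    by (rule bchoice) (use section_through_pinf SJ in blast)
  then obtain a where a: "\<And>i. i \<in> J \<Longrightarrow> a i \<in> csections E" "\<And>i. i \<in> J \<Longrightarrow> a i pinf = S i" by blast
  have "\<exists>b. \<forall>i\<in>J. b i \<in> csections E \<and> b i pinf = i"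
    by (rule bchoice) (use section_through_pinf JC in blast)
  then obtain b where b: "\<And>i. i \<in> J \<Longrightarrow> b i \<in> csections E" "\<And>i. i \<in> J \<Longrightarrow> b i pinf = i" by blast
  define M where "M u g = coeff J (\<lambda>i. a i u) (\<lambda>i. b i u) u g" for u g
  have M_inf: "M pinf g = coeff J S (\<lambda>f. f) pinf g" for g
    unfolding M_def coeff_def by (intro sum.cong refl) (simp add: a b)
  have M_lim: "(\<lambda>n. M (pt n) g) \<longlonglongrightarrow> M pinf g" if "g \<in> carrier \<Gamma>" for g
    unfolding M_def by (intro coeff_tendsto J a b that)
  have aC: "(\<lambda>i. a i u) \<in> J \<rightarrow> carrier (fibre E u)" "(\<lambda>i. b i u) \<in> J \<rightarrow> carrier (fibre E u)"
    if "u \<in> units \<G>" for u using a b that section_value by auto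
  \<comment> \<open>Exchanging \<open>i\<close> and \<open>j\<close> conjugates each term. The value
    being real, dividing by its real part \<open>N u\<close> gives exactly 1.\<close>
  have M_real: "M u ?one = of_real (Re (M u ?one))" if u: "u \<in> units \<G>" for u
  proof -
    interpret Hu: complex_hilbert_space "fibre E u" by (rule fibre_hilbert[OF u])
    have "cnj (M u ?one) = (\<Sum>i\<in>J. \<Sum>j\<in>J. cnj (hinner (fibre E u) (a i u) (a j u)) *
        cnj (hinner (fibre E u) (b j u) (b i u)))"
      unfolding M_def coeff_one[OF aC[OF u] u] by simp
    also have "\<dots> = (\<Sum>i\<in>J. \<Sum>j\<in>J. hinner (fibre E u) (a j u) (a i u) * hinner (fibre E u) (b i u) (b j u))"
      by (intro sum.cong refl arg_cong2[where f = "(*)"] Hu.hinner_commute[symmetric])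
        (use aC[OF u] in \<open>auto simp: Pi_iff\<close>)
    also have "\<dots> = (\<Sum>j\<in>J. \<Sum>i\<in>J. hinner (fibre E u) (a j u) (a i u) * hinner (fibre E u) (b i u) (b j u))"
      by (rule sum.swap)
    also have "\<dots> = M u ?one"
      unfolding M_def coeff_one[OF aC[OF u] u] ..
    finally show ?thesis by (simp add: complex_eq_iff)
  qed
  define N where "N u = Re (M u ?one)" for u
  have N_inf: "N pinf > 1/2"
    using c0[of ?one] \<delta>(2) abs_Re_le_cmod[of "M pinf ?one - 1"] unfolding N_def M_inf by simp
  have N_lim: "(\<lambda>n. N (pt n)) \<longlonglongrightarrow> N pinf"
    unfolding N_def by (intro tendsto_Re M_lim) simp
  have N_pos: "\<forall>\<^sub>F n in sequentially. N (pt n) > 0"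
    by (rule order_tendstoD(1)[OF N_lim]) (use N_inf in simp)
  \<comment> \<open>Where \<open>N u\<close> is 0 the quotient is 0 as well; this can happen only
    over finitely many \<open>n\<close>, where the operator is replaced later.\<close>
  define a' where "a' i = (\<lambda>u\<in>units \<G>. of_real (1 / sqrt (N u)) \<odot>\<^bsub>fibre E u\<^esub> a i u)" for i
  have a': "a' i \<in> csections E" if "i \<in> J" for i
    unfolding a'_def
    by (intro section_smult a(1)[OF that] tendsto_of_real tendsto_divide tendsto_const
        tendsto_real_sqrt N_lim) (use N_inf in simp)
  have coeff': "coeff J (\<lambda>i. a' i u) (\<lambda>i. b i u) u g = M u g / of_real (N u)"
    if "u \<in> units \<G>" "g \<in> carrier \<Gamma>" "N u > 0" for u g
    using coeff_smult[OF aC(1)[OF that(1)] that(1,2), of "1 / sqrt (N u)" "\<lambda>i. b i u"] that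
    by (simp add: a'_def M_def power_divide flip: of_real_power)
  have one: "coeff J (\<lambda>i. a' i u) (\<lambda>i. b i u) u ?one = 1" if "u \<in> units \<G>" "N u > 0" for u
    using coeff'[OF that(1) one_closed that(2)] M_real[OF that(1)] that(2) unfolding N_def
    by (metis divide_self less_irrefl of_real_eq_0_iff)
  have inf: "cmod (coeff J (\<lambda>i. a' i pinf) (\<lambda>i. b i pinf) pinf g - 1) < \<epsilon>" if g: "g \<in> A" for g
  proof -
    \<comment> \<open>Since the rescaled coefficient at the identity is 1, the distance to 1 is a
      difference of two unscaled coefficients over \<open>N pinf\<close>.\<close>
    have "coeff J (\<lambda>i. a' i pinf) (\<lambda>i. b i pinf) pinf g - 1 = (M pinf g - M pinf ?one) / of_real (N pinf)"
      using coeff'[of pinf g] one[of pinf] coeff'[of pinf ?one] g A N_inf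
      by (auto simp: diff_divide_distrib)
    also have "cmod \<dots> = cmod (M pinf g - M pinf ?one) / N pinf"
      using N_inf by (simp add: norm_divide)
    also have "\<dots> \<le> cmod (M pinf g - M pinf ?one) / (1/2)"
      using N_inf by (intro divide_left_mono) auto
    also have "cmod (M pinf g - M pinf ?one) \<le> cmod (M pinf g - 1) + cmod (M pinf ?one - 1)"
      using norm_triangle_ineq4[of "M pinf g - 1" "M pinf ?one - 1"] by simp
    also have "\<dots> < \<delta> + \<delta>"
      unfolding M_inf by (intro add_strict_mono c0) (use g in auto)
    finally show ?thesis using \<delta>(3) by simp
  qed
  have "\<forall>\<^sub>F n in sequentially. cmod (coeff J (\<lambda>i. a' i (pt n)) (\<lambda>i. b i (pt n)) (pt n) g - 1) < \<epsilon>"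
    if g: "g \<in> A" for g
  proof (rule order_tendstoD(2)[OF _ inf[OF g]])
    show "(\<lambda>n. cmod (coeff J (\<lambda>i. a' i (pt n)) (\<lambda>i. b i (pt n)) (pt n) g - 1))
      \<longlonglongrightarrow> cmod (coeff J (\<lambda>i. a' i pinf) (\<lambda>i. b i pinf) pinf g - 1)"
      using g A(2) by (intro tendsto_norm tendsto_diff tendsto_const coeff_tendsto J a' b) auto
  qed
  then have "\<forall>\<^sub>F n in sequentially. \<forall>g\<in>A.
      cmod (coeff J (\<lambda>i. a' i (pt n)) (\<lambda>i. b i (pt n)) (pt n) g - 1) < \<epsilon>"
    using A(1) by (intro eventually_ball_finite) auto
  with N_pos have ev: "\<forall>\<^sub>F n in sequentially. coeff J (\<lambda>i. a' i (pt n)) (\<lambda>i. b i (pt n)) (pt n) ?one = 1 \<and>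
       (\<forall>g\<in>A. cmod (coeff J (\<lambda>i. a' i (pt n)) (\<lambda>i. b i (pt n)) (pt n) g - 1) < \<epsilon>)"
    by eventually_elim (use one in auto)
  show ?thesis
    by (rule that[OF J(1) a' b(1) one inf ev]) (use N_inf in auto)
qed

text \<open>The operator is selected fibre by fibre: the extended one where it has norm 1 and is
  almost invariant, an invariant one elsewhere. The former holds for all large \<open>n\<close>, so
  sections are altered over finitely many points only.\<close>

lemma almost_invariant_operator:
  assumes am: "amenable_rep \<H> Einf (rep_at_infinity \<pi>)"
    and A: "finite A" "A \<subseteq> carrier \<Gamma>" and eps: "\<epsilon> > 0"
  shows "\<exists>T. hilbert_schmidt X E T \<and> bundle_hs_norm X E T \<le> 1 \<and>
    (\<forall>u\<in>units \<G>. hs_norm (fibre E u) (localization X E T u) = 1) \<and>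
    (\<forall>g\<in>A. \<forall>u\<in>units \<G>. cmod (hs_inner (fibre E u)
       (translate \<G> \<pi> (arr g u) (localization X E T u)) (localization X E T u) - 1) < \<epsilon>)"
proof -
  obtain J :: "'v set" and a b where J: "finite J"
    "\<And>i. i \<in> J \<Longrightarrow> a i \<in> csections E" "\<And>i. i \<in> J \<Longrightarrow> b i \<in> csections E"
    and inf: "coeff J (\<lambda>i. a i pinf) (\<lambda>i. b i pinf) pinf \<one>\<^bsub>\<Gamma>\<^esub> = 1"
    "\<And>g. g \<in> A \<Longrightarrow> cmod (coeff J (\<lambda>i. a i pinf) (\<lambda>i. b i pinf) pinf g - 1) < \<epsilon>"
    and ev: "\<forall>\<^sub>F n in sequentially. coeff J (\<lambda>i. a i (pt n)) (\<lambda>i. b i (pt n)) (pt n) \<one>\<^bsub>\<Gamma>\<^esub> = 1 \<and>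
       (\<forall>g\<in>A. cmod (coeff J (\<lambda>i. a i (pt n)) (\<lambda>i. b i (pt n)) (pt n) g - 1) < \<epsilon>)"
    using lift_almost_invariant[OF am A eps] by blast
  define good where "good u R R' \<longleftrightarrow> adjoint_pair (fibre E u) R R' \<and>
      ((\<lambda>e. (hnorm (fibre E u) (R e))\<^sup>2) has_sum 1) (chosen_basis (fibre E u)) \<and>
      (\<forall>g\<in>A. cmod ((\<Sum>\<^sub>\<infinity>e\<in>chosen_basis (fibre E u). hinner (fibre E u)
        (\<pi> (arr g u) (R (\<pi> (arr (inv\<^bsub>\<Gamma>\<^esub> g) u) e))) (R e)) - 1) < \<epsilon>)" for u R R'
  \<comment> \<open>Generic in the index type, as it serves both for basis vectors at infinity and
    for cosets over a finite \<open>n\<close>.\<close>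
  have goodI: "good u (finite_rank (fibre E u) I c d) (finite_rank (fibre E u) I d c)"
    if u: "u \<in> units \<G>" and I: "finite I" "c \<in> I \<rightarrow> carrier (fibre E u)" "d \<in> I \<rightarrow> carrier (fibre E u)"
      and one: "coeff I c d u \<one>\<^bsub>\<Gamma>\<^esub> = 1" and cA: "\<And>g. g \<in> A \<Longrightarrow> cmod (coeff I c d u g - 1) < \<epsilon>"
    for u and I :: "'i set" and c d
  proof -
    interpret H: complex_hilbert_space "fibre E u" by (rule fibre_hilbert[OF u])
    show ?thesis unfolding good_def
    proof (intro conjI ballI)
      show "adjoint_pair (fibre E u) (finite_rank (fibre E u) I c d) (finite_rank (fibre E u) I d c)"
        by (rule H.adjoint_pair_finite_rank[OF I])
      show "((\<lambda>e. (hnorm (fibre E u) (finite_rank (fibre E u) I c d e))\<^sup>2) has_sum 1) (chosen_basis (fibre E u))"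
        by (rule coeff_one_has_sum[OF I u one H.chosen_basis])
      fix g assume g: "g \<in> A"
      then have "g \<in> carrier \<Gamma>" using A by blast
      from infsumI[OF coeff_has_sum[OF I u this H.chosen_basis]] cA[OF g]
      show "cmod ((\<Sum>\<^sub>\<infinity>e\<in>chosen_basis (fibre E u). hinner (fibre E u)
        (\<pi> (arr g u) (finite_rank (fibre E u) I c d (\<pi> (arr (inv\<^bsub>\<Gamma>\<^esub> g) u) e)))
        (finite_rank (fibre E u) I c d e)) - 1) < \<epsilon>" by simp
    qed
  qed
  let ?R = "\<lambda>u. finite_rank (fibre E u) J (\<lambda>i. a i u) (\<lambda>i. b i u)"
  let ?R' = "\<lambda>u. finite_rank (fibre E u) J (\<lambda>i. b i u) (\<lambda>i. a i u)"
  have JC: "(\<lambda>i. a i u) \<in> J \<rightarrow> carrier (fibre E u)" "(\<lambda>i. b i u) \<in> J \<rightarrow> carrier (fibre E u)"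
    if "u \<in> units \<G>" for u using J that section_value by auto
  have good_inf: "good pinf (?R pinf) (?R' pinf)"
    by (rule goodI[OF pinf_units J(1) JC[OF pinf_units] inf])
  have good_ev: "\<forall>\<^sub>F n in sequentially. good (pt n) (?R (pt n)) (?R' (pt n))"
    using ev by eventually_elim (rule goodI[OF pt_units J(1) JC[OF pt_units]], auto)
  have "\<exists>R R'. good (pt n) R R'" for n
  proof -
    obtain I :: "'a set set" and c d where I: "finite I" "c \<in> I \<rightarrow> carrier (fibre E (pt n))"
      "d \<in> I \<rightarrow> carrier (fibre E (pt n))" "\<And>g. g \<in> carrier \<Gamma> \<Longrightarrow> coeff I c d (pt n) g = 1"
      using invariant_operator[of n] by blast
    have "good (pt n) (finite_rank (fibre E (pt n)) I c d) (finite_rank (fibre E (pt n)) I d c)"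
      using A eps by (intro goodI pt_units I(1,2,3)) (auto simp: I(4) subset_iff)
    then show ?thesis by blast
  qed
  then obtain P P' where P: "\<And>n. good (pt n) (P n) (P' n)" by metis
  \<comment> \<open>The same test decides for the operator and for its adjoint, so the selected pair
    remains adjoint in each fibre.\<close>
  define fixup where "fixup Q Z u = (case u of
      At n c \<Rightarrow> if good u (?R u) (?R' u) then Q u else Z n | AtInfty g \<Rightarrow> Q u)"
    for Q :: "'a hls \<Rightarrow> 'v \<Rightarrow> 'v" and Z u
  define R where "R = fixup ?R P"
  define R' where "R' = fixup ?R' P'"
  have good: "good u (R u) (R' u)" if "u \<in> units \<G>" for u
    using that by (cases rule: units_cases) (use P good_inf in \<open>auto simp: R_def R'_def fixup_def\<close>)
  have sec: "(\<lambda>u\<in>units \<G>. fixup Q Z u (\<xi> u)) \<in> csections E"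
    if Q: "(\<lambda>u\<in>units \<G>. Q u (\<xi> u)) \<in> csections E"
      and cl: "\<And>u. u \<in> units \<G> \<Longrightarrow> fixup Q Z u (\<xi> u) \<in> carrier (fibre E u)" for Q Z \<xi>
  proof (rule section_modify[OF _ Q])
    show "(\<lambda>u\<in>units \<G>. fixup Q Z u (\<xi> u)) \<in> (\<Pi>\<^sub>E u\<in>units \<G>. carrier (fibre E u))"
      using cl by auto
    show "\<forall>\<^sub>F n in sequentially. (\<lambda>u\<in>units \<G>. fixup Q Z u (\<xi> u)) (pt n) = (\<lambda>u\<in>units \<G>. Q u (\<xi> u)) (pt n)"
      using good_ev by eventually_elim (simp add: fixup_def)
  qed (simp add: fixup_def)
  have pair: "adjoint_pair (fibre E u) (R u) (R' u)" if "u \<in> units \<G>" for u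
    using good[OF that] by (simp add: good_def)
  have RC: "R u v \<in> carrier (fibre E u)" "R' u v \<in> carrier (fibre E u)"
    if "u \<in> units \<G>" "v \<in> carrier (fibre E u)" for u v
    using pair[OF that(1)] that(2) by (auto simp: adjoint_pair_def)
  define T where "T = (\<lambda>\<xi>. \<lambda>u\<in>units \<G>. R u (\<xi> u))"
  have s1: "(\<lambda>u\<in>units \<G>. R u (\<xi> u)) \<in> csections E" if "\<xi> \<in> csections E" for \<xi>
    unfolding R_def using RC(1) section_value[OF that]
    by (intro sec section_finite_rank J that) (auto simp: R_def)
  have s2: "(\<lambda>u\<in>units \<G>. R' u (\<xi> u)) \<in> csections E" if "\<xi> \<in> csections E" for \<xi>
    unfolding R'_def using RC(2) section_value[OF that]
    by (intro sec section_finite_rank J that) (auto simp: R'_def)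
  have nrm: "((\<lambda>e. (hnorm (fibre E u) (R u e))\<^sup>2) has_sum 1) (chosen_basis (fibre E u))"
    if "u \<in> units \<G>" for u using good[OF that] by (simp add: good_def)
  note T = fibrewise_operator[of R R', OF pair s1 s2 nrm T_def]
  have loc: "localization X E T u v = R u v" if "u \<in> units \<G>" "v \<in> carrier (fibre E u)" for u v
    by (rule T(4)) (use that in auto)
  have "cmod (hs_inner (fibre E u)
       (translate \<G> \<pi> (arr g u) (localization X E T u)) (localization X E T u) - 1) < \<epsilon>"
    if g: "g \<in> A" and u: "u \<in> units \<G>" for g u
  proof -
    have gC: "g \<in> carrier \<Gamma>" using g A by blast
    interpret H: complex_hilbert_space "fibre E u" by (rule fibre_hilbert[OF u])
    have "adjoint_pair (fibre E u) (localization X E T u) (R' u)"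
      using pair[OF u] loc[OF u] by (auto simp: adjoint_pair_def Pi_iff)
    from hs_inner_translate[OF gC u this]
    have "hs_inner (fibre E u) (translate \<G> \<pi> (arr g u) (localization X E T u)) (localization X E T u)
      = (\<Sum>\<^sub>\<infinity>e\<in>chosen_basis (fibre E u). hinner (fibre E u)
        (\<pi> (arr g u) (localization X E T u (\<pi> (arr (inv\<^bsub>\<Gamma>\<^esub> g) u) e))) (localization X E T u e))"
      by (simp only: translate_arr[OF gC u])
    also have "\<dots> = (\<Sum>\<^sub>\<infinity>e\<in>chosen_basis (fibre E u). hinner (fibre E u)
        (\<pi> (arr g u) (R u (\<pi> (arr (inv\<^bsub>\<Gamma>\<^esub> g) u) e))) (R u e))"
      by (rule infsum_cong)
        (simp only: loc[OF u] H.chosen_basis_carrier rep_arr_closed[OF inv_closed[OF gC] u])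
    finally show ?thesis using good[OF u] g by (simp add: good_def)
  qed
  moreover have "hilbert_schmidt X E T" "bundle_hs_norm X E T \<le> 1" by (rule T, assumption+)+
  moreover have "hs_norm (fibre E u) (localization X E T u) = 1" if "u \<in> units \<G>" for u
    by (rule T(3)) (use that in auto)
  ultimately show ?thesis by blast
qed

text \<open>Increasing finite sets \<open>A n\<close> exhaust the group, and an operator is chosen
  for \<open>A n\<close> with tolerance \<open>1 / Suc n\<close>; the image of the sequential filter
  is the required net. All estimates are uniform over the units, so only the group elements
  occurring in a compact set matter.\<close>

lemma amenable_from_infinity:
  assumes am: "amenable_rep \<H> Einf (rep_at_infinity \<pi>)" and cnt: "countable (carrier \<Gamma>)"
  shows "amenable_rep \<G> E \<pi>"
proof -
  \<comment> \<open>The enumeration may repeat elements, so a finite group is covered too.\<close>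
  define A where "A n = from_nat_into (carrier \<Gamma>) ` {..n}" for n :: nat
  have ne: "carrier \<Gamma> \<noteq> {}" using one_closed by blast
  have A: "finite (A n)" "A n \<subseteq> carrier \<Gamma>" for n
    using from_nat_into[OF ne] by (auto simp: A_def)
  have exhaust: "\<forall>\<^sub>F n in sequentially. C \<subseteq> A n" if "finite C" "C \<subseteq> carrier \<Gamma>" for C
  proof -
    have "\<forall>\<^sub>F n in sequentially. g \<in> A n" if "g \<in> C" for g
    proof -
      have "g \<in> carrier \<Gamma>" using that \<open>C \<subseteq> carrier \<Gamma>\<close> by blast
      from from_nat_into_surj[OF cnt this] obtain k where k: "from_nat_into (carrier \<Gamma>) k = g" ..
      have "g \<in> A n" if "k \<le> n" for n
        unfolding A_def k[symmetric] by (rule imageI) (use that in simp)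
      then show ?thesis unfolding eventually_sequentially by blast
    qed
    then have "\<forall>\<^sub>F n in sequentially. \<forall>g\<in>C. g \<in> A n"
      using \<open>finite C\<close> by (intro eventually_ball_finite) auto
    then show ?thesis by eventually_elim blast
  qed
  have "\<exists>T. hilbert_schmidt X E T \<and> bundle_hs_norm X E T \<le> 1 \<and>
    (\<forall>u\<in>units \<G>. hs_norm (fibre E u) (localization X E T u) = 1) \<and>
    (\<forall>g\<in>A n. \<forall>u\<in>units \<G>. cmod (hs_inner (fibre E u)
       (translate \<G> \<pi> (arr g u) (localization X E T u)) (localization X E T u) - 1) < 1 / real (Suc n))" for n
    by (rule almost_invariant_operator[OF am A]) simp
  then obtain T where T: "\<And>n. hilbert_schmidt X E (T n)" "\<And>n. bundle_hs_norm X E (T n) \<le> 1"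
    "\<And>n u. u \<in> units \<G> \<Longrightarrow> hs_norm (fibre E u) (localization X E (T n) u) = 1"
    "\<And>n g u. g \<in> A n \<Longrightarrow> u \<in> units \<G> \<Longrightarrow> cmod (hs_inner (fibre E u)
       (translate \<G> \<pi> (arr g u) (localization X E (T n) u)) (localization X E (T n) u) - 1) < 1 / real (Suc n)"
    by metis
  define F where "F = filtermap T sequentially"
  have "F \<noteq> bot" by (simp add: F_def filtermap_bot_iff)
  moreover have "\<forall>\<^sub>F S in F. hilbert_schmidt X E S \<and> bundle_hs_norm X E S \<le> 1"
    unfolding F_def eventually_filtermap using T(1,2) by simp
  moreover have "uniform_limit C (\<lambda>S u. hs_norm (fibre E u) (localization X E S u)) (\<lambda>_. 1) F"
    if "compactin X C" for C
  proof -
    have "C \<subseteq> units \<G>" using compactin_subset_topspace[OF that] by simp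
    then show ?thesis
      unfolding uniform_limit_iff F_def eventually_filtermap using T(3) by (auto simp: subset_iff)
  qed
  moreover have "uniform_limit C (\<lambda>S x. hs_inner (fibre E (grng \<G> x))
      (translate \<G> \<pi> x (localization X E S (gdom \<G> x))) (localization X E S (grng \<G> x))) (\<lambda>_. 1) F"
    if C: "compactin (gtop \<G>) C" for C
    unfolding uniform_limit_iff F_def eventually_filtermap
  proof (intro allI impI)
    fix \<epsilon> :: real assume eps: "\<epsilon> > 0"
    obtain D where D: "finite D" "D \<subseteq> carrier \<Gamma>"
      "\<And>x. x \<in> C \<Longrightarrow> \<exists>g\<in>D. \<exists>u\<in>units \<G>. x = arr g u"
      using compact_arrows[OF C] by blast
    have "\<forall>\<^sub>F n in sequentially. 1 / real (Suc n) < \<epsilon>"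
      using LIMSEQ_inverse_real_of_nat eps by (auto dest: order_tendstoD simp: inverse_eq_divide)
    with exhaust[OF D(1,2)]
    show "\<forall>\<^sub>F n in sequentially. \<forall>x\<in>C. dist (hs_inner (fibre E (grng \<G> x))
      (translate \<G> \<pi> x (localization X E (T n) (gdom \<G> x))) (localization X E (T n) (grng \<G> x))) 1 < \<epsilon>"
    proof eventually_elim
      case (elim n)
      show ?case
      proof
        fix x assume "x \<in> C"
        then obtain g u where gu: "g \<in> D" "u \<in> units \<G>" "x = arr g u" using D(3) by blast
        then have "g \<in> A n" using elim(1) by blast
        from less_trans[OF T(4)[OF this gu(2)] elim(2)]
        show "dist (hs_inner (fibre E (grng \<G> x))
          (translate \<G> \<pi> x (localization X E (T n) (gdom \<G> x))) (localization X E (T n) (grng \<G> x))) 1 < \<epsilon>"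
          unfolding gu(3) grng_eq gdom_eq base_arr[OF gu(2)] dist_norm .
      qed
    qed
  qed
  ultimately show ?thesis unfolding amenable_rep_def Let_def by blast
qed

text \<open>The net is pushed forward along \<open>\<Phi>\<close>, which regards the localization at
  \<open>pinf\<close> as an operator on sections over the point. Compact sets of the group are
  finite and embed as finite sets of arrows at infinity.\<close>

lemma amenable_at_infinity:
  assumes am: "amenable_rep \<G> E \<pi>"
  shows "amenable_rep \<H> Einf (rep_at_infinity \<pi>)"
proof -
  let ?H = "fibre E pinf"
  interpret H: complex_hilbert_space ?H by (rule fibre_hilbert) simp
  define \<Phi> where "\<Phi> T = (\<lambda>\<xi>. \<lambda>u\<in>{\<one>\<^bsub>\<Gamma>\<^esub>}. localization X E T pinf (\<xi> u))" for T :: "('a hls \<Rightarrow> 'v) \<Rightarrow> 'a hls \<Rightarrow> 'v"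
  have loc: "localization Y Einf (\<Phi> T) \<one>\<^bsub>\<Gamma>\<^esub> = localization X E T pinf" for T
  proof
    fix v
    show "localization Y Einf (\<Phi> T) \<one>\<^bsub>\<Gamma>\<^esub> v = localization X E T pinf v"
    proof (cases "v \<in> carrier ?H")
      case True
      then have "(\<lambda>u\<in>{\<one>\<^bsub>\<Gamma>\<^esub>}. v) \<in> C0_sections Y Einf"
        unfolding C0_sections_Y by (simp add: restrict_PiE_iff)
      then have "(\<exists>\<xi>\<in>C0_sections Y Einf. \<xi> \<one>\<^bsub>\<Gamma>\<^esub> = v \<and> \<Phi> T \<xi> \<one>\<^bsub>\<Gamma>\<^esub> = w) \<longleftrightarrow>
          w = localization X E T pinf v" for w
        by (auto simp: \<Phi>_def intro!: rev_bexI[of "\<lambda>u\<in>{\<one>\<^bsub>\<Gamma>\<^esub>}. v"])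
      then show ?thesis unfolding localization_def[of Y] by simp
    next
      \<comment> \<open>Outside the carrier no section has the value \<open>v\<close>, so both sides
        are \<open>THE\<close> of the same empty predicate. The equality therefore holds between
        functions and for every \<open>T\<close>, and can be rewritten with freely.\<close>
      case False
      then have "(\<exists>\<xi>\<in>C0_sections Y Einf. \<xi> \<one>\<^bsub>\<Gamma>\<^esub> = v \<and> \<Phi> T \<xi> \<one>\<^bsub>\<Gamma>\<^esub> = w) \<longleftrightarrow>
          (\<exists>\<xi>\<in>C0_sections X E. \<xi> pinf = v \<and> T \<xi> pinf = w)" for w
        unfolding C0_sections_Y C0_sections_eq using section_value[OF _ pinf_units] by auto
      then show ?thesis unfolding localization_def by simp
    qed
  qed
  obtain F where F: "F \<noteq> bot"
    and hs: "\<forall>\<^sub>F T in F. hilbert_schmidt X E T \<and> bundle_hs_norm X E T \<le> 1"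
    and lim1: "\<And>C. compactin X C \<Longrightarrow> uniform_limit C
      (\<lambda>T u. hs_norm (fibre E u) (localization X E T u)) (\<lambda>_. 1) F"
    and lim2: "\<And>C. compactin (gtop \<G>) C \<Longrightarrow> uniform_limit C
             (\<lambda>T x. hs_inner (fibre E (grng \<G> x))
                (translate \<G> \<pi> x (localization X E T (gdom \<G> x)))
                (localization X E T (grng \<G> x))) (\<lambda>_. 1) F"
    using am unfolding amenable_rep_def Let_def by blast
  have HS: "hilbert_schmidt Y Einf (\<Phi> T)" "bundle_hs_norm Y Einf (\<Phi> T) \<le> 1"
    if T: "hilbert_schmidt X E T" "bundle_hs_norm X E T \<le> 1" for T
  proof -
    have "\<exists>S'. adjoint_pair ?H (localization X E T pinf) S'"
      by (rule localization_adjoint_pair(2))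
        (use T(1) H.complex_hilbert_space_axioms section_through section_value in
          \<open>auto simp: C0_sections_eq hilbert_schmidt_def\<close>)
    then obtain S' where S: "adjoint_pair ?H (localization X E T pinf) S'" by blast
    have "adjointable Y Einf (\<Phi> T)"
      unfolding adjointable_def C0_sections_Y topspace_Y
    proof (intro conjI bexI[of _ "\<lambda>\<xi>. \<lambda>u\<in>{\<one>\<^bsub>\<Gamma>\<^esub>}. S' (\<xi> u)"] ballI)
    qed (use S in \<open>auto simp: \<Phi>_def adjoint_pair_def Pi_iff PiE_iff\<close>)
    moreover have "finite_htrace ?H (abs_square ?H (localization X E T pinf))"
      using T(1) by (simp add: hilbert_schmidt_def)
    ultimately show "hilbert_schmidt Y Einf (\<Phi> T)"
      unfolding hilbert_schmidt_def using C0_Y by (simp add: loc)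
    \<comment> \<open>The supremum in \<open>bundle_hs_norm\<close> dominates the value at
      \<open>pinf\<close> only if the norms are bounded; continuity of the trace on the compact unit
      space provides this.\<close>
    let ?t = "\<lambda>u. htrace (fibre E u) (abs_square (fibre E u) (localization X E T u))"
    have "continuous_map X euclidean ?t"
      using T(1) by (simp add: hilbert_schmidt_def C0_def)
    then have "compactin euclidean (?t ` units \<G>)"
      by (rule image_compactin[OF compact_X])
    then have "bounded (?t ` units \<G>)" by (simp add: compact_imp_bounded)
    then obtain M where M: "\<And>u. u \<in> units \<G> \<Longrightarrow> cmod (?t u) \<le> M"
      unfolding bounded_iff by auto
    have "hs_norm (fibre E u) (localization X E T u) \<le> sqrt M" if "u \<in> units \<G>" for u
      unfolding hs_norm_def using M[OF that] complex_Re_le_cmod[of "?t u"]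
      by (intro real_sqrt_le_mono) linarith
    then have "bdd_above ((\<lambda>u. hs_norm (fibre E u) (localization X E T u)) ` units \<G>)"
      by (rule bdd_aboveI2)
    then have "hs_norm ?H (localization X E T pinf) \<le> bundle_hs_norm X E T"
      unfolding bundle_hs_norm_def topspace_X by (rule cSUP_upper[OF pinf_units])
    then show "bundle_hs_norm Y Einf (\<Phi> T) \<le> 1"
      using T(2) by (simp add: bundle_hs_norm_Y loc)
  qed
  define F' where "F' = filtermap \<Phi> F"
  have "F' \<noteq> bot" using F by (simp add: F'_def filtermap_bot_iff)
  moreover have "\<forall>\<^sub>F S in F'. hilbert_schmidt Y Einf S \<and> bundle_hs_norm Y Einf S \<le> 1"
    unfolding F'_def eventually_filtermap using hs by eventually_elim (use HS in blast)
  moreover have "uniform_limit C (\<lambda>S u. hs_norm (fibre Einf u) (localization Y Einf S u)) (\<lambda>_. 1) F'"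
    if "compactin Y C" for C
  proof -
    have C: "C \<subseteq> {\<one>\<^bsub>\<Gamma>\<^esub>}" using compactin_subset_topspace[OF that] by simp
    have "uniform_limit {pinf} (\<lambda>T u. hs_norm (fibre E u) (localization X E T u)) (\<lambda>_. 1) F"
      by (rule lim1) simp
    then have near: "\<forall>\<^sub>F T in F. dist (hs_norm ?H (localization X E T pinf)) 1 < \<epsilon>" if "\<epsilon> > 0" for \<epsilon>
      using that by (auto simp: uniform_limit_iff)
    show ?thesis
      unfolding uniform_limit_iff F'_def eventually_filtermap
    proof (intro allI impI)
      fix \<epsilon> :: real assume "\<epsilon> > 0"
      then have "\<forall>\<^sub>F T in F. dist (hs_norm ?H (localization X E T pinf)) 1 < \<epsilon>"
        by (rule near)
      then show "\<forall>\<^sub>F T in F. \<forall>u\<in>C.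
          dist (hs_norm (fibre Einf u) (localization Y Einf (\<Phi> T) u)) 1 < \<epsilon>"
        by eventually_elim (use C loc in \<open>auto simp: subset_singleton_iff\<close>)
    qed
  qed
  moreover have "uniform_limit C (\<lambda>S x. hs_inner (fibre Einf (grng \<H> x))
      (translate \<H> (rep_at_infinity \<pi>) x (localization Y Einf S (gdom \<H> x)))
      (localization Y Einf S (grng \<H> x))) (\<lambda>_. 1) F'"
    if "compactin (gtop \<H>) C" for C
  proof -
    have C: "finite C" "C \<subseteq> carrier \<Gamma>"
      using that by (simp_all add: group_groupoid_def compactin_discrete_topology)
    have dom: "gdom \<H> x = \<one>\<^bsub>\<Gamma>\<^esub>" "grng \<H> x = \<one>\<^bsub>\<Gamma>\<^esub>" for x by (simp_all add: group_groupoid_def)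
    have "compactin (gtop \<G>) ((\<lambda>g. arr g pinf) ` C)"
      using C arr_arrow[OF _ pinf_units] by (intro finite_imp_compactin) auto
    from lim2[OF this] have near: "\<forall>\<^sub>F T in F. \<forall>g\<in>C. dist (hs_inner ?H
        (translate \<G> \<pi> (arr g pinf) (localization X E T pinf)) (localization X E T pinf)) 1 < \<epsilon>" if "\<epsilon> > 0" for \<epsilon>
      using that unfolding uniform_limit_iff by (simp del: arr.simps add: base_arr)
    have eq: "translate \<H> (rep_at_infinity \<pi>) g S = translate \<G> \<pi> (arr g pinf) S" if "g \<in> C" for g S
      unfolding translate_infinity by (rule translate_arr[symmetric]) (use that C in auto)
    have "\<forall>\<^sub>F T in F. \<forall>g\<in>C. dist (hs_inner ?H
        (translate \<H> (rep_at_infinity \<pi>) g (localization X E T pinf)) (localization X E T pinf)) 1 < \<epsilon>"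
      if "\<epsilon> > 0" for \<epsilon>
      using near[OF that]
    proof eventually_elim
      case (elim T)
      show ?case
      proof
        fix g assume g: "g \<in> C"
        show "dist (hs_inner ?H (translate \<H> (rep_at_infinity \<pi>) g (localization X E T pinf))
            (localization X E T pinf)) 1 < \<epsilon>"
          unfolding eq[OF g] using bspec[OF elim g] .
      qed
    qed
    then show ?thesis
      unfolding uniform_limit_iff F'_def eventually_filtermap dom fibre_infinity loc
      by (intro allI impI)
  qed
  ultimately show ?thesis unfolding amenable_rep_def Let_def by blast
qed

end

theorem lemma5p2:
  fixes \<Gamma> :: "('a, 'm) monoid_scheme" and K :: "nat \<Rightarrow> 'a set"
    and E :: "('a hls, 'v) hilbert_bundle" and \<pi> :: "'a hls \<Rightarrow> 'v \<Rightarrow> 'v"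
  assumes "approximated_group \<Gamma> K" and "countable (carrier \<Gamma>)"
    and "continuous_unitary_rep (hls_groupoid \<Gamma> K) E \<pi>"
  shows "amenable_rep (hls_groupoid \<Gamma> K) E \<pi> \<longleftrightarrow>
    amenable_rep (group_groupoid \<Gamma>) (bundle_at_infinity \<Gamma> E) (rep_at_infinity \<pi>)"
proof -
  interpret hls_representation \<Gamma> K E \<pi>
    using assms by (simp add: hls_representation_def)
  show ?thesis
    using amenable_at_infinity amenable_from_infinity assms(2) by blast
qed

end
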